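(* Let $4<p<6$ and $\alpha>0$. Then there exists $\mu^*=\mu^*(\alpha)<\|\phi_{\alpha^2}\|_{L^2(\mathbb{R})}^2$ such that bound states of mass $\mu$ exist if and only if $\mu\geq\mu^*$. In particular, two positive bound states of mass $\mu$ exist if and only if $\mu^*<\mu<\|\phi_{\alpha^2}\|_{L^2(\mathbb{R})}^2$. Moreover, there exists $\widetilde{\mu}=\widetilde{\mu}(\alpha)$ satisfying $\mu^*<\widetilde{\mu}<\|\phi_{\alpha^2}\|_{L^2(\mathbb{R})}^2$ such that ground states of $F$ at mass $\mu$ exist if and only if $\mu\geq\widetilde{\mu}$. Whenever they exist, the positive ground state is unique.
   Context: Let $\mathbb{R}^+=(0,+\infty)$. For $p\in(2,6]$ and $\alpha\in\mathbb{R}$, the energy is $$F(u)=\frac12\int_0^{+\infty}|u'|^2\,dx-\frac1p\int_0^{+\infty}|u|^p\,dx+\frac{\alpha}{2}|u(0)|^2,\qquad u\in H^1(\mathbb{R}^+),$$ where $u(0)$ is the value at $0$ of the continuous representative of $u$. For $\mu>0$, $H^1_\mu(\mathbb{R}^+):=\{u\in H^1(\mathbb{R}^+):\int_0^{+\infty}|u|^2\,dx=\mu\}$ and $\mathcal{F}(\mu):=\inf_{u\in H^1_\mu(\mathbb{R}^+)}F(u)$. A ground state of $F$ at mass $\mu$ is a function $u\in H^1_\mu(\mathbb{R}^+)$ with $F(u)=\mathcal{F}(\mu)$. Functions are real-valued (this is not restrictive). Masses $\mu$ are always positive. A bound state is a real-valued $u\in H^1(\mathbb{R}^+)$ which, for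 some $\omega>0$, solves $$-u''-|u|^{p-2}u+\omega u=0\ \text{ on }\mathbb{R}^+,\qquad u'(0)=\alpha u(0);$$ its mass is $\int_0^{+\infty}|u|^2\,dx$. "Two positive bound states" means two distinct ones. For $\omega>0$, the soliton at frequency $\omega$ is $$\phi_\omega(x)=\left[\frac p2\,\omega\,\mathrm{sech}^2\left(\left(\frac p2-1\right)\sqrt{\omega}\,|x|\right)\right]^{\frac1{p-2}},\qquad x\in\mathbb{R}.$$ *)

theory Defs
  imports "HOL-Analysis.Analysis" "HOL-Library.FuncSet"
begin

text \<open>
  The half-line is \<open>{0<..}\<close>. An element of the Sobolev space is an equivalence class of functions
  modulo equality almost everywhere; since in dimension one each class has exactly one
  representative that is continuous on \<open>{0..}\<close>, the class is represented here by that function,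
  made \<^const>\<open>extensional\<close> (a fixed junk value on the negative reals). Hence equality of elements of
  \<open>H1_half\<close> is equality in the Sobolev space, and the boundary value is just \<open>u 0\<close>.
\<close>

definition L2_half :: "(real \<Rightarrow> real) \<Rightarrow> bool" where
  "L2_half v \<longleftrightarrow>
     set_borel_measurable lborel {0<..} v \<and> set_integrable lborel {0<..} (\<lambda>x. \<bar>v x\<bar>\<^sup>2)"

text \<open>Test functions are \<open>C\<^sup>1\<close> with compact support in the open half-line; smooth ones give the
  same weak derivatives.\<close>

definition test_fun_half :: "(real \<Rightarrow> real) \<Rightarrow> (real \<Rightarrow> real) \<Rightarrow> bool" where
  "test_fun_half f f' \<longleftrightarrow>
     (\<forall>x. (f has_real_derivative f' x) (at x)) \<and> continuous_on UNIV f' \<and>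
     (\<exists>a b. 0 < a \<and> a \<le> b \<and> (\<forall>x. x \<notin> {a..b} \<longrightarrow> f x = 0))"

definition weak_deriv_half :: "(real \<Rightarrow> real) \<Rightarrow> (real \<Rightarrow> real) \<Rightarrow> bool" where
  "weak_deriv_half u v \<longleftrightarrow>
     (\<forall>f f'. test_fun_half f f' \<longrightarrow>
        (LINT x:{0<..}|lborel. u x * f' x) = - (LINT x:{0<..}|lborel. v x * f x))"

definition H1_half :: "(real \<Rightarrow> real) set" where
  "H1_half = {u \<in> extensional {0..}. continuous_on {0..} u \<and> L2_half u \<and>
                (\<exists>v. L2_half v \<and> weak_deriv_half u v)}"

text \<open>Determined up to a null set, so that its integrals do not depend on the choice.\<close>

definition wderiv :: "(real \<Rightarrow> real) \<Rightarrow> real \<Rightarrow> real" where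
  "wderiv u = (SOME v. L2_half v \<and> weak_deriv_half u v)"

definition mass :: "(real \<Rightarrow> real) \<Rightarrow> real" where
  "mass u = (LINT x:{0<..}|lborel. \<bar>u x\<bar>\<^sup>2)"

definition H1_mass :: "real \<Rightarrow> (real \<Rightarrow> real) set" where
  "H1_mass \<mu> = {u \<in> H1_half. mass u = \<mu>}"

definition energy :: "real \<Rightarrow> real \<Rightarrow> (real \<Rightarrow> real) \<Rightarrow> real" where
  "energy p \<alpha> u =
     1 / 2 * (LINT x:{0<..}|lborel. \<bar>wderiv u x\<bar>\<^sup>2)
     - 1 / p * (LINT x:{0<..}|lborel. \<bar>u x\<bar> powr p)
     + \<alpha> / 2 * \<bar>u 0\<bar>\<^sup>2"

text \<open>The infimum is taken in the extended reals, so that it is meaningful without knowing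
  beforehand that the energy is bounded below.\<close>

definition energy_level :: "real \<Rightarrow> real \<Rightarrow> real \<Rightarrow> ereal" where
  "energy_level p \<alpha> \<mu> = (INF u\<in>H1_mass \<mu>. ereal (energy p \<alpha> u))"

definition ground_states :: "real \<Rightarrow> real \<Rightarrow> real \<Rightarrow> (real \<Rightarrow> real) set" where
  "ground_states p \<alpha> \<mu> =
     {u \<in> H1_mass \<mu>. ereal (energy p \<alpha> u) = energy_level p \<alpha> \<mu>}"

text \<open>The equation holds classically; at \<open>0\<close> the derivative of \<open>u\<close> is one-sided.\<close>

definition solves_nls_half :: "real \<Rightarrow> real \<Rightarrow> real \<Rightarrow> (real \<Rightarrow> real) \<Rightarrow> bool" where
  "solves_nls_half p \<alpha> \<omega> u \<longleftrightarrow>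
     (\<exists>u' u''.
        (\<forall>x\<ge>0. (u has_real_derivative u' x) (at x within {0..})) \<and>
        (\<forall>x>0. (u' has_real_derivative u'' x) (at x)) \<and>
        (\<forall>x>0. - u'' x - \<bar>u x\<bar> powr (p - 2) * u x + \<omega> * u x = 0) \<and>
        u' 0 = \<alpha> * u 0)"

definition bound_states :: "real \<Rightarrow> real \<Rightarrow> real \<Rightarrow> (real \<Rightarrow> real) set" where
  "bound_states p \<alpha> \<mu> = {u \<in> H1_mass \<mu>. \<exists>\<omega>>0. solves_nls_half p \<alpha> \<omega> u}"

definition positive_half :: "(real \<Rightarrow> real) \<Rightarrow> bool" where
  "positive_half u \<longleftrightarrow> (\<forall>x>0. u x > 0)"

definition soliton :: "real \<Rightarrow> real \<Rightarrow> real \<Rightarrow> real" where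
  "soliton p \<omega> x =
     (p / 2 * \<omega> * (1 / cosh ((p / 2 - 1) * sqrt \<omega> * \<bar>x\<bar>))\<^sup>2) powr (1 / (p - 2))"

definition soliton_mass :: "real \<Rightarrow> real \<Rightarrow> real" where
  "soliton_mass p \<omega> = (LINT x|lborel. \<bar>soliton p \<omega> x\<bar>\<^sup>2)"

end

theory Submission imports Defs begin

text \<open>
  Write \<open>b = 2 / (p - 2)\<close>, so that \<open>1/2 < b < 1\<close>, and \<open>\<omega> = \<sigma>\<^sup>2\<close>. By the first integral
  \<open>u'\<^sup>2 = \<omega> u\<^sup>2 - 2/p |u|\<^sup>p\<close> and the resulting Riccati equation for \<open>u'/u\<close>, the bound states are, up to
  sign, the solitons centred at \<open>b T / \<sigma>\<close> with \<open>tanh T = \<alpha> / \<sigma>\<close>, one for each \<open>\<sigma> > \<alpha>\<close>. Their mass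
  first decreases and then increases in \<open>\<sigma>\<close>, from the mass of the soliton of frequency \<open>\<alpha>\<^sup>2\<close> to infinity.

  No compactness is needed for the ground states. Given \<open>u\<close> of mass \<open>\<mu>\<close>, choose \<open>\<sigma>\<close> such that the soliton
  of frequency \<open>\<sigma>\<^sup>2\<close> has maximum \<open>max |u|\<close>. Then \<open>2 W (u) = \<sigma>\<^sup>2 u\<^sup>2 - 2/p |u|\<^sup>p\<close> is nonnegative,
  and \<open>u'\<^sup>2 / 2 + W (u) \<ge> |u'| sqrt (2 W (u))\<close> bounds the energy below by an explicit function of \<open>\<sigma>\<close> and
  \<open>u 0\<close>. Minimising over \<open>u 0\<close> leaves a function of \<open>\<sigma>\<close>, the envelope, whose derivative is
  \<open>\<sigma> (M \<sigma> - \<mu>)\<close>, where \<open>M \<sigma>\<close> is the mass of the full soliton for \<open>\<sigma> \<le> \<alpha>\<close> and that of the bound state for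
  \<open>\<sigma> > \<alpha>\<close>. Its values are attained by the bound states when \<open>\<sigma> > \<alpha>\<close>, and only approached, by solitons
  escaping to infinity, when \<open>\<sigma> \<le> \<alpha>\<close>. Hence ground states exist exactly when the envelope has a minimiser
  beyond \<open>\<alpha>\<close>, and the difference of its two local minima is strictly decreasing in \<open>\<mu>\<close>.
\<close>

section \<open>Weak derivatives on the half-line\<close>

text \<open>The bounds on p enter through b. From p < 6 comes 2 b > 1, so that the mass of the whole
  soliton grows with the frequency; from p > 4 comes b < 1, so that \<open>mass_slope\<close> is
  strictly increasing and the mass curve turns exactly once beyond \<alpha>. The envelope is affine
  in \<mu> with slope - \<sigma>^2 / 2, hence raising the mass favours the local minimum of larger
  frequency, the one beyond \<alpha>. The obstacle is the equality case. An H1 function is only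
  absolutely continuous, and |u'| = sqrt (2 W (u)) almost everywhere does not determine u: the right
  side vanishes at the maximum like a square root, so u could rest there. The equality is therefore
  used only through Lipschitz bounds. With a logarithm it shows that u cannot leave the value 0,
  which excludes minimisers with \<sigma> \<le> \<alpha>. With arcosh it shows that |u| lies above
  the soliton that peaks at the same point; boundary value and mass then push the centre of that
  soliton in opposite directions and leave only the bound state.\<close>

lemma AE_zero_if_interval_integrals_zero:
  fixes f :: "real \<Rightarrow> real"
  assumes f: "integrable lborel f"
    and zero: "\<And>a b. a \<le> b \<Longrightarrow> (LINT x:{a..b}|lborel. f x) = 0"
  shows "AE x in lborel. f x = 0"
proof -
  have int: "set_integrable lborel A f" if "A \<in> sets borel" for A
    using f that unfolding set_integrable_def by (intro integrable_mult_indicator) auto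
  have UN: "(\<Union>n. {- real n..real n}) = (UNIV :: real set)"
  proof -
    have "\<exists>n. x \<in> {- real n..real n}" for x :: real
      by (metis abs_le_iff atLeastAtMost_iff minus_le_iff real_arch_simple)
    then show ?thesis by blast
  qed
  \<comment> \<open>Bounded intervals exhaust the line. The vanishing of the total integral is what
    the complement case of the Borel induction needs.\<close>
  have "(\<lambda>n. LINT x:{- real n..real n}|lborel. f x) \<longlonglongrightarrow> (LINT x:(\<Union>n. {- real n..real n})|lborel. f x)"
    by (rule set_integral_cont_up) (auto simp: incseq_def UN int)
  then have "(\<lambda>n. 0) \<longlonglongrightarrow> (LINT x|lborel. f x)"
    unfolding UN using zero by (simp add: set_lebesgue_integral_def)
  then have all: "(LINT x|lborel. f x) = 0"
    by (simp add: LIMSEQ_const_iff)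
  have "(LINT x:A|lborel. f x) = 0" if "A \<in> sets borel" for A
    using that
  proof (induction rule: borel_set_induct)
    case empty then show ?case by (simp add: set_lebesgue_integral_def)
  next
    case (interval a b) then show ?case using zero by simp
  next
    case (compl A)
    have "(LINT x:A \<union> - A|lborel. f x) = (LINT x:A|lborel. f x) + (LINT x:-A|lborel. f x)"
      by (rule set_integral_Un) (use compl int in auto)
    then show ?case using compl all by (simp add: set_lebesgue_integral_def)
  next
    case (union g)
    have "(LINT x:(\<Union>i. g i)|lborel. f x) = (\<Sum>i. (LINT x:(g i)|lborel. f x))"
    proof (rule lebesgue_integral_countable_add)
      show "set_integrable lborel (\<Union>i. g i) f" using union int by blast
    qed (use union in \<open>auto simp: disjoint_family_on_def\<close>)
    then show ?case using union by simp
  qed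
  then show ?thesis
    using density_unique_real[OF f, of "\<lambda>_. 0"] by simp
qed

lemma set_integral_Icc_split:
  fixes f :: "real \<Rightarrow> real"
  assumes "set_integrable lborel {a..c} f" "a \<le> b" "b \<le> c"
  shows "(LINT x:{a..c}|lborel. f x) = (LINT x:{a..b}|lborel. f x) + (LINT x:{b..c}|lborel. f x)"
proof -
  have "AE x in lborel. \<not> (x \<in> {a..b} \<and> x \<in> {b..c})"
    using AE_lborel_singleton[of b] by eventually_elim auto
  then have "(LINT x:{a..b} \<union> {b..c}|lborel. f x) = (LINT x:{a..b}|lborel. f x) + (LINT x:{b..c}|lborel. f x)"
    by (intro set_integral_Un_AE) (use assms in \<open>auto intro: set_integrable_subset\<close>)
  with assms show ?thesis by (simp add: ivl_disj_un_two_touch)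
qed

lemma set_integrable_continuous_mult:
  fixes g V :: "real \<Rightarrow> real"
  assumes V: "set_integrable lborel {a..b} V" and g: "continuous_on {a..b} g"
  shows "set_integrable lborel {a..b} (\<lambda>x. g x * V x)"
proof -
  have "compact (g ` {a..b})" using g by (intro compact_continuous_image) auto
  then obtain C where C: "\<And>x. x \<in> {a..b} \<Longrightarrow> \<bar>g x\<bar> \<le> C"
    by (metis bounded_iff compact_imp_bounded image_eqI real_norm_def)
  have gm: "(\<lambda>x. indicator {a..b} x *\<^sub>R g x) \<in> borel_measurable borel"
    using g by (intro borel_measurable_continuous_on_indicator) auto
  have "(\<lambda>x. (indicator {a..b} x *\<^sub>R g x) * (indicator {a..b} x *\<^sub>R V x)) \<in> borel_measurable lborel"
    using gm V by (intro borel_measurable_times) (auto simp: set_integrable_def)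
  then have m: "set_borel_measurable lborel {a..b} (\<lambda>x. g x * V x)"
    unfolding set_borel_measurable_def by (rule measurable_cong[THEN iffD1, rotated]) (auto simp: indicator_def)
  show ?thesis
  proof (rule set_integrable_bound[where f="\<lambda>x. C * V x"])
    show "set_integrable lborel {a..b} (\<lambda>x. C * V x)" using V by simp
    show "AE x in lborel. x \<in> {a..b} \<longrightarrow> norm (g x * V x) \<le> norm (C * V x)"
      using C by (intro AE_I2) (force simp: abs_mult intro: mult_right_mono)
  qed (use m in auto)
qed

text \<open>A substitute for the chain rule: \<^term>\<open>u\<close> is only absolutely continuous here.\<close>

lemma chain_inequality:
  fixes u V P \<psi> :: "real \<Rightarrow> real"
  assumes xy: "x \<le> y" and u: "continuous_on {x..y} u"
    and V: "set_integrable lborel {x..y} V" and V0: "\<And>s. 0 \<le> V s"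
    and incr: "\<And>s t. x \<le> s \<Longrightarrow> s \<le> t \<Longrightarrow> t \<le> y \<Longrightarrow> \<bar>u t - u s\<bar> \<le> (LINT r:{s..t}|lborel. V r)"
    and S: "open S" "u ` {x..y} \<subseteq> S"
    and P: "\<And>w. w \<in> S \<Longrightarrow> (P has_real_derivative \<psi> w) (at w)" and \<psi>: "continuous_on S \<psi>"
  shows "\<bar>P (u y) - P (u x)\<bar> \<le> (LINT r:{x..y}|lborel. \<bar>\<psi> (u r)\<bar> * V r)"
proof -
  have cont: "continuous_on {x..y} (\<lambda>r. \<bar>\<psi> (u r)\<bar>)"
    by (intro continuous_intros continuous_on_compose2[OF \<psi> u]) (use S in auto)
  have int: "set_integrable lborel {x..y} (\<lambda>r. \<bar>\<psi> (u r)\<bar> * V r)"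
    by (rule set_integrable_continuous_mult[OF V cont])
  have eps: "\<bar>P (u y) - P (u x)\<bar> \<le> (LINT r:{x..y}|lborel. (\<bar>\<psi> (u r)\<bar> + e) * V r)" if e: "e > 0" for e
  proof -
    have inte: "set_integrable lborel {x..y} (\<lambda>r. (\<bar>\<psi> (u r)\<bar> + e) * V r)"
      by (rule set_integrable_continuous_mult[OF V]) (intro continuous_intros cont)
    \<comment> \<open>The estimate is additive when an interval is cut, so Bolzano bisection reduces
      it to short intervals around a point z. There the slack e absorbs the oscillation of \<psi>
      along u, and the mean value inequality for P suffices.\<close>
    define Q where "Q s t \<longleftrightarrow> (x \<le> s \<and> s \<le> t \<and> t \<le> y \<longrightarrow>
       \<bar>P (u t) - P (u s)\<bar> \<le> (LINT r:{s..t}|lborel. (\<bar>\<psi> (u r)\<bar> + e) * V r))" for s t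
    have "Q x y" using xy
    proof (induction rule: Bolzano)
      case (trans a b c)
      show ?case unfolding Q_def
      proof (intro impI)
        assume h: "x \<le> a \<and> a \<le> c \<and> c \<le> y"
        have "(LINT r:{a..c}|lborel. (\<bar>\<psi> (u r)\<bar> + e) * V r)
          = (LINT r:{a..b}|lborel. (\<bar>\<psi> (u r)\<bar> + e) * V r) + (LINT r:{b..c}|lborel. (\<bar>\<psi> (u r)\<bar> + e) * V r)"
          by (rule set_integral_Icc_split[OF set_integrable_subset[OF inte]]) (use trans h in auto)
        then show "\<bar>P (u c) - P (u a)\<bar> \<le> (LINT r:{a..c}|lborel. (\<bar>\<psi> (u r)\<bar> + e) * V r)"
          using trans h unfolding Q_def by auto
      qed
    next
      case (local z)
      then have z: "z \<in> {x..y}" by simp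
      have uz: "u z \<in> S" using z S by auto
      obtain d0 where d0: "d0 > 0" "ball (u z) d0 \<subseteq> S"
        using S(1) uz openE by blast
      have "isCont \<psi> (u z)" using \<psi> S(1) uz continuous_on_eq_continuous_at by blast
      then obtain d1 where d1: "d1 > 0" "\<And>w. dist w (u z) < d1 \<Longrightarrow> dist (\<psi> w) (\<psi> (u z)) < e/2"
        unfolding continuous_at_eps_delta using e by (metis half_gt_zero)
      define d2 where "d2 = min d0 d1"
      have d2: "d2 > 0" using d0 d1 by (simp add: d2_def)
      obtain d where d: "d > 0" "\<And>r. r \<in> {x..y} \<Longrightarrow> dist r z < d \<Longrightarrow> dist (u r) (u z) < d2"
        using u z d2 unfolding continuous_on_iff by metis
      have "Q a b" if ab: "a \<le> z \<and> z \<le> b \<and> b - a < d" for a b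
        unfolding Q_def
      proof (intro impI)
        assume h: "x \<le> a \<and> a \<le> b \<and> b \<le> y"
        have near: "u r \<in> ball (u z) d2" if "r \<in> {a..b}" for r
        proof -
          have "\<bar>r - z\<bar> < d" using that ab by (auto simp: abs_if)
          then show ?thesis using d(2)[of r] that h by (auto simp: dist_commute dist_real_def)
        qed
        have bd: "\<bar>\<psi> w\<bar> \<le> \<bar>\<psi> (u z)\<bar> + e/2" if "w \<in> ball (u z) d2" for w
          using d1(2)[of w] that unfolding d2_def dist_real_def mem_ball by linarith
        have bd': "\<bar>\<psi> (u z)\<bar> \<le> \<bar>\<psi> w\<bar> + e/2" if "w \<in> ball (u z) d2" for w
          using d1(2)[of w] that unfolding d2_def dist_real_def mem_ball by linarith
        have "norm (P (u b) - P (u a)) \<le> (\<bar>\<psi> (u z)\<bar> + e/2) * norm (u b - u a)"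
        proof (rule field_differentiable_bound[of "ball (u z) d2" P \<psi>])
          show "(P has_field_derivative \<psi> w) (at w within ball (u z) d2)" if "w \<in> ball (u z) d2" for w
            using P[of w] d0 that by (intro has_field_derivative_at_within[OF P]) (auto simp: d2_def)
          show "norm (\<psi> w) \<le> \<bar>\<psi> (u z)\<bar> + e/2" if "w \<in> ball (u z) d2" for w
            using bd[OF that] by simp
        qed (use near h ab in auto)
        also have "\<dots> \<le> (\<bar>\<psi> (u z)\<bar> + e/2) * (LINT r:{a..b}|lborel. V r)"
          using incr[of a b] h e by (intro mult_left_mono) auto
        also have "\<dots> = (LINT r:{a..b}|lborel. (\<bar>\<psi> (u z)\<bar> + e/2) * V r)" by simp
        also have "\<dots> \<le> (LINT r:{a..b}|lborel. (\<bar>\<psi> (u r)\<bar> + e) * V r)"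
        proof (rule set_integral_mono)
          show "set_integrable lborel {a..b} (\<lambda>r. (\<bar>\<psi> (u z)\<bar> + e/2) * V r)"
            using set_integrable_subset[OF V, of "{a..b}"] h by simp
          show "set_integrable lborel {a..b} (\<lambda>r. (\<bar>\<psi> (u r)\<bar> + e) * V r)"
            using set_integrable_subset[OF inte, of "{a..b}"] h by simp
          show "(\<bar>\<psi> (u z)\<bar> + e/2) * V r \<le> (\<bar>\<psi> (u r)\<bar> + e) * V r" if "r \<in> {a..b}" for r
            using bd'[OF near[OF that]] V0[of r] by (intro mult_right_mono) auto
        qed
        finally show "\<bar>P (u b) - P (u a)\<bar> \<le> (LINT r:{a..b}|lborel. (\<bar>\<psi> (u r)\<bar> + e) * V r)" by simp
      qed
      then show ?case using d(1) by blast
    qed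
    then show ?thesis using xy by (simp add: Q_def)
  qed
  define I where "I = (LINT r:{x..y}|lborel. V r)"
  have I0: "I \<ge> 0" unfolding I_def unfolding set_lebesgue_integral_def by (rule Bochner_Integration.integral_nonneg) (simp add: V0)
  have eq: "(LINT r:{x..y}|lborel. (\<bar>\<psi> (u r)\<bar> + e) * V r) = (LINT r:{x..y}|lborel. \<bar>\<psi> (u r)\<bar> * V r) + e * I" for e
    unfolding I_def distrib_right using int V by (subst set_integral_add) auto
  show ?thesis
  proof (rule field_le_epsilon)
    fix e :: real assume e: "e > 0"
    \<comment> \<open>The slack is divided by I + 1 instead of I, since the integral I may be
      0.\<close>
    have "\<bar>P (u y) - P (u x)\<bar> \<le> (LINT r:{x..y}|lborel. \<bar>\<psi> (u r)\<bar> * V r) + e / (I + 1) * I"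
      using eps[of "e / (I+1)"] e I0 by (simp add: eq)
    also have "e / (I + 1) * I \<le> e" using e I0 by (simp add: field_simps)
    finally show "\<bar>P (u y) - P (u x)\<bar> \<le> (LINT r:{x..y}|lborel. \<bar>\<psi> (u r)\<bar> * V r) + e" by simp
  qed
qed

section \<open>Mollification with a C^1 step function\<close>

definition smoothstep :: "real \<Rightarrow> real" where
  "smoothstep s = 2 * (max 0 s)\<^sup>2 - 4 * (max 0 (s - 1/2))\<^sup>2 + 2 * (max 0 (s - 1))\<^sup>2"

text \<open>A hat of height 2 and integral 1 on the unit interval, with primitive
  \<open>smoothstep\<close>. Test functions need only be C^1, so a piecewise quadratic step is
  smooth enough.\<close>

definition tent :: "real \<Rightarrow> real" where
  "tent s = 4 * max 0 s - 8 * max 0 (s - 1/2) + 4 * max 0 (s - 1)"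

lemma DERIV_max_zero_sq: "((\<lambda>s::real. (max 0 s)\<^sup>2) has_real_derivative 2 * max 0 s) (at s)"
proof -
  consider "s > 0" | "s < 0" | "s = 0" by linarith
  then show ?thesis
  proof cases
    case 1
    have "((\<lambda>s::real. s\<^sup>2) has_real_derivative 2 * max 0 s) (at s)"
      using 1 by (auto intro!: derivative_eq_intros)
    then show ?thesis
      by (rule has_field_derivative_transform_within_open[of _ _ _ "{0<..}"]) (use 1 in auto)
  next
    case 2
    have "((\<lambda>s::real. 0) has_real_derivative 2 * max 0 s) (at s)"
      using 2 by (auto intro!: derivative_eq_intros)
    then show ?thesis
      by (rule has_field_derivative_transform_within_open[of _ _ _ "{..<0}"]) (use 2 in auto)
  next
    case 3
    have "isCont (\<lambda>s::real. max 0 s) 0" by (intro continuous_intros)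
    then show ?thesis unfolding CARAT_DERIV 3
      by (intro exI[of _ "\<lambda>z. max 0 z"]) (auto simp: power2_eq_square max_def)
  qed
qed

lemma DERIV_smoothstep: "(smoothstep has_real_derivative tent s) (at s)"
proof -
  have d: "((\<lambda>s. (max 0 (s - a))\<^sup>2) has_real_derivative 2 * max 0 (s - a)) (at s)" for a :: real
  proof -
    have "((\<lambda>s. s - a) has_real_derivative 1) (at s)" by (auto intro!: derivative_eq_intros)
    from DERIV_chain2[OF DERIV_max_zero_sq this] show ?thesis by simp
  qed
  show ?thesis
    unfolding smoothstep_def[abs_def] tent_def
    using DERIV_add[OF DERIV_diff[OF DERIV_cmult[OF d[of 0], of 2] DERIV_cmult[OF d[of "1/2"], of 4]] DERIV_cmult[OF d[of 1], of 2]]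
    by simp
qed

lemma continuous_on_tent: "continuous_on A tent"
  unfolding tent_def[abs_def] by (intro continuous_intros)

lemma tent_nonneg: "0 \<le> tent s" and tent_le: "tent s \<le> 2" and tent_eq_0: "s \<notin> {0..1} \<Longrightarrow> tent s = 0"
  by (auto simp: tent_def max_def)

lemma smoothstep_eq: "s \<le> 0 \<Longrightarrow> smoothstep s = 0" "1 \<le> s \<Longrightarrow> smoothstep s = 1"
  by (auto simp: smoothstep_def max_def power2_eq_square algebra_simps)

lemma smoothstep_mono: "s \<le> t \<Longrightarrow> smoothstep s \<le> smoothstep t"
  by (rule DERIV_nonneg_imp_nondecreasing) (use DERIV_smoothstep tent_nonneg in blast)+

lemma smoothstep_bounds: "0 \<le> smoothstep s" "smoothstep s \<le> 1"
  using smoothstep_mono[of "min 0 s" s] smoothstep_mono[of s "max 1 s"]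
    smoothstep_eq(1)[of "min 0 s"] smoothstep_eq(2)[of "max 1 s"] by auto

lemma integral_tent: "(LINT r:{0..1}|lborel. tent r) = 1"
proof -
  have "(LINT r|lborel. indicator {0..1} r *\<^sub>R tent r) = smoothstep 1 - smoothstep 0"
  proof (rule integral_FTC_atLeastAtMost)
    show "(smoothstep has_vector_derivative tent x) (at x within {0..1})" for x
      using DERIV_smoothstep[of x] has_real_derivative_iff_has_vector_derivative has_vector_derivative_at_within by blast
  qed (auto intro: continuous_on_tent)
  then show ?thesis by (simp add: set_lebesgue_integral_def smoothstep_eq)
qed

text \<open>The kernels are supported to the right of z only, hence never reach the boundary point
  0. Substituting s = z + r / (n + 1) moves n into the argument of u; dominated convergence then
  applies with bound C * 2, where 2 is the height of the tent.\<close>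

lemma mollified_value_tendsto:
  fixes u :: "real \<Rightarrow> real"
  assumes u: "continuous_on {0<..} u" and z: "0 < z"
  shows "(\<lambda>n. LINT s:{0<..}|lborel. u s * (real (Suc n) * tent (real (Suc n) * (s - z)))) \<longlonglongrightarrow> u z"
proof -
  have cz: "continuous_on {z..z+1} u" using u by (rule continuous_on_subset) (use z in auto)
  have "compact (u ` {z..z+1})" using cz by (intro compact_continuous_image) auto
  then obtain C where C: "\<And>x. x \<in> {z..z+1} \<Longrightarrow> \<bar>u x\<bar> \<le> C"
    by (metis bounded_iff compact_imp_bounded image_eqI real_norm_def)
  have in_z: "z + r / real (Suc n) \<in> {z..z+1}" if "r \<in> {0..1}" for r n
  proof -
    have "r / real (Suc n) \<le> r / 1" using that by (intro divide_left_mono) auto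
    then show ?thesis using that by auto
  qed
  have eq: "(LINT s:{0<..}|lborel. u s * (real (Suc n) * tent (real (Suc n) * (s - z))))
      = (LINT r|lborel. indicator {0..1} r *\<^sub>R (u (z + r / real (Suc n)) * tent r))" for n
  proof -
    have "(LINT s:{0<..}|lborel. u s * (real (Suc n) * tent (real (Suc n) * (s - z))))
      = \<bar>1 / real (Suc n)\<bar> *\<^sub>R (LINT r|lborel. indicator {0<..} (z + 1 / real (Suc n) * r) *\<^sub>R
          (u (z + 1 / real (Suc n) * r) * (real (Suc n) * tent (real (Suc n) * ((z + 1 / real (Suc n) * r) - z)))))"
      unfolding set_lebesgue_integral_def by (rule lborel_integral_real_affine) simp
    also have "\<dots> = (LINT r|lborel. \<bar>1 / real (Suc n)\<bar> *\<^sub>R (indicator {0<..} (z + 1 / real (Suc n) * r) *\<^sub>R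
          (u (z + 1 / real (Suc n) * r) * (real (Suc n) * tent (real (Suc n) * ((z + 1 / real (Suc n) * r) - z))))))"
      by (rule integral_scaleR_right[symmetric])
    also have "\<dots> = (LINT r|lborel. indicator {0..1} r *\<^sub>R (u (z + r / real (Suc n)) * tent r))"
    proof (rule Bochner_Integration.integral_cong)
      fix r :: real
      have a: "real (Suc n) * ((z + 1 / real (Suc n) * r) - z) = r" by simp
      show "\<bar>1 / real (Suc n)\<bar> *\<^sub>R (indicator {0<..} (z + 1 / real (Suc n) * r) *\<^sub>R
          (u (z + 1 / real (Suc n) * r) * (real (Suc n) * tent (real (Suc n) * ((z + 1 / real (Suc n) * r) - z)))))
        = indicator {0..1} r *\<^sub>R (u (z + r / real (Suc n)) * tent r)"
      proof (cases "r \<in> {0..1}")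
        case True
        then have "z + r / real (Suc n) > 0" using in_z[OF True, of n] z unfolding atLeastAtMost_iff by linarith
        then show ?thesis unfolding a using True by (simp del: of_nat_Suc)
      next
        case False
        then show ?thesis unfolding a using tent_eq_0[OF False] by simp
      qed
    qed simp
    finally show ?thesis .
  qed
  have "(\<lambda>n. LINT r|lborel. indicator {0..1} r *\<^sub>R (u (z + r / real (Suc n)) * tent r))
     \<longlonglongrightarrow> (LINT r|lborel. indicator {0..1} r *\<^sub>R (u z * tent r))"
  proof (rule integral_dominated_convergence[where w="\<lambda>r. indicator {0..1} r *\<^sub>R (C * 2)"])
    show "(\<lambda>r. indicator {0..1} r *\<^sub>R (u z * tent r)) \<in> borel_measurable lborel"
      by (auto intro!: borel_measurable_continuous_on_indicator continuous_intros continuous_on_tent simp del: real_scaleR_def)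
    show "(\<lambda>r. indicator {0..1} r *\<^sub>R (u (z + r / real (Suc n)) * tent r)) \<in> borel_measurable lborel" for n
    proof -
      have "continuous_on {0..1} (\<lambda>r. u (z + r / real (Suc n)) * tent r)"
        by (intro continuous_intros continuous_on_tent continuous_on_compose2[OF cz]) (use in_z in auto)
      then show ?thesis by (auto intro!: borel_measurable_continuous_on_indicator simp del: real_scaleR_def)
    qed
    show "integrable lborel (\<lambda>r. indicator {0..1::real} r *\<^sub>R (C * 2))"
      by (auto intro!: integrable_mult_left simp: integrable_indicator_iff)
    show "AE r in lborel. (\<lambda>n. indicator {0..1} r *\<^sub>R (u (z + r / real (Suc n)) * tent r))
        \<longlonglongrightarrow> indicator {0..1} r *\<^sub>R (u z * tent r)"
    proof (rule AE_I2)
      fix r :: real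
      show "(\<lambda>n. indicator {0..1} r *\<^sub>R (u (z + r / real (Suc n)) * tent r))
        \<longlonglongrightarrow> indicator {0..1} r *\<^sub>R (u z * tent r)"
      proof (cases "r \<in> {0..1}")
        case True
        have "(\<lambda>n. z + r * inverse (real (Suc n))) \<longlonglongrightarrow> z + r * 0"
          by (intro tendsto_intros LIMSEQ_inverse_real_of_nat)
        then have "(\<lambda>n. z + r / real (Suc n)) \<longlonglongrightarrow> z"
          by (simp add: field_simps)
        then have "(\<lambda>n. u (z + r / real (Suc n))) \<longlonglongrightarrow> u z"
          by (rule continuous_on_tendsto_compose[OF cz]) (use in_z[OF True] z in auto)
        then show ?thesis by (intro tendsto_intros)
      qed simp
    qed
    show "AE r in lborel. norm (indicator {0..1} r *\<^sub>R (u (z + r / real (Suc n)) * tent r)) \<le> indicator {0..1} r *\<^sub>R (C * 2)" for n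
    proof (rule AE_I2)
      fix r :: real
      show "norm (indicator {0..1} r *\<^sub>R (u (z + r / real (Suc n)) * tent r)) \<le> indicator {0..1} r *\<^sub>R (C * 2)"
      proof (cases "r \<in> {0..1}")
        case True
        then have "\<bar>u (z + r / real (Suc n))\<bar> * tent r \<le> C * 2"
          using C[OF in_z[OF True, of n]] tent_nonneg[of r] tent_le[of r] by (intro mult_mono) auto
        then show ?thesis using True tent_nonneg[of r] by (simp add: abs_mult)
      qed simp
    qed
  qed
  also have "(LINT r|lborel. indicator {0..1} r *\<^sub>R (u z * tent r)) = u z"
    using integral_tent by (simp add: set_lebesgue_integral_def mult.left_commute)
  finally show ?thesis unfolding eq .
qed

text \<open>The weak derivative is tested with a difference of two steepening steps that start at x
  and y. These functions approximate the indicator of the interval, and their derivatives are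
  mollifiers at x and at y, so both sides of the defining identity converge.\<close>

lemma weak_deriv_increment_pos:
  assumes u: "continuous_on {0<..} u"
    and v: "\<And>a b. 0 < a \<Longrightarrow> set_integrable lborel {a..b} v"
    and w: "weak_deriv_half u v" and x: "0 < x" and xy: "x \<le> y"
    and ui: "\<And>a b. 0 < a \<Longrightarrow> set_integrable lborel {a..b} u"
  shows "u y - u x = (LINT s:{x..y}|lborel. v s)"
proof -
  define f where "f n s = smoothstep (real (Suc n) * (s - x)) - smoothstep (real (Suc n) * (s - y))" for n s
  define g where "g n z s = real (Suc n) * tent (real (Suc n) * (s - z))" for n z s
  have fsupp: "f n s = 0" if "s \<notin> {x..y+1}" for n s
  proof (cases "s < x")
    case True
    then show ?thesis unfolding f_def
      using xy by (subst (1 2) smoothstep_eq(1)) (auto intro!: mult_nonneg_nonpos)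
  next
    case False
    then have s: "s > y + 1" using that by auto
    have "1 \<le> real (Suc n) * (s - x)" "1 \<le> real (Suc n) * (s - y)"
      using s xy mult_mono[of 1 "real (Suc n)" 1 "s - x"] mult_mono[of 1 "real (Suc n)" 1 "s - y"] by auto
    then show ?thesis unfolding f_def by (simp add: smoothstep_eq del: of_nat_Suc)
  qed
  have fb: "\<bar>f n s\<bar> \<le> 1" for n s
    unfolding f_def using smoothstep_bounds[of "real (Suc n) * (s - x)"] smoothstep_bounds[of "real (Suc n) * (s - y)"] by (auto simp del: of_nat_Suc)
  have fD: "(f n has_real_derivative g n x s - g n y s) (at s)" for n s
    unfolding f_def[abs_def] g_def
    by (auto intro!: derivative_eq_intros DERIV_chain2[OF DERIV_smoothstep] simp del: of_nat_Suc)
  have gc: "continuous_on A (g n z)" for A n z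
    unfolding g_def[abs_def] by (intro continuous_intros continuous_on_compose2[OF continuous_on_tent[of UNIV]]) auto
  have tf: "test_fun_half (f n) (\<lambda>s. g n x s - g n y s)" for n
    unfolding test_fun_half_def
  proof (intro conjI)
    show "\<forall>s. (f n has_real_derivative g n x s - g n y s) (at s)" using fD by blast
    show "continuous_on UNIV (\<lambda>s. g n x s - g n y s)" by (intro continuous_on_diff gc)
    show "\<exists>a b. 0 < a \<and> a \<le> b \<and> (\<forall>s. s \<notin> {a..b} \<longrightarrow> f n s = 0)"
      by (rule exI[of _ x], rule exI[of _ "y+1"]) (use x xy in \<open>auto intro!: fsupp\<close>)
  qed
  have gi: "set_integrable lborel {0<..} (\<lambda>s. u s * g n z s)" if z: "z > 0" for n z
  proof -
    have "set_integrable lborel {z..z+1} (\<lambda>s. g n z s * u s)"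
      by (rule set_integrable_continuous_mult[OF ui[OF z] gc])
    then show ?thesis unfolding set_integrable_def
    proof (rule back_subst[of "integrable lborel"], intro ext)
      fix s show "indicat_real {z..z+1} s *\<^sub>R (g n z s * u s) = indicat_real {0<..} s *\<^sub>R (u s * g n z s)"
      proof (cases "s \<in> {z..z+1}")
        case False
        have "real (Suc n) * (s - z) \<notin> {0..1}"
        proof (cases "s < z")
          case True then show ?thesis by (auto simp: mult_less_0_iff zero_le_mult_iff)
        next
          case s: False
          then have "1 < s - z" using False by auto
          moreover have "1 * (s - z) \<le> real (Suc n) * (s - z)" by (rule mult_right_mono) (use s in auto)
          ultimately have "1 < real (Suc n) * (s - z)" by (simp only: mult_1_left less_le_trans)
          then show ?thesis by simp
        qed
        then show ?thesis using False by (simp add: g_def tent_eq_0 del: of_nat_Suc)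
      qed (use z in auto)
    qed
  qed
  have "(\<lambda>n. (LINT s:{0<..}|lborel. u s * g n x s) - (LINT s:{0<..}|lborel. u s * g n y s)) \<longlonglongrightarrow> u x - u y"
    unfolding g_def by (intro tendsto_diff mollified_value_tendsto u) (use x xy in auto)
  also have "(\<lambda>n. (LINT s:{0<..}|lborel. u s * g n x s) - (LINT s:{0<..}|lborel. u s * g n y s))
      = (\<lambda>n. - (LINT s:{0<..}|lborel. v s * f n s))"
  proof
    fix n
    have "(LINT s:{0<..}|lborel. u s * (g n x s - g n y s)) = - (LINT s:{0<..}|lborel. v s * f n s)"
      by (rule w[unfolded weak_deriv_half_def, rule_format, OF tf])
    then show "(LINT s:{0<..}|lborel. u s * g n x s) - (LINT s:{0<..}|lborel. u s * g n y s) = - (LINT s:{0<..}|lborel. v s * f n s)"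
      using set_integral_diff(2)[OF gi[of x n] gi[of y n]] x xy by (simp add: right_diff_distrib)
  qed
  finally have 1: "(\<lambda>n. - (LINT s:{0<..}|lborel. v s * f n s)) \<longlonglongrightarrow> u x - u y" .
  have vi: "set_integrable lborel {x..y+1} v" using v x by blast
  \<comment> \<open>A step starting at z is 0 at z itself and eventually 1 at every point to the
    right of z; hence the limit is the indicator of a half-open interval.\<close>
  have "(\<lambda>n. LINT s|lborel. indicator {x..y+1} s *\<^sub>R v s * f n s) \<longlonglongrightarrow> (LINT s|lborel. indicator {x<..y} s *\<^sub>R v s)"
  proof (rule integral_dominated_convergence[where w="\<lambda>s. \<bar>indicator {x..y+1} s *\<^sub>R v s\<bar>"])
    have "set_integrable lborel {x<..y} v" by (rule set_integrable_subset[OF vi]) auto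
    then show "(\<lambda>s. indicator {x<..y} s *\<^sub>R v s) \<in> borel_measurable lborel" unfolding set_integrable_def by auto
    have fc: "continuous_on UNIV (f n)" for n by (intro continuous_at_imp_continuous_on ballI DERIV_isCont[OF fD])
    show "(\<lambda>s. indicator {x..y+1} s *\<^sub>R v s * f n s) \<in> borel_measurable lborel" for n
    proof (rule borel_measurable_times)
      show "(\<lambda>s. indicator {x..y+1} s *\<^sub>R v s) \<in> borel_measurable lborel"
        using vi unfolding set_integrable_def by (rule borel_measurable_integrable)
      show "f n \<in> borel_measurable lborel"
        using borel_measurable_continuous_onI[OF fc[of n]] by simp
    qed
    show "integrable lborel (\<lambda>s. \<bar>indicator {x..y+1} s *\<^sub>R v s\<bar>)" using vi unfolding set_integrable_def by (rule integrable_abs)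
    show "AE s in lborel. norm (indicator {x..y+1} s *\<^sub>R v s * f n s) \<le> \<bar>indicator {x..y+1} s *\<^sub>R v s\<bar>" for n
      by (intro AE_I2) (auto simp: abs_mult intro: mult_left_le[OF fb])
    show "AE s in lborel. (\<lambda>n. indicator {x..y+1} s *\<^sub>R v s * f n s) \<longlonglongrightarrow> indicator {x<..y} s *\<^sub>R v s"
    proof (rule AE_I2)
      fix s :: real
      have st: "(\<lambda>n. smoothstep (real (Suc n) * (s - z))) \<longlonglongrightarrow> (if z < s then 1 else 0)" for z
      proof (cases "z < s")
        case True
        obtain N where N: "inverse (real (Suc N)) < s - z" using True reals_Archimedean[of "s - z"] by auto
        have "smoothstep (real (Suc n) * (s - z)) = 1" if "n \<ge> N" for n
        proof (rule smoothstep_eq(2))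
          have "1 = real (Suc N) * inverse (real (Suc N))" by simp
          also have "\<dots> \<le> real (Suc n) * (s - z)" using N that by (intro mult_mono) auto
          finally show "1 \<le> real (Suc n) * (s - z)" .
        qed
        then show ?thesis using True by (intro tendsto_eventually eventually_sequentiallyI[of N]) auto
      next
        case False
        then have "smoothstep (real (Suc n) * (s - z)) = 0" for n
          by (intro smoothstep_eq(1)) (auto intro!: mult_nonneg_nonpos)
        then show ?thesis using False by simp
      qed
      have "(\<lambda>n. f n s) \<longlonglongrightarrow> (if x < s then 1 else 0) - (if y < s then 1 else 0)"
        unfolding f_def by (intro tendsto_diff st)
      then have "(\<lambda>n. indicator {x..y+1} s *\<^sub>R v s * f n s) \<longlonglongrightarrow> indicator {x..y+1} s *\<^sub>R v s * ((if x < s then 1 else 0) - (if y < s then 1 else 0))"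
        by (rule tendsto_mult_left)
      also have "indicator {x..y+1} s *\<^sub>R v s * ((if x < s then 1 else 0) - (if y < s then 1 else 0)) = indicator {x<..y} s *\<^sub>R v s"
        using xy by (auto simp: indicator_def)
      finally show "(\<lambda>n. indicator {x..y+1} s *\<^sub>R v s * f n s) \<longlonglongrightarrow> indicator {x<..y} s *\<^sub>R v s" .
    qed
  qed
  also have "(\<lambda>n. LINT s|lborel. indicator {x..y+1} s *\<^sub>R v s * f n s) = (\<lambda>n. LINT s:{0<..}|lborel. v s * f n s)"
    unfolding set_lebesgue_integral_def
  proof (intro ext Bochner_Integration.integral_cong)
    fix n s
    show "indicator {x..y+1} s *\<^sub>R v s * f n s = indicator {0<..} s *\<^sub>R (v s * f n s)"
      by (cases "s \<in> {x..y+1}") (use fsupp[of s n] x in simp_all)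
  qed simp
  also have "(LINT s|lborel. indicator {x<..y} s *\<^sub>R v s) = (LINT s:{x..y}|lborel. v s)"
    unfolding set_lebesgue_integral_def
  proof (rule integral_cong_AE)
    have "set_integrable lborel {x<..y} v" "set_integrable lborel {x..y} v" by (rule set_integrable_subset[OF vi]; auto)+
    then show "(\<lambda>s. indicator {x<..y} s *\<^sub>R v s) \<in> borel_measurable lborel" "(\<lambda>s. indicator {x..y} s *\<^sub>R v s) \<in> borel_measurable lborel"
      unfolding set_integrable_def by auto
    show "AE s in lborel. indicator {x<..y} s *\<^sub>R v s = indicator {x..y} s *\<^sub>R v s"
      using AE_lborel_singleton[of x] by eventually_elim (auto simp: indicator_def)
  qed
  finally have 2: "(\<lambda>n. LINT s:{0<..}|lborel. v s * f n s) \<longlonglongrightarrow> (LINT s:{x..y}|lborel. v s)" .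
  from LIMSEQ_unique[OF 1 tendsto_minus[OF 2]] show ?thesis by simp
qed

text \<open>\<^term>\<open>V\<close> is the weak derivative; it vanishes to the left of the origin so that its integrals can be
  taken over the whole line.\<close>

definition sobolev_rep :: "(real \<Rightarrow> real) \<Rightarrow> (real \<Rightarrow> real) \<Rightarrow> bool" where
  "sobolev_rep u V \<longleftrightarrow> continuous_on {0..} u \<and> set_integrable lborel {0<..} (\<lambda>x. (u x)\<^sup>2) \<and>
     V \<in> borel_measurable lborel \<and> integrable lborel (\<lambda>x. (V x)\<^sup>2) \<and> (\<forall>x\<le>0. V x = 0) \<and>
     (\<forall>x y. 0 \<le> x \<longrightarrow> x \<le> y \<longrightarrow> u y - u x = (LINT s:{x..y}|lborel. V s))"

lemma set_integrable_Icc_of_square: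
  fixes V :: "real \<Rightarrow> real"
  assumes V: "V \<in> borel_measurable lborel" and V2: "integrable lborel (\<lambda>x. (V x)\<^sup>2)"
  shows "set_integrable lborel {a..b} V"
proof (rule set_integrable_bound[where f="\<lambda>x. 1 + (V x)\<^sup>2"])
  have "set_integrable lborel {a..b} (\<lambda>x. (V x)\<^sup>2)"
    using V2 unfolding set_integrable_def by (intro integrable_mult_indicator) auto
  then show "set_integrable lborel {a..b} (\<lambda>x. 1 + (V x)\<^sup>2)"
    by (intro set_integral_add borel_integrable_atLeastAtMost'[OF continuous_on_const])
  show "set_borel_measurable lborel {a..b} V"
    unfolding set_borel_measurable_def using V by (intro borel_measurable_scaleR) auto
  have "\<bar>r\<bar> \<le> 1 + r\<^sup>2" for r :: real
    using zero_le_power2[of "\<bar>r\<bar> - 1/2", unfolded power2_diff] by (simp add: power2_eq_square)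
  then show "AE x in lborel. x \<in> {a..b} \<longrightarrow> norm (V x) \<le> norm (1 + (V x)\<^sup>2)"
    by (intro AE_I2) (simp add: abs_of_nonneg)
qed

text \<open>Test functions vanish near 0, so increments are first known on the open half-line only.
  They extend to the left end point 0 because u is continuous there and V, being square integrable,
  is integrable up to 0.\<close>

lemma sobolev_repI:
  fixes u v :: "real \<Rightarrow> real"
  assumes u: "continuous_on {0..} u" "L2_half u" and v: "L2_half v" "weak_deriv_half u v"
  defines "V \<equiv> \<lambda>x. indicator {0<..} x *\<^sub>R v x"
  shows "sobolev_rep u V" "(LINT x:{0<..}|lborel. \<bar>v x\<bar>\<^sup>2) = (LINT x|lborel. (V x)\<^sup>2)"
proof -
  have V2: "(\<lambda>x. indicator {0<..} x *\<^sub>R \<bar>v x\<bar>\<^sup>2) = (\<lambda>x. (V x)\<^sup>2)"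
    by (auto simp: V_def indicator_def)
  show "(LINT x:{0<..}|lborel. \<bar>v x\<bar>\<^sup>2) = (LINT x|lborel. (V x)\<^sup>2)"
    unfolding set_lebesgue_integral_def V2 ..
  have m: "V \<in> borel_measurable lborel" using v by (simp add: L2_half_def set_borel_measurable_def V_def)
  have i2: "integrable lborel (\<lambda>x. (V x)\<^sup>2)" using v(1) unfolding L2_half_def set_integrable_def V2 by simp
  note Vi = set_integrable_Icc_of_square[OF m i2]
  have Vv: "(LINT s:{a..b}|lborel. V s) = (LINT s:{a..b}|lborel. v s)" if "0 < a" for a b
    unfolding set_lebesgue_integral_def
    by (intro Bochner_Integration.integral_cong) (use that in \<open>auto simp: V_def indicator_def\<close>)
  have vi: "set_integrable lborel {a..b} v" if "0 < a" for a b
    using Vi[of a b] unfolding set_integrable_def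
    by (rule back_subst[of "integrable lborel"]) (use that in \<open>auto simp: V_def indicator_def\<close>)
  have ui: "set_integrable lborel {a..b} u" if "0 < a" for a b
    using u(1) by (intro borel_integrable_atLeastAtMost' continuous_on_subset[OF u(1)]) (use that in auto)
  have pos: "u y - u x = (LINT s:{x..y}|lborel. V s)" if "0 < x" "x \<le> y" for x y
    unfolding Vv[OF that(1)]
    by (rule weak_deriv_increment_pos[OF continuous_on_subset[OF u(1)] vi v(2) that ui]) auto
  have "u y - u x = (LINT s:{x..y}|lborel. V s)" if xy: "0 \<le> x" "x \<le> y" for x y
  proof -
    consider "0 < x" | "x = 0" "y = 0" | "x = 0" "0 < y" using xy by linarith
    then show ?thesis
    proof cases
      case 1 then show ?thesis using pos xy by blast
    next
      case 2
      have "(LINT s:{0..0}|lborel. V s) = 0"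
        unfolding set_lebesgue_integral_def by (rule integral_eq_zero_AE, rule AE_I2) (auto simp: V_def indicator_def)
      then show ?thesis using 2 by simp
    next
      case 3
      have xn: "0 < y / real (Suc n)" "y / real (Suc n) \<le> y" for n
        using 3 divide_left_mono[of 1 "real (Suc n)" y] by (auto simp del: of_nat_Suc)
      have lim0: "(\<lambda>n. y / real (Suc n)) \<longlonglongrightarrow> 0"
        using tendsto_mult[OF tendsto_const[of y] LIMSEQ_inverse_real_of_nat] by (simp add: divide_inverse)
      have "(\<lambda>n. LINT s:{y / real (Suc n)..y}|lborel. V s) \<longlonglongrightarrow> (LINT s:(\<Union>n. {y / real (Suc n)..y})|lborel. V s)"
      proof (rule set_integral_cont_up)
        show "incseq (\<lambda>n. {y / real (Suc n)..y})"
          unfolding incseq_def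
        proof (intro allI impI)
          fix m n :: nat assume "m \<le> n"
          then have "y / real (Suc n) \<le> y / real (Suc m)" using 3 by (intro divide_left_mono) auto
          then show "{y / real (Suc m)..y} \<subseteq> {y / real (Suc n)..y}" by simp
        qed
        show "set_integrable lborel (\<Union>n. {y / real (Suc n)..y}) V"
          by (rule set_integrable_subset[OF Vi[of 0 y]]) (auto intro: order_trans[OF less_imp_le[OF xn(1)]] simp del: of_nat_Suc)
      qed simp
      also have "(LINT s:(\<Union>n. {y / real (Suc n)..y})|lborel. V s) = (LINT s:{0..y}|lborel. V s)"
        unfolding set_lebesgue_integral_def
      proof (rule Bochner_Integration.integral_cong)
        fix s :: real
        have "s \<in> (\<Union>n. {y / real (Suc n)..y})" if "0 < s" "s \<le> y"
        proof -
          have "\<exists>n. y / real (Suc n) < s"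
            by (rule eventually_happens'[OF sequentially_bot order_tendstoD(2)[OF lim0 that(1)]])
          then obtain n where "y / real (Suc n) < s" ..
          then show ?thesis using that by (intro UN_I[of n]) auto
        qed
        moreover have "0 < s \<and> s \<le> y" if "s \<in> (\<Union>n. {y / real (Suc n)..y})"
          using that less_le_trans[OF xn(1)] by (auto simp del: of_nat_Suc)
        ultimately have "s \<in> (\<Union>n. {y / real (Suc n)..y}) \<longleftrightarrow> 0 < s \<and> s \<le> y" by blast
        then show "indicat_real (\<Union>n. {y / real (Suc n)..y}) s *\<^sub>R V s = indicat_real {0..y} s *\<^sub>R V s"
          by (simp add: indicator_def V_def)
      qed simp
      finally have l1: "(\<lambda>n. LINT s:{y / real (Suc n)..y}|lborel. V s) \<longlonglongrightarrow> (LINT s:{0..y}|lborel. V s)" .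
      have "(\<lambda>n. u (y / real (Suc n))) \<longlonglongrightarrow> u 0"
        by (rule continuous_on_tendsto_compose[OF u(1) lim0]) (auto intro!: always_eventually less_imp_le[OF xn(1)] simp del: of_nat_Suc)
      then have "(\<lambda>n. u y - u (y / real (Suc n))) \<longlonglongrightarrow> u y - u 0" by (intro tendsto_intros)
      then have "(\<lambda>n. LINT s:{y / real (Suc n)..y}|lborel. V s) \<longlonglongrightarrow> u y - u 0"
        by (simp only: pos[OF xn])
      then show ?thesis using LIMSEQ_unique l1 3 by blast
    qed
  qed
  then show "sobolev_rep u V"
    unfolding sobolev_rep_def using u m i2 by (auto simp: V_def L2_half_def)
qed

lemma sobolev_rep_unique:
  assumes V: "sobolev_rep u V" and W: "sobolev_rep u W"
  shows "AE x in lborel. V x = W x"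
proof -
  have Vi: "set_integrable lborel {a..b} V" and Wi: "set_integrable lborel {a..b} W" for a b
    using V W by (auto simp: sobolev_rep_def intro!: set_integrable_Icc_of_square)
  \<comment> \<open>A square integrable function need not be integrable on the half-line, as the
    criterion on interval integrals requires; hence the cut-off at n.\<close>
  have "AE x in lborel. indicator {0..real n} x *\<^sub>R (V x - W x) = 0" for n
  proof (rule AE_zero_if_interval_integrals_zero)
    have i: "set_integrable lborel {0..real n} (\<lambda>x. V x - W x)" by (intro set_integral_diff Vi Wi)
    then show "integrable lborel (\<lambda>x. indicator {0..real n} x *\<^sub>R (V x - W x))" by (simp add: set_integrable_def)
    fix a b :: real assume "a \<le> b"
    have "(LINT x:{a..b}|lborel. indicator {0..real n} x *\<^sub>R (V x - W x)) = (LINT x:{max a 0..min b (real n)}|lborel. V x - W x)"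
      unfolding set_lebesgue_integral_def by (intro Bochner_Integration.integral_cong) (auto simp: indicator_def)
    also have "\<dots> = (LINT x:{max a 0..min b (real n)}|lborel. V x) - (LINT x:{max a 0..min b (real n)}|lborel. W x)"
      by (intro set_integral_diff Vi Wi)
    also have "\<dots> = 0"
    proof (cases "max a 0 \<le> min b (real n)")
      case True then show ?thesis using V W by (simp add: sobolev_rep_def)
    next
      case False then show ?thesis by (simp add: set_lebesgue_integral_def)
    qed
    finally show "(LINT x:{a..b}|lborel. indicator {0..real n} x *\<^sub>R (V x - W x)) = 0" .
  qed
  then have "AE x in lborel. \<forall>n. indicator {0..real n} x *\<^sub>R (V x - W x) = 0" unfolding AE_all_countable by blast
  then show ?thesis
  proof eventually_elim
    case (elim x)
    show ?case
    proof (cases "x \<le> 0")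
      case True then show ?thesis using V W by (simp add: sobolev_rep_def)
    next
      case False
      obtain n where "x \<le> real n" using real_arch_simple by blast
      then show ?thesis using elim[rule_format, of n] False by simp
    qed
  qed
qed

section \<open>Kinetic energy, classical derivatives and decay at infinity\<close>

lemma wderiv_half:
  assumes "u \<in> H1_half"
  shows "L2_half (wderiv u)" "weak_deriv_half u (wderiv u)"
  using assms someI_ex[of "\<lambda>v. L2_half v \<and> weak_deriv_half u v"] by (auto simp: H1_half_def wderiv_def)

lemma H1_half_sobolev_rep:
  assumes "u \<in> H1_half"
  obtains V where "sobolev_rep u V" "(LINT x:{0<..}|lborel. \<bar>wderiv u x\<bar>\<^sup>2) = (LINT x|lborel. (V x)\<^sup>2)"
  using sobolev_repI[OF _ _ wderiv_half[OF assms]] assms by (auto simp: H1_half_def)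

text \<open>\<open>wderiv\<close> is an arbitrary choice; this is what allows the kinetic energy of
  an explicit function to be computed from its classical derivative.\<close>

lemma kinetic_unique:
  assumes u: "u \<in> H1_half" and v: "L2_half v" "weak_deriv_half u v"
  shows "(LINT x:{0<..}|lborel. \<bar>wderiv u x\<bar>\<^sup>2) = (LINT x:{0<..}|lborel. \<bar>v x\<bar>\<^sup>2)"
proof -
  have uc: "continuous_on {0..} u" "L2_half u" using u by (auto simp: H1_half_def)
  note r1 = sobolev_repI[OF uc wderiv_half[OF u]] and r2 = sobolev_repI[OF uc v]
  have "AE x in lborel. (indicator {0<..} x *\<^sub>R wderiv u x)\<^sup>2 = (indicator {0<..} x *\<^sub>R v x)\<^sup>2"
    using sobolev_rep_unique[OF r1(1) r2(1)] by eventually_elim (simp only:)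
  then show ?thesis unfolding r1(2) r2(2)
    by (intro integral_cong_AE) (use r1(1) r2(1) in \<open>auto simp: sobolev_rep_def\<close>)
qed

lemma classical_weak_deriv:
  assumes u: "\<And>x. 0 < x \<Longrightarrow> (u has_real_derivative u' x) (at x)" and u': "continuous_on {0<..} u'"
  shows "weak_deriv_half u u'"
  unfolding weak_deriv_half_def
proof (intro allI impI)
  fix f f' assume tf: "test_fun_half f f'"
  then obtain a b where ab: "0 < a" "a \<le> b" "\<And>x. x \<notin> {a..b} \<Longrightarrow> f x = 0"
    and f: "\<And>x. (f has_real_derivative f' x) (at x)" and f': "continuous_on UNIV f'"
    unfolding test_fun_half_def by blast
  \<comment> \<open>An interval strictly larger than the support of f, still inside the open
    half-line: the boundary terms of the integration by parts vanish at its ends.\<close>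
  define A B where "A = a / 2" and "B = b + 1"
  have AB: "0 < A" "A < a" "b < B" "A \<le> B" using ab by (auto simp: A_def B_def)
  have f'0: "f' x = 0" if "x \<notin> {a..b}" for x
  proof -
    have "(f has_real_derivative 0) (at x)"
    proof (rule has_field_derivative_transform_within_open[of "\<lambda>_. 0" 0 x "- {a..b}"])
      show "open (- {a..b})" by (simp add: open_Compl)
    qed (use that ab in auto)
    then show ?thesis using f DERIV_unique by blast
  qed
  have uc: "continuous_on {A..B} u" "continuous_on {A..B} u'"
    using AB by (auto intro!: continuous_at_imp_continuous_on DERIV_isCont u continuous_on_subset[OF u'])
  have fc: "continuous_on {A..B} f" "continuous_on {A..B} f'"
    using f by (auto intro!: continuous_at_imp_continuous_on DERIV_isCont continuous_on_subset[OF f'])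
  have e1: "(LINT x:{0<..}|lborel. u x * f' x) = (LINT x:{A..B}|lborel. u x * f' x)"
    unfolding set_lebesgue_integral_def
    by (intro Bochner_Integration.integral_cong) (use AB f'0 in \<open>auto simp: indicator_def\<close>)
  have e2: "(LINT x:{0<..}|lborel. u' x * f x) = (LINT x:{A..B}|lborel. u' x * f x)"
    unfolding set_lebesgue_integral_def
    by (intro Bochner_Integration.integral_cong) (use AB ab(3) in \<open>auto simp: indicator_def\<close>)
  have i: "set_integrable lborel {A..B} (\<lambda>x. u x * f' x)" "set_integrable lborel {A..B} (\<lambda>x. u' x * f x)"
    by (intro borel_integrable_atLeastAtMost' continuous_intros uc fc)+
  have "(LINT x:{A..B}|lborel. u x * f' x + u' x * f x) = u B * f B - u A * f A"
    unfolding set_lebesgue_integral_def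
  proof (rule integral_FTC_atLeastAtMost)
    show "((\<lambda>x. u x * f x) has_vector_derivative (u x * f' x + u' x * f x)) (at x within {A..B})" if "A \<le> x" "x \<le> B" for x
      using DERIV_mult[OF u f, of x] that AB
      by (auto simp: has_real_derivative_iff_has_vector_derivative[symmetric] algebra_simps intro: has_field_derivative_at_within)
    show "continuous_on {A..B} (\<lambda>x. u x * f' x + u' x * f x)" by (intro continuous_intros uc fc)
  qed (use AB in auto)
  also have "\<dots> = 0" using ab(3)[of A] ab(3)[of B] AB by auto
  finally show "(LINT x:{0<..}|lborel. u x * f' x) = - (LINT x:{0<..}|lborel. u' x * f x)"
    unfolding e1 e2 using set_integral_add(2)[OF i] by simp
qed

text \<open>Let q = u^2 + V^2 and let G x be its integral beyond x, which tends to 0. The derivative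
  2 u V of u^2 is dominated by q, so u(x)^2 \<le> u(y)^2 + G x for y \<ge> x, and averaging over y
  in a window of length one gives u(x)^2 \<le> 2 G x.\<close>

lemma sobolev_rep_tendsto_0:
  assumes "sobolev_rep u V"
  shows "(u \<longlongrightarrow> 0) at_top"
proof -
  note r = assms[unfolded sobolev_rep_def]
  have m: "V \<in> borel_measurable lborel" and V2: "integrable lborel (\<lambda>x. (V x)\<^sup>2)" and uc: "continuous_on {0..} u"
    using r by auto
  define q where "q x = indicator {0<..} x *\<^sub>R (u x)\<^sup>2 + (V x)\<^sup>2" for x
  have q: "integrable lborel q"
    unfolding q_def[abs_def] using r by (intro Bochner_Integration.integrable_add) (auto simp: set_integrable_def)
  have q0: "q x \<ge> 0" for x by (simp add: q_def)
  have qi: "set_integrable lborel A q" if "A \<in> sets borel" for A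
    using q that unfolding set_integrable_def by (intro integrable_mult_indicator) auto
  define G where "G x = (LINT s:{x..}|lborel. q s)" for x
  have "(G \<longlongrightarrow> (LINT s::real|lborel. 0)) at_top"
    unfolding G_def set_lebesgue_integral_def
  proof (rule integral_dominated_convergence_at_top[where w=q])
    show "AE x in lborel. ((\<lambda>t. indicator {t..} x *\<^sub>R q x) \<longlongrightarrow> 0) at_top"
    proof (intro AE_I2 tendsto_eventually)
      fix x :: real
      show "\<forall>\<^sub>F t in at_top. indicator {t..} x *\<^sub>R q x = 0"
        by (rule eventually_at_top_linorderI[of "x + 1"]) (auto simp: indicator_def)
    qed
    show "\<forall>\<^sub>F t in at_top. AE x in lborel. norm (indicator {t..} x *\<^sub>R q x) \<le> q x"
      by (intro always_eventually allI AE_I2) (auto simp: indicator_def q0)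
  qed (use q in \<open>auto simp: set_integrable_def\<close>)
  then have G: "(G \<longlongrightarrow> 0) at_top" by simp
  have key: "(u x)\<^sup>2 \<le> 2 * G x" if x: "x > 0" for x
  proof -
    have G0: "(LINT s:{x..y}|lborel. q s) \<le> G x" for y
      unfolding G_def set_lebesgue_integral_def
    proof (rule integral_mono)
      show "integrable lborel (\<lambda>s. indicator {x..y} s *\<^sub>R q s)" "integrable lborel (\<lambda>s. indicator {x..} s *\<^sub>R q s)"
        using qi[of "{x..y}"] qi[of "{x..}"] unfolding set_integrable_def by simp_all
    qed (auto simp: indicator_def q0)
    have uxy: "continuous_on {x..y} u" for y using uc by (rule continuous_on_subset) (use x in auto)
    have st: "(u x)\<^sup>2 \<le> (u y)\<^sup>2 + G x" if y: "x \<le> y" for y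
    proof -
      have Vi: "set_integrable lborel {a..b} (\<lambda>s. \<bar>V s\<bar>)" for a b
        by (intro set_integrable_abs set_integrable_Icc_of_square m V2)
      have "\<bar>(u y)\<^sup>2 - (u x)\<^sup>2\<bar> \<le> (LINT r:{x..y}|lborel. \<bar>2 * u r\<bar> * \<bar>V r\<bar>)"
      proof (rule chain_inequality[where S=UNIV and P="\<lambda>w. w\<^sup>2" and \<psi>="\<lambda>w. 2 * w", OF y uxy Vi])
        show "\<bar>u t - u s\<bar> \<le> (LINT r:{s..t}|lborel. \<bar>V r\<bar>)" if "x \<le> s" "s \<le> t" "t \<le> y" for s t
        proof -
          have "u t - u s = (LINT r:{s..t}|lborel. V r)" using assms that x unfolding sobolev_rep_def by (meson less_imp_le order_trans)
          then show ?thesis using set_integral_norm_bound[OF set_integrable_Icc_of_square[OF m V2], of s t] by simp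
        qed
      qed (auto intro!: derivative_eq_intros continuous_intros)
      also have "\<dots> \<le> (LINT r:{x..y}|lborel. q r)"
      proof (rule set_integral_mono)
        show "set_integrable lborel {x..y} (\<lambda>r. \<bar>2 * u r\<bar> * \<bar>V r\<bar>)"
          by (rule set_integrable_continuous_mult[OF Vi]) (intro continuous_intros uxy)
        show "\<bar>2 * u s\<bar> * \<bar>V s\<bar> \<le> q s" if "s \<in> {x..y}" for s
          using zero_le_power2[of "\<bar>u s\<bar> - \<bar>V s\<bar>"] that x by (simp add: q_def power2_diff abs_mult)
      qed (use qi in auto)
      finally show ?thesis using G0[of y] by linarith
    qed
    have "(u x)\<^sup>2 = (LINT y:{x..x+1}|lborel. (u x)\<^sup>2)" by (simp add: set_lebesgue_integral_def)
    also have "\<dots> \<le> (LINT y:{x..x+1}|lborel. q y + G x)"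
    proof (rule set_integral_mono)
      show "set_integrable lborel {x..x+1} (\<lambda>y. q y + G x)" using qi by (intro set_integral_add borel_integrable_atLeastAtMost'[OF continuous_on_const]) auto
      show "(u x)\<^sup>2 \<le> q y + G x" if "y \<in> {x..x+1}" for y
      proof -
        have "q y = (u y)\<^sup>2 + (V y)\<^sup>2" using that x by (simp add: q_def)
        moreover have "(u x)\<^sup>2 \<le> (u y)\<^sup>2 + G x" using st that by simp
        moreover have "0 \<le> (V y)\<^sup>2" by simp
        ultimately show ?thesis by linarith
      qed
    qed (rule borel_integrable_atLeastAtMost'[OF continuous_on_const])
    also have "(LINT y:{x..x+1}|lborel. q y + G x) = (LINT y:{x..x+1}|lborel. q y) + (LINT y:{x..x+1}|lborel. G x)"
      using qi by (intro set_integral_add borel_integrable_atLeastAtMost'[OF continuous_on_const]) auto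
    also have "(LINT y:{x..x+1}|lborel. G x) = G x" by (simp add: set_lebesgue_integral_def)
    finally show ?thesis using G0[of "x+1"] by simp
  qed
  have "((\<lambda>x. (u x)\<^sup>2) \<longlongrightarrow> 0) at_top"
  proof (rule tendsto_sandwich[of "\<lambda>_. 0" _ _ "\<lambda>x. 2 * G x"])
    show "((\<lambda>x. 2 * G x) \<longlongrightarrow> 0) at_top" using tendsto_mult[OF tendsto_const[of 2] G] by simp
    show "\<forall>\<^sub>F x in at_top. (u x)\<^sup>2 \<le> 2 * G x" using key by (intro eventually_at_top_dense[THEN iffD2]) blast
  qed auto
  then have "((\<lambda>x. sqrt ((u x)\<^sup>2)) \<longlongrightarrow> sqrt 0) at_top" by (rule tendsto_real_sqrt)
  then show ?thesis by (simp add: tendsto_rabs_zero_iff)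
qed

section \<open>Integrals of powers of the hyperbolic secant\<close>

text \<open>The oriented integral is used so that the primitive is differentiable on the whole line,
  including at negative arguments; the truncation of a soliton at 0 evaluates it there.\<close>

definition primitive :: "(real \<Rightarrow> real) \<Rightarrow> real \<Rightarrow> real" where
  "primitive f x = (LBINT s=ereal 0..ereal x. f s)"

lemma primitive_0 [simp]: "primitive f 0 = 0"
  by (simp add: primitive_def)

lemma DERIV_primitive:
  assumes "continuous_on UNIV f"
  shows "(primitive f has_real_derivative f x) (at x)"
proof -
  define a b where "a = min (-1) (x - 1)" and "b = max 1 (x + 1)"
  have "(primitive f has_vector_derivative f x) (at x within {a..b})"
    unfolding primitive_def[abs_def]
    by (rule interval_integral_FTC2) (auto simp: a_def b_def intro: continuous_on_subset[OF assms])
  then have "(primitive f has_vector_derivative f x) (at x)"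
    using at_within_Icc_at[of a x b] by (auto simp: a_def b_def)
  then show ?thesis by (simp add: has_real_derivative_iff_has_vector_derivative)
qed

lemma half_line_FTC:
  fixes f F :: "real \<Rightarrow> real"
  assumes F: "\<And>x. (F has_real_derivative f x) (at x)" and f: "\<And>x. isCont f x" and nn: "\<And>x. 0 \<le> f x"
    and L: "(F \<longlongrightarrow> L) at_top"
  shows "set_integrable lborel {0<..} f" "(LINT x:{0<..}|lborel. f x) = L - F 0"
proof -
  have e: "einterval (ereal 0) \<infinity> = {0<..}" by (auto simp: einterval_def)
  have A: "((F \<circ> real_of_ereal) \<longlongrightarrow> F 0) (at_right (ereal 0))"
  proof -
    have "(F \<longlongrightarrow> F 0) (at_right 0)"
      using DERIV_isCont[OF F, of 0] by (auto simp: isCont_def filterlim_at_split)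
    then show ?thesis by (simp add: ereal_tendsto_simps)
  qed
  have B: "((F \<circ> real_of_ereal) \<longlongrightarrow> L) (at_left \<infinity>)"
    using L by (simp add: ereal_tendsto_simps)
  note r = interval_integral_FTC_nonneg[of "ereal 0" \<infinity> F f, OF _ F f _ A B]
  show "set_integrable lborel {0<..} f" using r(1) nn unfolding e by simp
  show "(LINT x:{0<..}|lborel. f x) = L - F 0"
    using r(2) nn by (simp add: interval_lebesgue_integral_def e[unfolded zero_ereal_def[symmetric]] zero_ereal_def)
qed

lemma real_line_FTC:
  fixes f F :: "real \<Rightarrow> real"
  assumes F: "\<And>x. (F has_real_derivative f x) (at x)" and f: "\<And>x. isCont f x" and nn: "\<And>x. 0 \<le> f x"
    and L: "(F \<longlongrightarrow> L) at_top" and K: "(F \<longlongrightarrow> K) at_bot"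
  shows "(LINT x|lborel. f x) = L - K"
proof -
  have e: "einterval (-\<infinity>) \<infinity> = UNIV" by (auto simp: einterval_def)
  have A: "((F \<circ> real_of_ereal) \<longlongrightarrow> K) (at_right (-\<infinity>))" using K by (simp add: ereal_tendsto_simps)
  have B: "((F \<circ> real_of_ereal) \<longlongrightarrow> L) (at_left \<infinity>)" using L by (simp add: ereal_tendsto_simps)
  show ?thesis
    using interval_integral_FTC_nonneg(2)[of "-\<infinity>" \<infinity> F f, OF _ F f _ A B] nn
    by (simp add: interval_lebesgue_integral_def e set_lebesgue_integral_def)
qed

text \<open>In terms of the ratio \<open>r = u / max u\<close>, \<^term>\<open>psi b\<close> is the speed along the soliton and
  \<^term>\<open>Psi b\<close> the geodesic length between the levels \<open>0\<close> and \<open>r\<close>, where \<open>b = 2 / (p - 2)\<close>.\<close>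

definition psi :: "real \<Rightarrow> real \<Rightarrow> real" where
  "psi b r = \<bar>r\<bar> * sqrt (1 - \<bar>r\<bar> powr (2 / b))"

definition Psi :: "real \<Rightarrow> real \<Rightarrow> real" where
  "Psi b = primitive (psi b)"

definition sech_kin :: "real \<Rightarrow> real \<Rightarrow> real" where
  "sech_kin b = primitive (\<lambda>x. b * (tanh x)\<^sup>2 * cosh x powr (-2 * b))"

text \<open>The antiderivative of cosh^(-2 b) vanishing at 0, rewritten by integration by parts. One
  non-elementary function thus serves both mass and kinetic energy, and this link between the two is
  what later produces the mass in the derivative of the envelope.\<close>

definition sech_mass :: "real \<Rightarrow> real \<Rightarrow> real" where
  "sech_mass b x = (2 * b + 1) / b * sech_kin b x + tanh x * cosh x powr (-2 * b)"

text \<open>The limit of \<open>sech_mass\<close> at infinity, where \<open>sech_kin\<close> tends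
  to \<open>Psi b 1\<close> and the boundary term to 0.\<close>

definition sech_mass_top :: "real \<Rightarrow> real" where
  "sech_mass_top b = (2 * b + 1) / b * Psi b 1"

lemma continuous_psi: "b > 0 \<Longrightarrow> continuous_on UNIV (psi b)"
  unfolding psi_def[abs_def] by (intro continuous_intros continuous_on_powr') auto

lemma psi_nonneg: "b > 0 \<Longrightarrow> 0 \<le> r \<Longrightarrow> r \<le> 1 \<Longrightarrow> 0 \<le> psi b r"
  unfolding psi_def by (intro mult_nonneg_nonneg real_sqrt_ge_zero) (auto intro: powr_le1)

lemma psi_pos: assumes "b > 0" "0 < r" "r < 1" shows "0 < psi b r"
proof -
  have "r powr (2 / b) < r powr 0" by (rule powr_less_mono') (use assms in auto)
  then show ?thesis using assms by (simp add: psi_def)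
qed

lemma DERIV_Psi: "b > 0 \<Longrightarrow> (Psi b has_real_derivative psi b r) (at r)"
  unfolding Psi_def by (rule DERIV_primitive[OF continuous_psi])

lemma Psi_0 [simp]: "Psi b 0 = 0" by (simp add: Psi_def)

lemma Psi_strict_mono:
  assumes b: "b > 0" and r: "0 \<le> r" "r < s" "s \<le> 1"
  shows "Psi b r < Psi b s"
proof (rule DERIV_pos_imp_increasing_open[OF r(2)])
  show "\<exists>y. (Psi b has_real_derivative y) (at x) \<and> 0 < y" if "r < x" "x < s" for x
    using DERIV_Psi[OF b] psi_pos[OF b, of x] that r by auto
  show "continuous_on {r..s} (Psi b)"
    by (intro continuous_at_imp_continuous_on ballI DERIV_isCont[OF DERIV_Psi[OF b]])
qed

lemma Psi_1_pos: "b > 0 \<Longrightarrow> 0 < Psi b 1"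
  using Psi_strict_mono[of b 0 1] by simp

lemma cosh_pos [simp]: "cosh (x::real) > 0" by (rule cosh_real_pos)

lemma DERIV_cosh_powr: "((\<lambda>x. cosh x powr a) has_real_derivative a * tanh x * cosh x powr a) (at (x::real))"
proof -
  have "((\<lambda>x. cosh x powr a) has_real_derivative a * cosh x powr (a - 1) * sinh x) (at x)"
    by (auto intro!: derivative_eq_intros simp: powr_diff)
  also have "a * cosh x powr (a - 1) * sinh x = a * tanh x * cosh x powr a"
    by (simp add: powr_diff tanh_def)
  finally show ?thesis .
qed

lemma DERIV_sech_kin: "(sech_kin b has_real_derivative b * (tanh x)\<^sup>2 * cosh x powr (-2 * b)) (at x)"
  unfolding sech_kin_def by (rule DERIV_primitive) (auto intro!: continuous_intros)

lemma sech_kin_0 [simp]: "sech_kin b 0 = 0" by (simp add: sech_kin_def)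

lemma sech_kin_minus: "sech_kin b (- x) = - sech_kin b x"
proof -
  have "((\<lambda>x. sech_kin b x + sech_kin b (- x)) has_real_derivative 0) (at x)" for x
    by (rule DERIV_cong) (auto intro!: derivative_eq_intros DERIV_sech_kin DERIV_chain2[OF DERIV_sech_kin])
  then have "sech_kin b x + sech_kin b (- x) = sech_kin b 0 + sech_kin b (- 0)"
    by (intro DERIV_isconst_all) auto
  then show ?thesis by simp
qed

lemma sech_mass_minus: "sech_mass b (- x) = - sech_mass b x"
  by (simp add: sech_mass_def sech_kin_minus)

lemma tanh_sq: "(tanh x)\<^sup>2 = 1 - cosh x powr (-2)" for x :: real
proof -
  have "(tanh x)\<^sup>2 = (sinh x)\<^sup>2 / (cosh x)\<^sup>2" by (simp add: tanh_def power_divide)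
  also have "\<dots> = 1 - 1 / (cosh x)\<^sup>2" by (simp add: sinh_square_eq field_simps)
  also have "1 / (cosh x)\<^sup>2 = cosh x powr (-2)" by (simp add: powr_minus_divide)
  finally show ?thesis .
qed

lemma DERIV_sech_mass:
  assumes "b > 0"
  shows "(sech_mass b has_real_derivative cosh x powr (-2 * b)) (at x)"
proof -
  have t: "(tanh has_real_derivative 1 - (tanh x)\<^sup>2) (at x)" by (auto intro!: derivative_eq_intros)
  have "(sech_mass b has_real_derivative (2 * b + 1) / b * (b * (tanh x)\<^sup>2 * cosh x powr (-2 * b)) +
     ((1 - (tanh x)\<^sup>2) * cosh x powr (-2 * b) + (-2 * b) * tanh x * cosh x powr (-2 * b) * tanh x)) (at x)"
    unfolding sech_mass_def[abs_def]
    by (intro DERIV_add DERIV_cmult DERIV_mult DERIV_sech_kin DERIV_cosh_powr t)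
  also have "(2 * b + 1) / b * (b * (tanh x)\<^sup>2 * cosh x powr (-2 * b)) +
     ((1 - (tanh x)\<^sup>2) * cosh x powr (-2 * b) + (-2 * b) * tanh x * cosh x powr (-2 * b) * tanh x) = cosh x powr (-2 * b)"
  proof -
    have "(2 * b + 1) / b * (b * (tanh x)\<^sup>2 * cosh x powr (-2 * b)) = (2 * b + 1) * ((tanh x)\<^sup>2 * cosh x powr (-2 * b))"
      using assms by simp
    then show ?thesis by (simp add: power2_eq_square algebra_simps)
  qed
  finally show ?thesis .
qed

lemma psi_cosh: "psi b (cosh x powr (- b)) = cosh x powr (- b) * \<bar>tanh x\<bar>" if "b > 0" for x :: real
proof -
  have "(cosh x powr (- b)) powr (2 / b) = cosh x powr (-2)" using that by (simp add: powr_powr)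
  then show ?thesis by (simp add: psi_def tanh_sq[symmetric])
qed

text \<open>Substitution of the level r = cosh(x)^(-b): it decreases at rate b tanh(x) r, while
  \<open>psi\<close> at that level is tanh(x) r. So the kinetic integral over an arc of the soliton
  is the geodesic length between its end levels, which is equality in the later lower bound.\<close>

lemma sech_kin_eq_Psi:
  assumes b: "b > 0" and x: "0 \<le> x"
  shows "sech_kin b x = Psi b 1 - Psi b (cosh x powr (- b))"
proof -
  define g where "g x = sech_kin b x + Psi b (cosh x powr (- b))" for x
  have g: "(g has_real_derivative 0) (at y)" if "0 \<le> y" for y
  proof -
    have "(g has_real_derivative b * (tanh y)\<^sup>2 * cosh y powr (-2 * b) + psi b (cosh y powr (- b)) * ((- b) * tanh y * cosh y powr (- b))) (at y)"
      unfolding g_def[abs_def] by (intro DERIV_add DERIV_sech_kin DERIV_chain2[OF DERIV_Psi[OF b]] DERIV_cosh_powr)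
    also have "b * (tanh y)\<^sup>2 * cosh y powr (-2 * b) + psi b (cosh y powr (- b)) * ((- b) * tanh y * cosh y powr (- b)) = 0"
      using that by (simp add: psi_cosh[OF b] power2_eq_square powr_add[symmetric])
    finally show ?thesis .
  qed
  have "g x = g 0"
  proof (cases "x = 0")
    case False
    show ?thesis by (rule DERIV_isconst2[of 0 x]) (use False x g DERIV_isCont[OF g] in \<open>auto intro!: continuous_at_imp_continuous_on\<close>)
  qed simp
  then show ?thesis by (simp add: g_def)
qed

lemma cosh_powr_tendsto_0: "a > 0 \<Longrightarrow> ((\<lambda>x::real. cosh x powr (- a)) \<longlongrightarrow> 0) at_top"
  using cosh_real_at_top by (intro tendsto_neg_powr) auto

lemma sech_kin_tendsto: assumes b: "b > 0" shows "(sech_kin b \<longlongrightarrow> Psi b 1) at_top"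
proof -
  have "((\<lambda>x. Psi b 1 - Psi b (cosh x powr (- b))) \<longlongrightarrow> Psi b 1 - Psi b 0) at_top"
    by (intro tendsto_intros isCont_tendsto_compose[OF DERIV_isCont[OF DERIV_Psi[OF b]]] cosh_powr_tendsto_0 b)
  then have "((\<lambda>x. Psi b 1 - Psi b (cosh x powr (- b))) \<longlongrightarrow> Psi b 1) at_top" by simp
  then show ?thesis
    by (rule Lim_transform_eventually)
       (use sech_kin_eq_Psi[OF b] in \<open>auto intro!: eventually_at_top_linorderI[of 0]\<close>)
qed

lemma sech_mass_tendsto: assumes b: "b > 0" shows "(sech_mass b \<longlongrightarrow> sech_mass_top b) at_top"
proof -
  have "((\<lambda>x. (2 * b + 1) / b * sech_kin b x + tanh x * cosh x powr (- (2 * b))) \<longlongrightarrow> (2 * b + 1) / b * Psi b 1 + 1 * 0) at_top"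
    by (intro tendsto_intros sech_kin_tendsto cosh_powr_tendsto_0 tanh_real_at_top) (use b in auto)
  then show ?thesis by (simp add: sech_mass_def[abs_def] sech_mass_top_def)
qed

lemma sech_mass_strict_mono: "b > 0 \<Longrightarrow> x < y \<Longrightarrow> sech_mass b x < sech_mass b y"
  by (rule DERIV_pos_imp_increasing) (use DERIV_sech_mass in \<open>auto intro!: exI\<close>)

lemma sech_mass_less_top: assumes b: "b > 0" shows "sech_mass b x < sech_mass_top b"
proof -
  have "sech_mass b x < sech_mass b (x + 1)" by (rule sech_mass_strict_mono) (use b in auto)
  also have "\<dots> \<le> sech_mass_top b"
    by (rule tendsto_lowerbound[OF sech_mass_tendsto[OF b]])
       (use sech_mass_strict_mono[OF b] in \<open>auto intro!: eventually_at_top_linorderI[of "x + 1"] simp: order_le_less\<close>)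
  finally show ?thesis .
qed

lemma sech_mass_0 [simp]: "sech_mass b 0 = 0" by (simp add: sech_mass_def)

text \<open>The antiderivatives are rescaled copies of \<open>sech_mass\<close> and
  \<open>sech_kin\<close> at k x - T. Both are odd, which turns the value at the lower limit into a
  summand at T.\<close>

lemma sech_integrals:
  assumes b: "b > 0" and k: "k > 0"
  shows "set_integrable lborel {0<..} (\<lambda>x. cosh (k * x - T) powr (-2 * b))"
    "(LINT x:{0<..}|lborel. cosh (k * x - T) powr (-2 * b)) = (sech_mass_top b + sech_mass b T) / k"
    "set_integrable lborel {0<..} (\<lambda>x. (tanh (k * x - T))\<^sup>2 * cosh (k * x - T) powr (-2 * b))"
    "(LINT x:{0<..}|lborel. (tanh (k * x - T))\<^sup>2 * cosh (k * x - T) powr (-2 * b)) = (Psi b 1 + sech_kin b T) / (b * k)"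
proof -
  have lim: "filterlim (\<lambda>x. k * x - T) at_top at_top"
    using filterlim_tendsto_add_at_top[OF tendsto_const[of "- T"] filterlim_tendsto_pos_mult_at_top[OF tendsto_const k filterlim_ident]]
    by simp
  have 1: "((\<lambda>x. sech_mass b (k * x - T) / k) has_real_derivative cosh (k * x - T) powr (-2 * b)) (at x)" for x
    using k by (auto intro!: derivative_eq_intros DERIV_chain2[OF DERIV_sech_mass[OF b]])
  have l1: "((\<lambda>x. sech_mass b (k * x - T) / k) \<longlongrightarrow> sech_mass_top b / k) at_top"
    by (intro tendsto_divide filterlim_compose[OF sech_mass_tendsto[OF b] lim] tendsto_const) (use k in auto)
  have 2: "((\<lambda>x. sech_kin b (k * x - T) / (b * k)) has_real_derivative (tanh (k * x - T))\<^sup>2 * cosh (k * x - T) powr (-2 * b)) (at x)" for x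
    using k b by (auto intro!: derivative_eq_intros DERIV_chain2[OF DERIV_sech_kin])
  have l2: "((\<lambda>x. sech_kin b (k * x - T) / (b * k)) \<longlongrightarrow> Psi b 1 / (b * k)) at_top"
    by (intro tendsto_divide filterlim_compose[OF sech_kin_tendsto[OF b] lim] tendsto_const) (use k b in auto)
  have c1: "isCont (\<lambda>x. cosh (k * x - T) powr (-2 * b)) x" for x by (intro continuous_intros) auto
  have c2: "isCont (\<lambda>x. (tanh (k * x - T))\<^sup>2 * cosh (k * x - T) powr (-2 * b)) x" for x
    by (intro continuous_intros) auto
  show "set_integrable lborel {0<..} (\<lambda>x. cosh (k * x - T) powr (-2 * b))"
    "(LINT x:{0<..}|lborel. cosh (k * x - T) powr (-2 * b)) = (sech_mass_top b + sech_mass b T) / k"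
    using half_line_FTC[OF 1 c1 _ l1] by (auto simp: sech_mass_minus add_divide_distrib)
  show "set_integrable lborel {0<..} (\<lambda>x. (tanh (k * x - T))\<^sup>2 * cosh (k * x - T) powr (-2 * b))"
    "(LINT x:{0<..}|lborel. (tanh (k * x - T))\<^sup>2 * cosh (k * x - T) powr (-2 * b)) = (Psi b 1 + sech_kin b T) / (b * k)"
    using half_line_FTC[OF 2 c2 _ l2] by (auto simp: sech_kin_minus add_divide_distrib)
qed

lemma sech_integral_line:
  assumes b: "b > 0" and k: "k > 0"
  shows "(LINT x|lborel. cosh (k * x) powr (-2 * b)) = 2 * sech_mass_top b / k"
proof -
  have lim: "filterlim (\<lambda>x. k * x) at_top at_top"
    by (rule filterlim_tendsto_pos_mult_at_top[OF tendsto_const k filterlim_ident])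
  have 1: "((\<lambda>x. sech_mass b (k * x) / k) has_real_derivative cosh (k * x) powr (-2 * b)) (at x)" for x
    using k by (auto intro!: derivative_eq_intros DERIV_chain2[OF DERIV_sech_mass[OF b]])
  have l1: "((\<lambda>x. sech_mass b (k * x) / k) \<longlongrightarrow> sech_mass_top b / k) at_top"
    by (intro tendsto_divide filterlim_compose[OF sech_mass_tendsto[OF b] lim] tendsto_const) (use k in auto)
  have l2: "((\<lambda>x. sech_mass b (k * x) / k) \<longlongrightarrow> - (sech_mass_top b / k)) at_bot"
    using tendsto_minus[OF l1] by (simp add: filterlim_at_bot_mirror sech_mass_minus)
  have c1: "isCont (\<lambda>x. cosh (k * x) powr (-2 * b)) x" for x by (intro continuous_intros) auto
  show ?thesis using real_line_FTC[OF 1 c1 _ l1 l2] by (simp add: field_simps)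
qed

section \<open>Truncated solitons\<close>

locale supercritical_nls =
  fixes p \<alpha> b c :: real
  assumes p4: "4 < p" and p6: "p < 6" and alpha: "0 < \<alpha>"
    and b_eq: "b = 2 / (p - 2)" and c_eq: "c = (p / 2) powr b"
begin

lemma b_bounds: "1/2 < b" "b < 1" "0 < b"
  using p4 p6 by (auto simp: b_eq field_simps)

lemma p_eq: "p = 2 + 2 / b"
  using p4 by (simp add: b_eq field_simps)

lemma c_pos: "0 < c"
  using p4 by (simp add: c_eq)

text \<open>The maximum of the soliton of frequency \<sigma>^2, that is, the positive zero of
  \<sigma>^2 w^2 - (2 / p) w^p; see \<open>amp_powr\<close>.\<close>

definition amp :: "real \<Rightarrow> real" where
  "amp \<sigma> = sqrt c * \<sigma> powr b"

lemma amp_pos: "0 < \<sigma> \<Longrightarrow> 0 < amp \<sigma>"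
  using c_pos by (simp add: amp_def)

lemma amp_sq: "0 < \<sigma> \<Longrightarrow> (amp \<sigma>)\<^sup>2 = c * \<sigma> powr (2 * b)"
  using c_pos by (simp add: amp_def power_mult_distrib powr_power mult.commute)

lemma amp_powr: assumes "0 < \<sigma>" shows "amp \<sigma> powr (2 / b) = p / 2 * \<sigma>\<^sup>2"
proof -
  have "amp \<sigma> powr (2 / b) = ((amp \<sigma>)\<^sup>2) powr (1 / b)"
    using amp_pos[OF assms] by (simp add: powr_powr flip: powr_numeral)
  also have "\<dots> = c powr (1 / b) * \<sigma> powr 2"
    using amp_sq[OF assms] c_pos b_bounds assms by (simp add: powr_mult powr_powr)
  also have "c powr (1 / b) = p / 2"
    using b_bounds p4 by (simp add: c_eq powr_powr)
  finally show ?thesis using assms by simp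
qed

text \<open>The soliton of frequency \<open>\<sigma>\<^sup>2\<close> centred at \<open>b T / \<sigma>\<close>.\<close>

definition shifted :: "real \<Rightarrow> real \<Rightarrow> real \<Rightarrow> real" where
  "shifted \<sigma> T x = amp \<sigma> * cosh (\<sigma> / b * x - T) powr (- b)"

definition shifted' :: "real \<Rightarrow> real \<Rightarrow> real \<Rightarrow> real" where
  "shifted' \<sigma> T x = - \<sigma> * tanh (\<sigma> / b * x - T) * shifted \<sigma> T x"

definition profile :: "real \<Rightarrow> real \<Rightarrow> real \<Rightarrow> real" where
  "profile \<sigma> T = restrict (shifted \<sigma> T) {0..}"

definition profile_mass :: "real \<Rightarrow> real \<Rightarrow> real" where
  "profile_mass \<sigma> T = c * b * \<sigma> powr (2 * b - 1) * (sech_mass_top b + sech_mass b T)"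

text \<open>This is the action rather than the energy: the term \<sigma>^2 / 2 times the mass is
  still to be subtracted, as in \<open>energy_profile\<close>.\<close>

definition profile_energy :: "real \<Rightarrow> real \<Rightarrow> real" where
  "profile_energy \<sigma> T = c * \<sigma> powr (2 * b + 1) * (Psi b 1 + sech_kin b T)
     + \<alpha> * c / 2 * \<sigma> powr (2 * b) * cosh T powr (- 2 * b)"

lemma shifted_pos: "0 < \<sigma> \<Longrightarrow> 0 < shifted \<sigma> T x"
  by (simp add: shifted_def amp_pos)

lemma DERIV_shifted: "(shifted \<sigma> T has_real_derivative shifted' \<sigma> T x) (at x)"
proof -
  have "((\<lambda>x. \<sigma> / b * x - T) has_real_derivative \<sigma> / b) (at x)"
    using b_bounds(3) by (auto intro!: derivative_eq_intros)
  note d = DERIV_cmult[OF DERIV_chain2[OF DERIV_cosh_powr this], of "amp \<sigma>" "- b"]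
  show ?thesis unfolding shifted_def[abs_def] shifted'_def
    by (rule DERIV_cong[OF d]) (use b_bounds(3) in simp)
qed

lemma shifted_sq: assumes "0 < \<sigma>"
  shows "(shifted \<sigma> T x)\<^sup>2 = (amp \<sigma>)\<^sup>2 * cosh (\<sigma> / b * x - T) powr (-2 * b)"
  by (simp add: shifted_def power_mult_distrib powr_power mult.commute)

lemma shifted_powr_minus: assumes "0 < \<sigma>"
  shows "shifted \<sigma> T x powr (p - 2) = p / 2 * \<sigma>\<^sup>2 * (1 - (tanh (\<sigma> / b * x - T))\<^sup>2)"
proof -
  have "shifted \<sigma> T x powr (2 / b) = amp \<sigma> powr (2 / b) * cosh (\<sigma> / b * x - T) powr (- 2)"
    using b_bounds amp_pos[OF assms] by (simp add: shifted_def powr_mult powr_powr)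
  then show ?thesis using amp_powr[OF assms] by (simp add: p_eq tanh_sq)
qed

lemma shifted_powr: assumes "0 < \<sigma>"
  shows "shifted \<sigma> T x powr p = p / 2 * \<sigma>\<^sup>2 * (1 - (tanh (\<sigma> / b * x - T))\<^sup>2) * (shifted \<sigma> T x)\<^sup>2"
proof -
  have "shifted \<sigma> T x powr p = shifted \<sigma> T x powr (p - 2) * (shifted \<sigma> T x)\<^sup>2"
    using shifted_pos[OF assms, of T x] powr_add[of "shifted \<sigma> T x" "p - 2" 2] by simp
  then show ?thesis using shifted_powr_minus[OF assms] by simp
qed

lemma continuous_on_shifted: "continuous_on A (shifted \<sigma> T)"
  by (intro continuous_at_imp_continuous_on ballI DERIV_isCont[OF DERIV_shifted])

lemma continuous_on_shifted': "continuous_on A (shifted' \<sigma> T)"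
  unfolding shifted'_def[abs_def] using b_bounds by (intro continuous_intros continuous_on_shifted) auto

lemma shifted_integrals:
  assumes s: "0 < \<sigma>"
  shows "set_integrable lborel {0<..} (\<lambda>x. (shifted \<sigma> T x)\<^sup>2)"
    "(LINT x:{0<..}|lborel. (shifted \<sigma> T x)\<^sup>2) = profile_mass \<sigma> T"
    "set_integrable lborel {0<..} (\<lambda>x. (shifted' \<sigma> T x)\<^sup>2)"
    "(LINT x:{0<..}|lborel. (shifted' \<sigma> T x)\<^sup>2) = c * \<sigma> powr (2 * b + 1) * (Psi b 1 + sech_kin b T)"
proof -
  have k: "\<sigma> / b > 0" using s b_bounds by simp
  note I = sech_integrals[OF b_bounds(3) k, of T]
  show "set_integrable lborel {0<..} (\<lambda>x. (shifted \<sigma> T x)\<^sup>2)"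
    unfolding shifted_sq[OF s] using I(1) by (intro set_integrable_mult_right) auto
  show "(LINT x:{0<..}|lborel. (shifted \<sigma> T x)\<^sup>2) = profile_mass \<sigma> T"
    unfolding shifted_sq[OF s] set_integral_mult_right I(2) amp_sq[OF s] profile_mass_def
    using s b_bounds by (simp add: powr_diff field_simps)
  have e: "(shifted' \<sigma> T x)\<^sup>2 = \<sigma>\<^sup>2 * (amp \<sigma>)\<^sup>2 * ((tanh (\<sigma> / b * x - T))\<^sup>2 * cosh (\<sigma> / b * x - T) powr (-2 * b))" for x
    unfolding shifted'_def power_mult_distrib shifted_sq[OF s] by simp
  show "set_integrable lborel {0<..} (\<lambda>x. (shifted' \<sigma> T x)\<^sup>2)"
    unfolding e using I(3) by (intro set_integrable_mult_right) auto
  show "(LINT x:{0<..}|lborel. (shifted' \<sigma> T x)\<^sup>2) = c * \<sigma> powr (2 * b + 1) * (Psi b 1 + sech_kin b T)"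
    unfolding e set_integral_mult_right I(4) amp_sq[OF s]
    using s b_bounds by (simp add: powr_add field_simps power2_eq_square)
qed

lemma profile_eq: "0 \<le> x \<Longrightarrow> profile \<sigma> T x = shifted \<sigma> T x"
  by (simp add: profile_def)

lemma profile_H1:
  assumes s: "0 < \<sigma>"
  shows "profile \<sigma> T \<in> H1_half" "L2_half (shifted' \<sigma> T)" "weak_deriv_half (profile \<sigma> T) (shifted' \<sigma> T)"
proof -
  have L: "L2_half f" if "continuous_on {0<..} f" "set_integrable lborel {0<..} (\<lambda>x. (f x)\<^sup>2)" for f
    unfolding L2_half_def set_borel_measurable_def using that
    by (auto intro!: borel_measurable_continuous_on_indicator simp del: real_scaleR_def)
  show 1: "L2_half (shifted' \<sigma> T)" by (rule L[OF continuous_on_shifted' shifted_integrals(3)[OF s]])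
  have c: "continuous_on {0..} (profile \<sigma> T)"
    by (rule continuous_on_eq[OF continuous_on_shifted[of "{0..}" \<sigma> T]]) (simp add: profile_eq)
  have 2: "L2_half (profile \<sigma> T)"
  proof (rule L)
    show "continuous_on {0<..} (profile \<sigma> T)" using c by (rule continuous_on_subset) auto
    show "set_integrable lborel {0<..} (\<lambda>x. (profile \<sigma> T x)\<^sup>2)"
      using shifted_integrals(1)[OF s, of T] by (rule set_integrable_cong[THEN iffD1, rotated -1]) (auto simp: profile_eq)
  qed
  show 3: "weak_deriv_half (profile \<sigma> T) (shifted' \<sigma> T)"
  proof (rule classical_weak_deriv[OF _ continuous_on_shifted'])
    fix x :: real assume "0 < x"
    then show "(profile \<sigma> T has_real_derivative shifted' \<sigma> T x) (at x)"
      by (intro has_field_derivative_transform_within_open[OF DERIV_shifted, of "{0<..}"]) (auto simp: profile_eq)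
  qed
  show "profile \<sigma> T \<in> H1_half" using c 1 2 3 by (auto simp: H1_half_def profile_def)
qed

lemma mass_profile: assumes s: "0 < \<sigma>" shows "mass (profile \<sigma> T) = profile_mass \<sigma> T"
proof -
  have "mass (profile \<sigma> T) = (LINT x:{0<..}|lborel. (shifted \<sigma> T x)\<^sup>2)"
    unfolding mass_def by (rule set_lebesgue_integral_cong) (auto simp: profile_eq)
  then show ?thesis using shifted_integrals(2)[OF s] by simp
qed

text \<open>The first integral of the soliton expresses (2 / p) u^p as \<sigma>^2 u^2 - u'^2. This
  removes the potential term and leaves the full kinetic integral, the boundary term and a multiple
  of the mass.\<close>

lemma energy_profile:
  assumes s: "0 < \<sigma>"
  shows "energy p \<alpha> (profile \<sigma> T) = profile_energy \<sigma> T - \<sigma>\<^sup>2 / 2 * profile_mass \<sigma> T"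
proof -
  note I = shifted_integrals[OF s, of T]
  have K: "(LINT x:{0<..}|lborel. \<bar>wderiv (profile \<sigma> T) x\<bar>\<^sup>2) = (LINT x:{0<..}|lborel. (shifted' \<sigma> T x)\<^sup>2)"
    using kinetic_unique[OF profile_H1[OF s]] by simp
  have e: "\<bar>profile \<sigma> T x\<bar> powr p = p / 2 * (\<sigma>\<^sup>2 * (shifted \<sigma> T x)\<^sup>2 - (shifted' \<sigma> T x)\<^sup>2)" if "0 < x" for x
    using that shifted_powr[OF s, of T x] shifted_pos[OF s, of T x]
    by (simp add: profile_eq shifted'_def power_mult_distrib algebra_simps)
  have "(LINT x:{0<..}|lborel. \<bar>profile \<sigma> T x\<bar> powr p) = (LINT x:{0<..}|lborel. p / 2 * (\<sigma>\<^sup>2 * (shifted \<sigma> T x)\<^sup>2 - (shifted' \<sigma> T x)\<^sup>2))"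
    by (rule set_lebesgue_integral_cong) (auto simp: e)
  also have "\<dots> = p / 2 * (\<sigma>\<^sup>2 * (LINT x:{0<..}|lborel. (shifted \<sigma> T x)\<^sup>2) - (LINT x:{0<..}|lborel. (shifted' \<sigma> T x)\<^sup>2))"
    using I(1,3) by (simp add: set_integral_diff(2)[OF set_integrable_mult_right])
  finally have P: "(LINT x:{0<..}|lborel. \<bar>profile \<sigma> T x\<bar> powr p) = \<dots>" .
  have z: "\<bar>profile \<sigma> T 0\<bar>\<^sup>2 = c * \<sigma> powr (2 * b) * cosh T powr (-2 * b)"
    using shifted_sq[OF s, of T 0] amp_sq[OF s] by (simp add: profile_eq)
  show ?thesis unfolding energy_def K P z I profile_energy_def using p4 by (simp add: field_simps)
qed

lemma sech_mass_top_pos: "0 < sech_mass_top b"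
  using Psi_1_pos[OF b_bounds(3)] b_bounds by (simp add: sech_mass_top_def)

lemma sech_mass_sum_pos: "0 < sech_mass_top b + sech_mass b T"
  using sech_mass_less_top[OF b_bounds(3), of "- T"] by (simp add: sech_mass_minus)

lemma profile_mass_pos: "0 < \<sigma> \<Longrightarrow> 0 < profile_mass \<sigma> T"
  unfolding profile_mass_def using c_pos b_bounds sech_mass_sum_pos[of T] by simp

lemma profile_mass_strict_mono: "0 < \<sigma> \<Longrightarrow> S < T \<Longrightarrow> profile_mass \<sigma> S < profile_mass \<sigma> T"
  unfolding profile_mass_def using c_pos b_bounds sech_mass_strict_mono[of b S T] by simp

lemma soliton_mass_eq: "soliton_mass p (\<alpha>\<^sup>2) = 2 * c * b * \<alpha> powr (2 * b - 1) * sech_mass_top b"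
proof -
  have e: "\<bar>soliton p (\<alpha>\<^sup>2) x\<bar>\<^sup>2 = c * \<alpha> powr (2 * b) * cosh (\<alpha> / b * x) powr (-2 * b)" for x
  proof -
    define C where "C = cosh (\<alpha> / b * x)"
    have C: "C > 0" by (simp add: C_def)
    have "(p / 2 - 1) * sqrt (\<alpha>\<^sup>2) * \<bar>x\<bar> = \<bar>\<alpha> / b * x\<bar>"
    proof -
      have "p / 2 - 1 = 1 / b" using b_bounds by (simp add: p_eq field_simps)
      then show ?thesis using alpha b_bounds(3) by (simp add: abs_mult)
    qed
    then have "cosh ((p / 2 - 1) * sqrt (\<alpha>\<^sup>2) * \<bar>x\<bar>) = C" by (simp add: C_def)
    then have "\<bar>soliton p (\<alpha>\<^sup>2) x\<bar>\<^sup>2 = ((p / 2 * \<alpha>\<^sup>2 * (1 / C)\<^sup>2) powr (1 / (p - 2)))\<^sup>2" by (simp add: soliton_def)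
    also have "\<dots> = (p / 2 * \<alpha>\<^sup>2 * (1 / C)\<^sup>2) powr b" by (simp add: power2_eq_square b_eq flip: powr_add)
    also have "p / 2 * \<alpha>\<^sup>2 * (1 / C)\<^sup>2 = p / 2 * \<alpha> powr 2 * C powr (-2)"
      using alpha C by (simp add: power_divide powr_minus_divide)
    also have "\<dots> powr b = c * \<alpha> powr (2 * b) * C powr (-2 * b)"
      by (simp only: c_eq powr_mult powr_powr mult_ac)
    finally show ?thesis by (simp add: C_def)
  qed
  have k: "\<alpha> / b > 0" using alpha b_bounds by simp
  show ?thesis
    unfolding soliton_mass_def e integral_mult_right_zero sech_integral_line[OF b_bounds(3) k]
    using alpha b_bounds by (simp add: powr_diff field_simps)
qed

end

section \<open>The mass curve and the energy envelope\<close>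

lemma tanh_artanh_real:
  assumes "\<bar>x\<bar> < (1::real)"
  shows "tanh (artanh x) = x"
proof -
  have p: "0 < (1 + x) / (1 - x)" using assms by (intro divide_pos_pos) auto
  have "exp (- (2 * artanh x)) = inverse ((1 + x) / (1 - x))"
    using p by (simp add: artanh_def exp_minus)
  then have "tanh (artanh x) = (1 - inverse ((1 + x) / (1 - x))) / (1 + inverse ((1 + x) / (1 - x)))"
    by (simp add: tanh_real_altdef)
  also have "\<dots> = x" using assms by (simp add: field_simps)
  finally show ?thesis .
qed

lemma artanh_pos_real: "0 < x \<Longrightarrow> x < 1 \<Longrightarrow> 0 < artanh (x::real)"
  by (simp add: artanh_def)

context supercritical_nls
begin

definition centre :: "real \<Rightarrow> real" where
  "centre \<sigma> = artanh (\<alpha> / \<sigma>)"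

text \<open>Up to \<open>\<alpha>\<close> the optimal competitor is a whole soliton escaping to infinity, beyond \<open>\<alpha>\<close> it is
  the bound state of frequency \<open>\<sigma>\<^sup>2\<close>.\<close>

definition mass_curve :: "real \<Rightarrow> real" where
  "mass_curve \<sigma> = (if \<sigma> \<le> \<alpha> then c * b * \<sigma> powr (2 * b - 1) * (2 * sech_mass_top b) else profile_mass \<sigma> (centre \<sigma>))"

definition envelope0 :: "real \<Rightarrow> real" where
  "envelope0 \<sigma> = (if \<sigma> \<le> \<alpha> then c * \<sigma> powr (2 * b + 1) * (2 * Psi b 1) else profile_energy \<sigma> (centre \<sigma>))"

definition envelope :: "real \<Rightarrow> real \<Rightarrow> real" where
  "envelope \<mu> \<sigma> = envelope0 \<sigma> - \<sigma>\<^sup>2 / 2 * \<mu>"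

lemma tanh_centre: "\<alpha> < \<sigma> \<Longrightarrow> tanh (centre \<sigma>) = \<alpha> / \<sigma>"
  unfolding centre_def using alpha by (intro tanh_artanh_real) auto

lemma centre_pos: "\<alpha> < \<sigma> \<Longrightarrow> 0 < centre \<sigma>"
  unfolding centre_def using alpha by (intro artanh_pos_real) auto

lemma centre_tendsto: "filterlim centre at_top (at_right \<alpha>)"
  unfolding centre_def[abs_def]
proof (rule filterlim_compose[OF artanh_real_at_left_1])
  have "((\<lambda>\<sigma>. \<alpha> / \<sigma>) \<longlongrightarrow> \<alpha> / \<alpha>) (at_right \<alpha>)" using alpha by (intro tendsto_intros) auto
  then show "filterlim (\<lambda>\<sigma>. \<alpha> / \<sigma>) (at_left 1) (at_right \<alpha>)"
    using alpha by (auto simp: filterlim_at eventually_at_filter)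
qed

lemma DERIV_centre: "\<alpha> < \<sigma> \<Longrightarrow> \<exists>d. (centre has_real_derivative d) (at \<sigma>)"
proof
  assume s: "\<alpha> < \<sigma>"
  then have "((\<lambda>\<sigma>. \<alpha> / \<sigma>) has_real_derivative - \<alpha> / \<sigma>\<^sup>2) (at \<sigma>)"
    using alpha by (auto intro!: derivative_eq_intros simp: power2_eq_square)
  from DERIV_chain2[OF artanh_real_has_field_derivative this]
  show "(centre has_real_derivative 1 / (1 - (\<alpha> / \<sigma>)\<^sup>2) * (- \<alpha> / \<sigma>\<^sup>2)) (at \<sigma>)"
    using s alpha by (simp add: centre_def[abs_def])
qed

text \<open>As \<sigma> decreases to \<alpha> the centre goes to infinity, so the limit of g there
  is the value that joins the two branches. Applied to \<open>sech_mass\<close>,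
  \<open>sech_kin\<close> and a power of cosh it gives continuity of the mass curve and of the
  envelope.\<close>

lemma continuous_glue:
  assumes g: "continuous_on UNIV g" and L: "(g \<longlongrightarrow> L) at_top"
  shows "continuous_on {0<..} (\<lambda>\<sigma>. if \<sigma> \<le> \<alpha> then L else g (centre \<sigma>))"
proof (rule continuous_at_imp_continuous_on, rule ballI)
  fix x :: real assume "x \<in> {0<..}"
  let ?f = "\<lambda>\<sigma>. if \<sigma> \<le> \<alpha> then L else g (centre \<sigma>)"
  consider "x < \<alpha>" | "x > \<alpha>" | "x = \<alpha>" by linarith
  then show "isCont ?f x"
  proof cases
    case 1
    have "\<forall>\<^sub>F \<sigma> in nhds x. ?f \<sigma> = L"
      using eventually_nhds_in_open[of "{..<\<alpha>}" x] 1 by (auto elim: eventually_mono)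
    then show ?thesis using isCont_cong[of ?f "\<lambda>_. L" x] by simp
  next
    case 2
    have "\<forall>\<^sub>F \<sigma> in nhds x. ?f \<sigma> = g (centre \<sigma>)"
      using eventually_nhds_in_open[of "{\<alpha><..}" x] 2 by (auto elim: eventually_mono)
    moreover have "isCont (\<lambda>\<sigma>. g (centre \<sigma>)) x"
    proof (rule isCont_o2)
      show "isCont centre x" using DERIV_centre[OF 2] DERIV_isCont by blast
      show "isCont g (centre x)" using g continuous_on_eq_continuous_at[of UNIV g] by auto
    qed
    ultimately show ?thesis using isCont_cong[of ?f "\<lambda>\<sigma>. g (centre \<sigma>)" x] by simp
  next
    case 3
    have "(?f \<longlongrightarrow> L) (at_left \<alpha>)"
      by (rule tendsto_eventually) (auto simp: eventually_at_filter)
    moreover have "(?f \<longlongrightarrow> L) (at_right \<alpha>)"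
      by (rule Lim_transform_eventually[OF filterlim_compose[OF L centre_tendsto]])
         (auto simp: eventually_at_filter)
    ultimately show ?thesis unfolding 3 isCont_def by (auto simp: filterlim_at_split)
  qed
qed

lemma continuous_mass_curve: "continuous_on {0<..} mass_curve"
proof -
  have "continuous_on UNIV (sech_mass b)"
    by (intro continuous_at_imp_continuous_on ballI DERIV_isCont[OF DERIV_sech_mass[OF b_bounds(3)]])
  from continuous_glue[OF this sech_mass_tendsto[OF b_bounds(3)]]
  have "continuous_on {0<..} (\<lambda>\<sigma>. c * b * \<sigma> powr (2 * b - 1) * (sech_mass_top b +
    (if \<sigma> \<le> \<alpha> then sech_mass_top b else sech_mass b (centre \<sigma>))))"
    by (intro continuous_intros) auto
  then show ?thesis
    by (rule continuous_on_cong[THEN iffD1, rotated -1]) (auto simp: mass_curve_def profile_mass_def)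
qed

lemma continuous_envelope: "continuous_on {0<..} (envelope \<mu>)"
proof -
  have 1: "continuous_on UNIV (sech_kin b)"
    by (intro continuous_at_imp_continuous_on ballI DERIV_isCont[OF DERIV_sech_kin])
  have 2: "continuous_on UNIV (\<lambda>x::real. cosh x powr (- (2 * b)))"
    by (intro continuous_intros) auto
  have 3: "((\<lambda>x::real. cosh x powr (- (2 * b))) \<longlongrightarrow> 0) at_top"
    using b_bounds by (intro cosh_powr_tendsto_0) auto
  from continuous_glue[OF 1 sech_kin_tendsto[OF b_bounds(3)]] continuous_glue[OF 2 3]
  have "continuous_on {0<..} (\<lambda>\<sigma>. c * \<sigma> powr (2 * b + 1) * (Psi b 1 +
      (if \<sigma> \<le> \<alpha> then Psi b 1 else sech_kin b (centre \<sigma>))) + \<alpha> * c / 2 * \<sigma> powr (2 * b) *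
      (if \<sigma> \<le> \<alpha> then 0 else cosh (centre \<sigma>) powr (- (2 * b))) - \<sigma>\<^sup>2 / 2 * \<mu>)"
    by (intro continuous_intros) auto
  then show ?thesis
    by (rule continuous_on_cong[THEN iffD1, rotated -1]) (auto simp: envelope_def envelope0_def profile_energy_def)
qed

text \<open>Beyond \<alpha> the frequency acts also through the centre, but the two terms with the
  derivative d of the centre cancel, because \<alpha> = \<sigma> tanh (centre \<sigma>) makes the
  action stationary in the centre. Only the explicit powers of \<sigma> contribute.\<close>

lemma DERIV_envelope:
  assumes s: "0 < \<sigma>" "\<sigma> \<noteq> \<alpha>"
  shows "(envelope \<mu> has_real_derivative \<sigma> * (mass_curve \<sigma> - \<mu>)) (at \<sigma>)"
proof (cases "\<sigma> < \<alpha>")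
  case True
  have q: "((\<lambda>\<sigma>. \<sigma>\<^sup>2 / 2 * \<mu>) has_real_derivative \<sigma> * \<mu>) (at \<sigma>)" by (auto intro!: derivative_eq_intros)
  have "((\<lambda>\<sigma>. \<sigma> powr (2 * b + 1)) has_real_derivative (2 * b + 1) * \<sigma> powr (2 * b)) (at \<sigma>)"
    using has_real_derivative_powr[OF s(1), of "2 * b + 1"] by simp
  from DERIV_diff[OF DERIV_cmult_right[OF DERIV_cmult[OF this]] q, of c "2 * Psi b 1"]
  have "((\<lambda>\<sigma>. c * \<sigma> powr (2 * b + 1) * (2 * Psi b 1) - \<sigma>\<^sup>2 / 2 * \<mu>) has_real_derivative
     c * ((2 * b + 1) * \<sigma> powr (2 * b)) * (2 * Psi b 1) - \<sigma> * \<mu>) (at \<sigma>)" .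
  also have "c * ((2 * b + 1) * \<sigma> powr (2 * b)) * (2 * Psi b 1) - \<sigma> * \<mu> = \<sigma> * (mass_curve \<sigma> - \<mu>)"
    using True s b_bounds by (simp add: mass_curve_def sech_mass_top_def powr_diff field_simps)
  finally show ?thesis
    by (rule has_field_derivative_transform_within_open[of _ _ _ "{0<..<\<alpha>}"])
       (use s True in \<open>auto simp: envelope_def envelope0_def\<close>)
next
  case False
  then have sa: "\<alpha> < \<sigma>" using s by simp
  obtain d where d: "(centre has_real_derivative d) (at \<sigma>)" using DERIV_centre[OF sa] by blast
  define C where "C = cosh (centre \<sigma>) powr (- 2 * b)"
  define t where "t = tanh (centre \<sigma>)"
  have t: "\<alpha> = \<sigma> * t" using tanh_centre[OF sa] s by (simp add: t_def)
  have d1: "((\<lambda>\<sigma>. sech_kin b (centre \<sigma>)) has_real_derivative b * t\<^sup>2 * C * d) (at \<sigma>)"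
    unfolding t_def C_def by (rule DERIV_chain2[OF DERIV_sech_kin d])
  have d2: "((\<lambda>\<sigma>. cosh (centre \<sigma>) powr (- 2 * b)) has_real_derivative (- 2 * b) * t * C * d) (at \<sigma>)"
    unfolding t_def C_def by (rule DERIV_chain2[OF DERIV_cosh_powr d])
  have d3: "((\<lambda>\<sigma>. \<sigma> powr a) has_real_derivative a * \<sigma> powr a / \<sigma>) (at \<sigma>)" for a
    using s by (auto intro!: derivative_eq_intros simp: powr_diff)
  have d4: "((\<lambda>\<sigma>. \<sigma>\<^sup>2 / 2 * \<mu>) has_real_derivative \<sigma> * \<mu>) (at \<sigma>)" by (auto intro!: derivative_eq_intros)
  define K where "K = sech_kin b (centre \<sigma>)"
  have "((\<lambda>\<sigma>. profile_energy \<sigma> (centre \<sigma>) - \<sigma>\<^sup>2 / 2 * \<mu>) has_real_derivative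
      (c * ((2 * b + 1) * \<sigma> powr (2 * b + 1) / \<sigma>)) * (Psi b 1 + K) + (0 + b * t\<^sup>2 * C * d) * (c * \<sigma> powr (2 * b + 1))
      + ((\<alpha> * c / 2 * (2 * b * \<sigma> powr (2 * b) / \<sigma>)) * C + ((- 2 * b) * t * C * d) * (\<alpha> * c / 2 * \<sigma> powr (2 * b))) - \<sigma> * \<mu>) (at \<sigma>)"
    unfolding profile_energy_def K_def C_def
    by (intro DERIV_diff DERIV_add DERIV_mult DERIV_cmult DERIV_const d1[unfolded C_def] d2[unfolded C_def] d3 d4)
  also have "(c * ((2 * b + 1) * \<sigma> powr (2 * b + 1) / \<sigma>)) * (Psi b 1 + K) + (0 + b * t\<^sup>2 * C * d) * (c * \<sigma> powr (2 * b + 1))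
      + ((\<alpha> * c / 2 * (2 * b * \<sigma> powr (2 * b) / \<sigma>)) * C + ((- 2 * b) * t * C * d) * (\<alpha> * c / 2 * \<sigma> powr (2 * b))) - \<sigma> * \<mu>
      = \<sigma> * (mass_curve \<sigma> - \<mu>)"
  proof -
    define Y where "Y = \<sigma> powr (2 * b)"
    have y: "\<sigma> powr (2 * b + 1) = \<sigma> * Y" "\<sigma> powr (2 * b - 1) = Y / \<sigma>"
      using s by (simp_all add: Y_def powr_add powr_diff)
    have m: "\<sigma> * mass_curve \<sigma> = c * b * Y * ((2 * b + 1) / b * (Psi b 1 + K) + t * C)"
    proof -
      have "mass_curve \<sigma> = profile_mass \<sigma> (centre \<sigma>)" using sa by (simp add: mass_curve_def)
      also have "\<dots> = c * b * (Y / \<sigma>) * ((2 * b + 1) / b * (Psi b 1 + K) + t * C)"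
        unfolding profile_mass_def y sech_mass_top_def sech_mass_def K_def t_def C_def by (simp only: distrib_left add.assoc)
      finally show ?thesis using s by simp
    qed
    have m2: "\<sigma> * mass_curve \<sigma> = c * Y * ((2 * b + 1) * (Psi b 1 + K)) + c * b * Y * t * C"
    proof -
      have "c * b * Y * ((2 * b + 1) / b * (Psi b 1 + K)) = c * Y * ((2 * b + 1) * (Psi b 1 + K))"
        using b_bounds(3) by simp
      then show ?thesis unfolding m distrib_left[of "c * b * Y"] by simp
    qed
    have z: "c * ((2 * b + 1) * (\<sigma> * Y) / \<sigma>) * (Psi b 1 + K) = c * Y * ((2 * b + 1) * (Psi b 1 + K))"
      "\<alpha> * c / 2 * (2 * b * Y / \<sigma>) * C = c * b * Y * t * C"
      using s by (simp_all add: t)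
    show ?thesis unfolding right_diff_distrib m2 y Y_def[symmetric] z
      by (simp add: t power2_eq_square algebra_simps)
  qed
  finally show ?thesis
    by (rule has_field_derivative_transform_within_open[of _ _ _ "{\<alpha><..}"])
       (use sa in \<open>auto simp: envelope_def envelope0_def\<close>)
qed

section \<open>Shape of the mass curve\<close>

lemma mass_curve_alpha: "mass_curve \<alpha> = soliton_mass p (\<alpha>\<^sup>2)"
  by (simp add: mass_curve_def soliton_mass_eq)

lemma mass_curve_pos: "0 < \<sigma> \<Longrightarrow> 0 < mass_curve \<sigma>"
  using c_pos b_bounds sech_mass_top_pos by (simp add: mass_curve_def profile_mass_pos)

lemma mass_curve_strict_mono_left: "0 < \<sigma> \<Longrightarrow> \<sigma> < \<tau> \<Longrightarrow> \<tau> \<le> \<alpha> \<Longrightarrow> mass_curve \<sigma> < mass_curve \<tau>"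
  using c_pos b_bounds sech_mass_top_pos by (simp add: mass_curve_def powr_less_mono2)

lemma mass_curve_attains_left:
  assumes "0 < \<mu>" "\<mu> \<le> mass_curve \<alpha>"
  shows "\<exists>\<sigma>>0. \<sigma> \<le> \<alpha> \<and> mass_curve \<sigma> = \<mu>"
proof -
  define K where "K = c * b * (2 * sech_mass_top b)"
  have K: "K > 0" using c_pos b_bounds sech_mass_top_pos by (simp add: K_def)
  have e: "mass_curve \<sigma> = K * \<sigma> powr (2 * b - 1)" if "\<sigma> \<le> \<alpha>" for \<sigma>
    using that by (simp add: mass_curve_def K_def)
  \<comment> \<open>Below \<alpha> the curve is a pure power of \<sigma> with positive exponent 2 b
    - 1, which is solved explicitly.\<close>
  define \<sigma> where "\<sigma> = (\<mu> / K) powr (1 / (2 * b - 1))"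
  have s: "\<sigma> > 0" using assms K by (simp add: \<sigma>_def)
  have sp: "\<sigma> powr (2 * b - 1) = \<mu> / K" using assms K b_bounds by (simp add: \<sigma>_def powr_powr)
  have "\<sigma> powr (2 * b - 1) \<le> \<alpha> powr (2 * b - 1)"
    using assms e[of \<alpha>] K unfolding sp by (simp add: field_simps)
  then have "\<sigma> \<le> \<alpha>" using b_bounds s alpha powr_less_mono2[of "2 * b - 1" \<alpha> \<sigma>] by force
  then show ?thesis using s sp e K by auto
qed

text \<open>The factor that carries the sign of the derivative of the mass when the bound states are
  parametrised by the centre T, with \<sigma> = \<alpha> / tanh T.\<close>

definition mass_slope :: "real \<Rightarrow> real" where
  "mass_slope T = tanh T * cosh T powr (2 - 2 * b) - (2 * b - 1) * (sech_mass_top b + sech_mass b T)"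

text \<open>By tanh^2 = 1 - cosh^(-2) all multiples of cosh^(-2 b) cancel. What remains is positive
  because b < 1, that is p > 4, and so the slope changes sign only once.\<close>

lemma DERIV_mass_slope: "(mass_slope has_real_derivative (2 - 2 * b) * cosh T powr (2 - 2 * b)) (at T)"
proof -
  have t: "(tanh has_real_derivative 1 - (tanh x)\<^sup>2) (at x)" for x :: real by (auto intro!: derivative_eq_intros)
  have "(mass_slope has_real_derivative ((1 - (tanh T)\<^sup>2) * cosh T powr (2 - 2 * b) + (2 - 2 * b) * tanh T * cosh T powr (2 - 2 * b) * tanh T)
      - (2 * b - 1) * (0 + cosh T powr (- 2 * b))) (at T)"
    unfolding mass_slope_def[abs_def]
    by (intro DERIV_diff DERIV_mult t DERIV_cosh_powr DERIV_cmult DERIV_add DERIV_const DERIV_sech_mass b_bounds)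
  also have "((1 - (tanh T)\<^sup>2) * cosh T powr (2 - 2 * b) + (2 - 2 * b) * tanh T * cosh T powr (2 - 2 * b) * tanh T)
      - (2 * b - 1) * (0 + cosh T powr (- 2 * b)) = (2 - 2 * b) * cosh T powr (2 - 2 * b)"
  proof -
    define X where "X = cosh T powr (2 - 2 * b)"
    have X: "(tanh T)\<^sup>2 * X = X - cosh T powr (- 2 * b)"
      unfolding tanh_sq X_def by (simp add: left_diff_distrib flip: powr_add)
    have "(1 - (tanh T)\<^sup>2) * X + (2 - 2 * b) * tanh T * X * tanh T = X + (1 - 2 * b) * ((tanh T)\<^sup>2 * X)"
      by (simp add: power2_eq_square algebra_simps)
    then show ?thesis unfolding X_def[symmetric] X by (simp add: algebra_simps)
  qed
  finally show ?thesis .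
qed

lemma mass_slope_strict_mono: "S < T \<Longrightarrow> mass_slope S < mass_slope T"
  by (rule DERIV_pos_imp_increasing) (use DERIV_mass_slope b_bounds in \<open>force+\<close>)

lemma mass_slope_root: "\<exists>T>0. mass_slope T = 0"
proof -
  have neg: "mass_slope 0 < 0" using sech_mass_top_pos b_bounds by (simp add: mass_slope_def)
  \<comment> \<open>As cosh is at least 1, the slope grows at rate at least 2 - 2 b; from its
    negative value at 0 it is nonnegative by the time R.\<close>
  define R where "R = - mass_slope 0 / (2 - 2 * b)"
  have R: "R > 0" using neg b_bounds unfolding R_def by (intro divide_pos_pos) auto
  obtain z where z: "mass_slope R - mass_slope 0 = (R - 0) * ((2 - 2 * b) * cosh z powr (2 - 2 * b))"
    using MVT2[of 0 R mass_slope "\<lambda>T. (2 - 2 * b) * cosh T powr (2 - 2 * b)"] R DERIV_mass_slope by auto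
  have "R * ((2 - 2 * b) * 1) \<le> R * ((2 - 2 * b) * cosh z powr (2 - 2 * b))"
    using R b_bounds cosh_real_ge_1[of z] by (intro mult_left_mono ge_one_powr_ge_zero) auto
  also have "R * ((2 - 2 * b) * 1) = - mass_slope 0" using b_bounds by (simp add: R_def)
  finally have "mass_slope R \<ge> 0" using z by simp
  then obtain T where "0 \<le> T" "T \<le> R" "mass_slope T = 0"
    using IVT[of mass_slope 0 0 R] neg R DERIV_isCont[OF DERIV_mass_slope] by auto
  then show ?thesis using neg by (metis less_irrefl order_le_less)
qed

text \<open>In the parameter T the relation tanh T = \<alpha> / \<sigma> is solved explicitly for
  the frequency, and the derivative splits off positive factors.\<close>

lemma DERIV_mass_along:
  assumes T: "T > 0"
  shows "((\<lambda>T. profile_mass (\<alpha> / tanh T) T) has_real_derivative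
     c * b * \<alpha> powr (2 * b - 1) * (tanh T powr (- 2 * b) * cosh T powr (- 2) * mass_slope T)) (at T)"
proof -
  have tp: "tanh S > 0" if "S > 0" for S :: real using that by simp
  have e: "profile_mass (\<alpha> / tanh S) S = c * b * \<alpha> powr (2 * b - 1) * (tanh S powr (1 - 2 * b) * (sech_mass_top b + sech_mass b S))" if "S > 0" for S
  proof -
    have "(\<alpha> / tanh S) powr (2 * b - 1) = \<alpha> powr (2 * b - 1) * tanh S powr (1 - 2 * b)"
      using alpha tp[OF that] by (simp add: powr_divide powr_diff powr_minus field_simps)
    then show ?thesis by (simp add: profile_mass_def)
  qed
  have t: "((\<lambda>T. tanh T powr (1 - 2 * b)) has_real_derivative (1 - 2 * b) * tanh T powr (- 2 * b) * cosh T powr (- 2)) (at T)"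
  proof -
    have "(tanh has_real_derivative cosh T powr (- 2)) (at T)"
      by (rule DERIV_cong[where X="1 - (tanh T)\<^sup>2"]) (auto intro!: derivative_eq_intros simp: tanh_sq)
    from DERIV_chain2[OF has_real_derivative_powr[OF tp[OF T]] this, of "1 - 2 * b"] show ?thesis by simp
  qed
  have "((\<lambda>T. c * b * \<alpha> powr (2 * b - 1) * (tanh T powr (1 - 2 * b) * (sech_mass_top b + sech_mass b T))) has_real_derivative
    c * b * \<alpha> powr (2 * b - 1) * ((1 - 2 * b) * tanh T powr (- 2 * b) * cosh T powr (- 2) * (sech_mass_top b + sech_mass b T)
      + (0 + cosh T powr (- 2 * b)) * tanh T powr (1 - 2 * b))) (at T)"
    by (intro DERIV_cmult DERIV_mult t DERIV_add DERIV_const DERIV_sech_mass b_bounds)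
  also have "(1 - 2 * b) * tanh T powr (- 2 * b) * cosh T powr (- 2) * (sech_mass_top b + sech_mass b T)
      + (0 + cosh T powr (- 2 * b)) * tanh T powr (1 - 2 * b) = tanh T powr (- 2 * b) * cosh T powr (- 2) * mass_slope T"
  proof -
    have "cosh T powr (- 2 * b) = cosh T powr (- 2) * cosh T powr (2 - 2 * b)" by (simp flip: powr_add)
    moreover have "tanh T powr (1 - 2 * b) = tanh T * tanh T powr (- 2 * b)" using tp[OF T] by (simp add: powr_mult_base)
    ultimately show ?thesis by (simp add: mass_slope_def algebra_simps)
  qed
  finally show ?thesis
    by (rule has_field_derivative_transform_within_open[of _ _ _ "{0<..}"]) (use T e in auto)
qed

text \<open>In T the mass falls up to the root of \<open>mass_slope\<close> and rises afterwards.
  Since \<open>centre\<close> is strictly decreasing in the frequency, the two phases appear in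
  reverse: the mass falls just beyond \<alpha> and rises for high frequencies.\<close>

lemma mass_curve_turning:
  obtains \<sigma>s where "\<alpha> < \<sigma>s"
    "\<And>\<sigma> \<tau>. \<alpha> < \<sigma> \<Longrightarrow> \<sigma> < \<tau> \<Longrightarrow> \<tau> \<le> \<sigma>s \<Longrightarrow> mass_curve \<tau> < mass_curve \<sigma>"
    "\<And>\<sigma> \<tau>. \<sigma>s \<le> \<sigma> \<Longrightarrow> \<sigma> < \<tau> \<Longrightarrow> mass_curve \<sigma> < mass_curve \<tau>"
proof -
  obtain T0 where T0: "T0 > 0" "mass_slope T0 = 0" using mass_slope_root by blast
  define m where "m T = profile_mass (\<alpha> / tanh T) T" for T
  have m: "(m has_real_derivative c * b * \<alpha> powr (2 * b - 1) * (tanh T powr (- 2 * b) * cosh T powr (- 2) * mass_slope T)) (at T)" if "T > 0" for T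
    unfolding m_def[abs_def] by (rule DERIV_mass_along[OF that])
  have K: "c * b * \<alpha> powr (2 * b - 1) > 0" using c_pos b_bounds alpha by simp
  have inc: "m S < m T" if "T0 \<le> S" "S < T" for S T
  proof (rule DERIV_pos_imp_increasing_open[OF that(2)])
    show "\<exists>y. (m has_real_derivative y) (at x) \<and> 0 < y" if "S < x" "x < T" for x
    proof -
      have "0 < tanh x powr (- 2 * b) * cosh x powr (- 2) * mass_slope x"
        using mass_slope_strict_mono[of T0 x] T0 that \<open>T0 \<le> S\<close> by simp
      from mult_pos_pos[OF K this] show ?thesis using m[of x] T0 that \<open>T0 \<le> S\<close> by (meson less_le_trans less_trans)
    qed
    show "continuous_on {S..T} m"
      using T0 that by (intro continuous_at_imp_continuous_on ballI DERIV_isCont[OF m]) auto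
  qed
  have dec: "m T < m S" if "0 < S" "S < T" "T \<le> T0" for S T
  proof (rule DERIV_neg_imp_decreasing_open[OF that(2)])
    show "\<exists>y. (m has_real_derivative y) (at x) \<and> y < 0" if "S < x" "x < T" for x
    proof -
      have "tanh x powr (- 2 * b) * cosh x powr (- 2) * mass_slope x < 0"
        using mass_slope_strict_mono[of x T0] T0 that \<open>0 < S\<close> \<open>T \<le> T0\<close> by (intro mult_pos_neg) auto
      from mult_pos_neg[OF K this] show ?thesis using m[of x] that \<open>0 < S\<close> by (meson less_trans)
    qed
    show "continuous_on {S..T} m"
      using that by (intro continuous_at_imp_continuous_on ballI DERIV_isCont[OF m]) auto
  qed
  have mc: "mass_curve \<sigma> = m (centre \<sigma>)" if "\<alpha> < \<sigma>" for \<sigma>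
    using that alpha tanh_centre[OF that] by (simp add: m_def mass_curve_def)
  have cm: "centre \<tau> < centre \<sigma>" if "\<alpha> < \<sigma>" "\<sigma> < \<tau>" for \<sigma> \<tau>
  proof -
    have "tanh (centre \<tau>) < tanh (centre \<sigma>)" using tanh_centre that alpha by (simp add: divide_strict_left_mono)
    then show ?thesis by simp
  qed
  define \<sigma>s where "\<sigma>s = \<alpha> / tanh T0"
  have tT: "0 < tanh T0" "tanh T0 < 1" using T0 tanh_real_bounds[of T0] by auto
  have ss: "\<alpha> < \<sigma>s" using tT alpha by (simp add: \<sigma>s_def field_simps)
  have cs: "centre \<sigma>s = T0" using tT alpha by (simp add: centre_def \<sigma>s_def artanh_tanh_real)
  have le: "centre \<tau> \<le> centre \<sigma>" if "\<alpha> < \<sigma>" "\<sigma> \<le> \<tau>" for \<sigma> \<tau>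
    using cm[of \<sigma> \<tau>] that by (cases "\<sigma> = \<tau>") auto
  show ?thesis
  proof (rule that[OF ss])
    fix \<sigma> \<tau> assume "\<alpha> < \<sigma>" "\<sigma> < \<tau>" "\<tau> \<le> \<sigma>s"
    then show "mass_curve \<tau> < mass_curve \<sigma>"
      using inc[of "centre \<tau>" "centre \<sigma>"] le[of \<tau> \<sigma>s] cm[of \<sigma> \<tau>] by (simp add: mc cs)
  next
    fix \<sigma> \<tau> assume "\<sigma>s \<le> \<sigma>" "\<sigma> < \<tau>"
    then show "mass_curve \<sigma> < mass_curve \<tau>"
      using dec[of "centre \<tau>" "centre \<sigma>"] le[of \<sigma>s \<sigma>] cm[of \<sigma> \<tau>] centre_pos[of \<tau>] ss by (simp add: mc cs)
  qed
qed

lemma mass_curve_unbounded: "\<exists>\<tau>>\<sigma>. \<mu> < mass_curve \<tau>"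
proof -
  define K where "K = c * b * sech_mass_top b"
  have K: "K > 0" using c_pos b_bounds sech_mass_top_pos by (simp add: K_def)
  \<comment> \<open>N solves K N^(2 b - 1) = |\<mu>| + 1, where K times that power of the frequency
    is a lower bound for the mass curve beyond \<alpha>.\<close>
  define N where "N = ((\<bar>\<mu>\<bar> + 1) / K) powr (1 / (2 * b - 1))"
  define \<tau> where "\<tau> = max N (max \<sigma> \<alpha>) + 1"
  have q: "0 < (\<bar>\<mu>\<bar> + 1) / K" using K by (intro divide_pos_pos) auto
  have "(\<bar>\<mu>\<bar> + 1) / K = N powr (2 * b - 1)" using b_bounds q K by (simp add: N_def powr_powr)
  also have "\<dots> \<le> \<tau> powr (2 * b - 1)"
    by (rule powr_mono2) (use b_bounds in \<open>auto simp: \<tau>_def N_def\<close>)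
  finally have "\<mu> < K * \<tau> powr (2 * b - 1)" using K by (simp add: field_simps)
  then have t: "\<mu> < K * \<tau> powr (2 * b - 1)" "\<sigma> < \<tau>" "\<alpha> < \<tau>" by (auto simp: \<tau>_def)
  have "0 \<le> sech_mass b (centre \<tau>)"
    using sech_mass_strict_mono[OF b_bounds(3) centre_pos[OF t(3)]] by simp
  then have "c * b * \<tau> powr (2 * b - 1) * sech_mass_top b \<le> mass_curve \<tau>"
    using t c_pos b_bounds unfolding mass_curve_def profile_mass_def by (auto intro!: mult_left_mono)
  then show ?thesis using t by (intro exI[of _ \<tau>]) (simp add: K_def mult_ac)
qed


section \<open>Local minima of the envelope and the threshold masses\<close>

lemma envelope_strict_antimono:
  assumes x: "0 < x" "x < y" and m: "\<And>z. x < z \<Longrightarrow> z < y \<Longrightarrow> z \<noteq> \<alpha> \<Longrightarrow> mass_curve z < \<mu>"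
  shows "envelope \<mu> y < envelope \<mu> x"
proof -
  \<comment> \<open>\<open>DERIV_envelope\<close> excludes \<alpha>, so the interval is cut there;
    continuity joins the two pieces.\<close>
  have s: "envelope \<mu> v < envelope \<mu> u" if "x \<le> u" "u < v" "v \<le> y" "\<alpha> \<notin> {u<..<v}" for u v
  proof (rule DERIV_neg_imp_decreasing_open[OF that(2)])
    fix z assume z: "u < z" "z < v"
    then have "z \<noteq> \<alpha>" "0 < z" "mass_curve z < \<mu>" using that x m[of z] by auto
    then have "(envelope \<mu> has_real_derivative z * (mass_curve z - \<mu>)) (at z)" "z * (mass_curve z - \<mu>) < 0"
      using DERIV_envelope by (auto intro: mult_pos_neg)
    then show "\<exists>d. (envelope \<mu> has_real_derivative d) (at z) \<and> d < 0" by blast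
  next
    show "continuous_on {u..v} (envelope \<mu>)" by (rule continuous_on_subset[OF continuous_envelope]) (use that x in auto)
  qed
  show ?thesis
  proof (cases "\<alpha> \<in> {x<..<y}")
    case True
    then show ?thesis using s[of x \<alpha>] s[of \<alpha> y] by auto
  qed (use s[of x y] x in auto)
qed

lemma envelope_strict_mono:
  assumes x: "0 < x" "x < y" and m: "\<And>z. x < z \<Longrightarrow> z < y \<Longrightarrow> z \<noteq> \<alpha> \<Longrightarrow> \<mu> < mass_curve z"
  shows "envelope \<mu> x < envelope \<mu> y"
proof -
  have s: "envelope \<mu> u < envelope \<mu> v" if "x \<le> u" "u < v" "v \<le> y" "\<alpha> \<notin> {u<..<v}" for u v
  proof (rule DERIV_pos_imp_increasing_open[OF that(2)])
    fix z assume z: "u < z" "z < v"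
    then have "z \<noteq> \<alpha>" "0 < z" "\<mu> < mass_curve z" using that x m[of z] by auto
    then have "(envelope \<mu> has_real_derivative z * (mass_curve z - \<mu>)) (at z)" "0 < z * (mass_curve z - \<mu>)"
      using DERIV_envelope by auto
    then show "\<exists>d. (envelope \<mu> has_real_derivative d) (at z) \<and> 0 < d" by blast
  next
    show "continuous_on {u..v} (envelope \<mu>)" by (rule continuous_on_subset[OF continuous_envelope]) (use that x in auto)
  qed
  show ?thesis
  proof (cases "\<alpha> \<in> {x<..<y}")
    case True
    then show ?thesis using s[of x \<alpha>] s[of \<alpha> y] by auto
  qed (use s[of x y] x in auto)
qed

text \<open>The envelope is affine in the mass, with slope given by the frequency. This allows
  minima at different masses to be compared by testing one with the minimiser of the other.\<close>

lemma envelope_shift: "envelope \<nu> \<sigma> = envelope \<mu> \<sigma> - (\<nu> - \<mu>) * (\<sigma>\<^sup>2 / 2)"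
  by (simp add: envelope_def field_simps)

text \<open>\<open>\<mu>s\<close> is the mass at the turning point, and \<open>\<mu>t\<close> the
  mass at which the two local minima of the envelope have equal height. At \<open>\<mu>t\<close>
  both minimise, which is why uniqueness of the minimiser is stated only beyond \<alpha>.\<close>

lemma mass_thresholds:
  obtains \<mu>s \<mu>t where "0 < \<mu>s" "\<mu>s < \<mu>t" "\<mu>t < soliton_mass p (\<alpha>\<^sup>2)"
    "\<And>\<mu>. (\<exists>\<sigma>>\<alpha>. mass_curve \<sigma> = \<mu>) \<longleftrightarrow> \<mu>s \<le> \<mu>"
    "\<And>\<mu>. (\<exists>\<sigma>>\<alpha>. \<exists>\<tau>>\<alpha>. \<sigma> \<noteq> \<tau> \<and> mass_curve \<sigma> = \<mu> \<and> mass_curve \<tau> = \<mu>) \<longleftrightarrow> \<mu>s < \<mu> \<and> \<mu> < soliton_mass p (\<alpha>\<^sup>2)"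
    "\<And>\<mu>. \<mu>t \<le> \<mu> \<Longrightarrow> \<exists>\<sigma>2>\<alpha>. mass_curve \<sigma>2 = \<mu> \<and> (\<forall>\<sigma>>0. envelope \<mu> \<sigma>2 \<le> envelope \<mu> \<sigma>) \<and>
       (\<forall>\<sigma>>\<alpha>. envelope \<mu> \<sigma> = envelope \<mu> \<sigma>2 \<longrightarrow> \<sigma> = \<sigma>2)"
    "\<And>\<mu>. 0 < \<mu> \<Longrightarrow> \<mu> < \<mu>t \<Longrightarrow> \<exists>\<sigma>0>0. \<sigma>0 \<le> \<alpha> \<and> mass_curve \<sigma>0 = \<mu> \<and> (\<forall>\<sigma>>0. envelope \<mu> \<sigma>0 \<le> envelope \<mu> \<sigma>) \<and>
       (\<forall>\<sigma>>\<alpha>. envelope \<mu> \<sigma>0 < envelope \<mu> \<sigma>)"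
proof -
  obtain ss where ss: "\<alpha> < ss"
    and dec0: "\<And>\<sigma> \<tau>. \<alpha> < \<sigma> \<Longrightarrow> \<sigma> < \<tau> \<Longrightarrow> \<tau> \<le> ss \<Longrightarrow> mass_curve \<tau> < mass_curve \<sigma>"
    and inc: "\<And>\<sigma> \<tau>. ss \<le> \<sigma> \<Longrightarrow> \<sigma> < \<tau> \<Longrightarrow> mass_curve \<sigma> < mass_curve \<tau>"
    using mass_curve_turning by metis
  define M where "M = mass_curve"
  define \<mu>s where "\<mu>s = M ss"
  define \<mu>1 where "\<mu>1 = M \<alpha>"
  have \<mu>1: "soliton_mass p (\<alpha>\<^sup>2) = \<mu>1" by (simp add: \<mu>1_def M_def mass_curve_alpha)
  have Mc: "continuous_on {0<..} M" using continuous_mass_curve by (simp add: M_def)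
  have dec: "M \<tau> < M \<sigma>" if "\<alpha> \<le> \<sigma>" "\<sigma> < \<tau>" "\<tau> \<le> ss" for \<sigma> \<tau>
  proof (cases "\<sigma> = \<alpha>")
    case True
    \<comment> \<open>The limit at \<alpha> yields only a weak inequality; the intermediate point w
      restores strictness.\<close>
    define w where "w = (\<alpha> + \<tau>) / 2"
    have w: "\<alpha> < w" "w < \<tau>" using that True by (auto simp: w_def)
    have "isCont M \<alpha>" using Mc alpha by (simp add: continuous_on_eq_continuous_at)
    then have "(M \<longlongrightarrow> M \<alpha>) (at_right \<alpha>)" by (auto simp: isCont_def filterlim_at_split)
    moreover have "\<forall>\<^sub>F \<sigma> in at_right \<alpha>. M w \<le> M \<sigma>"
      using eventually_at_right_real[OF w(1)] by eventually_elim (use dec0[of _ w] w that in \<open>auto simp: M_def less_imp_le\<close>)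
    ultimately have "M w \<le> M \<alpha>" by (rule tendsto_lowerbound) simp
    then show ?thesis using dec0[of w \<tau>] w that True by (simp add: M_def)
  qed (use dec0 that in \<open>auto simp: M_def\<close>)
  have inc: "M \<sigma> < M \<tau>" if "ss \<le> \<sigma>" "\<sigma> < \<tau>" for \<sigma> \<tau> using inc that by (simp add: M_def)
  have incl: "M \<sigma> < M \<tau>" if "0 < \<sigma>" "\<sigma> < \<tau>" "\<tau> \<le> \<alpha>" for \<sigma> \<tau>
    using mass_curve_strict_mono_left that by (simp add: M_def)
  have s1: "\<mu>s < \<mu>1" using dec[of \<alpha> ss] ss by (simp add: \<mu>s_def \<mu>1_def)
  have s0: "0 < \<mu>s" using mass_curve_pos[of ss] ss alpha by (simp add: \<mu>s_def M_def)
  have ge: "\<mu>s \<le> M \<sigma>" if "\<alpha> < \<sigma>" for \<sigma>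
    using dec[of \<sigma> ss] inc[of ss \<sigma>] that by (cases \<sigma> ss rule: linorder_cases) (auto simp: \<mu>s_def)
  have ex2: "\<exists>\<sigma>\<ge>ss. M \<sigma> = \<mu>" if "\<mu>s \<le> \<mu>" for \<mu>
  proof -
    obtain \<tau> where t: "ss < \<tau>" "\<mu> < M \<tau>" using mass_curve_unbounded[of ss \<mu>] by (auto simp: M_def)
    have "\<exists>x. ss \<le> x \<and> x \<le> \<tau> \<and> M x = \<mu>"
      by (rule IVT') (use that t ss alpha in \<open>auto simp: \<mu>s_def intro!: continuous_on_subset[OF Mc]\<close>)
    then show ?thesis by blast
  qed
  \<comment> \<open>\<open>s2\<close> picks the solution of M \<sigma> = \<mu> on the rising branch
    beyond ss, and \<open>s0'\<close> below the one on the rising branch up to \<alpha>. Since the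
    envelope has derivative \<sigma> (M \<sigma> - \<mu>), both are local minimum points, while a
    solution on the falling branch in between is a local maximum.\<close>
  define s2 where "s2 \<mu> = (SOME \<sigma>. ss \<le> \<sigma> \<and> M \<sigma> = \<mu>)" for \<mu>
  have s2: "ss \<le> s2 \<mu>" "M (s2 \<mu>) = \<mu>" if "\<mu>s \<le> \<mu>" for \<mu>
    using someI_ex[OF ex2[OF that]] by (auto simp: s2_def)
  define s0' where "s0' \<mu> = (SOME \<sigma>. 0 < \<sigma> \<and> \<sigma> \<le> \<alpha> \<and> M \<sigma> = \<mu>)" for \<mu>
  have s0': "0 < s0' \<mu>" "s0' \<mu> \<le> \<alpha>" "M (s0' \<mu>) = \<mu>" if "0 < \<mu>" "\<mu> \<le> \<mu>1" for \<mu>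
    using someI_ex[OF mass_curve_attains_left[of \<mu>]] that by (auto simp: s0'_def M_def \<mu>1_def)
  let ?E = envelope
  have E2: "?E \<mu> (s2 \<mu>) < ?E \<mu> \<sigma>" if m: "\<mu>s \<le> \<mu>" and s: "ss \<le> \<sigma>" "\<sigma> \<noteq> s2 \<mu>" for \<mu> \<sigma>
  proof (cases "\<sigma> < s2 \<mu>")
    case True
    then show ?thesis
      using s2[OF m] s ss alpha inc[of _ "s2 \<mu>"] by (intro envelope_strict_antimono) (auto simp: M_def)
  next
    case False
    then show ?thesis
      using s2[OF m] s ss alpha inc[of "s2 \<mu>"] by (intro envelope_strict_mono) (auto simp: M_def)
  qed
  have E0: "?E \<mu> (s0' \<mu>) < ?E \<mu> \<sigma>" if m: "0 < \<mu>" "\<mu> \<le> \<mu>1" and s: "0 < \<sigma>" "\<sigma> \<le> \<alpha>" "\<sigma> \<noteq> s0' \<mu>" for \<mu> \<sigma>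
  proof (cases "\<sigma> < s0' \<mu>")
    case True
    then show ?thesis
      using s0'[OF m] s incl[of _ "s0' \<mu>"] by (intro envelope_strict_antimono) (auto simp: M_def)
  next
    case False
    then show ?thesis
      using s0'[OF m] s incl[of "s0' \<mu>"] by (intro envelope_strict_mono) (auto simp: M_def)
  qed
  \<comment> \<open>On the falling branch the sign of M - \<mu> at \<sigma> decides: if it is
    nonnegative, the envelope increases from \<alpha> to \<sigma> and is compared with the left
    minimum; otherwise it decreases from \<sigma> to ss and is compared with the right one.\<close>
  have Emid: "min (?E \<mu> (s0' \<mu>)) (?E \<mu> (s2 \<mu>)) < ?E \<mu> \<sigma>"
    if m: "\<mu>s \<le> \<mu>" "\<mu> \<le> \<mu>1" and s: "\<alpha> < \<sigma>" "\<sigma> \<noteq> s2 \<mu>" for \<mu> \<sigma>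
  proof (cases "ss \<le> \<sigma>")
    case True then show ?thesis using E2[of \<mu> \<sigma>] m s by (auto simp: min_def)
  next
    case False
    show ?thesis
    proof (cases "\<mu> \<le> M \<sigma>")
      case True
      have "?E \<mu> \<alpha> < ?E \<mu> \<sigma>"
      proof (rule envelope_strict_mono[OF alpha s(1)])
        fix z assume "\<alpha> < z" "z < \<sigma>"
        then show "\<mu> < mass_curve z" using dec[of z \<sigma>] False True by (simp add: M_def)
      qed
      moreover have "?E \<mu> (s0' \<mu>) \<le> ?E \<mu> \<alpha>"
        using E0[of \<mu> \<alpha>] m s0 alpha by (cases "\<alpha> = s0' \<mu>") auto
      ultimately show ?thesis by (auto simp: min_def)
    next
      case lt: False
      have "?E \<mu> ss < ?E \<mu> \<sigma>"
        using s False dec[of \<sigma>] lt alpha by (intro envelope_strict_antimono) (force simp: M_def)+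
      moreover have "?E \<mu> (s2 \<mu>) \<le> ?E \<mu> ss" using E2[of \<mu> ss] m by (cases "ss = s2 \<mu>") auto
      ultimately show ?thesis by (auto simp: min_def)
    qed
  qed
  \<comment> \<open>The sign of this difference tells which of the two local minima is the global
    one.\<close>
  define D where "D \<mu> = ?E \<mu> (s2 \<mu>) - ?E \<mu> (s0' \<mu>)" for \<mu>
  have comp2: "?E \<nu> (s2 \<nu>) \<le> ?E \<mu> (s2 \<mu>) - (\<nu> - \<mu>) * ((s2 \<mu>)\<^sup>2 / 2)" if "\<mu>s \<le> \<mu>" "\<mu>s \<le> \<nu>" for \<mu> \<nu>
    using E2[of \<nu> "s2 \<mu>"] s2[of \<mu>] that by (cases "s2 \<mu> = s2 \<nu>") (auto simp: envelope_shift[of \<nu> _ \<mu>])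
  have comp0: "?E \<nu> (s0' \<nu>) \<le> ?E \<mu> (s0' \<mu>) - (\<nu> - \<mu>) * ((s0' \<mu>)\<^sup>2 / 2)" if "0 < \<mu>" "\<mu> \<le> \<mu>1" "0 < \<nu>" "\<nu> \<le> \<mu>1" for \<mu> \<nu>
    using E0[of \<nu> "s0' \<mu>"] s0'[of \<mu>] that by (cases "s0' \<mu> = s0' \<nu>") (auto simp: envelope_shift[of \<nu> _ \<mu>])
  \<comment> \<open>Each minimum is bounded by testing with the minimiser of the other mass. The
    right frequency exceeds \<alpha> and the left one does not, so the right minimum falls faster as
    the mass grows.\<close>
  have Ddec: "D \<nu> < D \<mu>" if "\<mu>s \<le> \<mu>" "\<mu> < \<nu>" "\<nu> \<le> \<mu>1" for \<mu> \<nu>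
  proof -
    have "s0' \<nu> < s2 \<mu>" using s0'[of \<nu>] s2[of \<mu>] that s0 ss by auto
    then have "(s0' \<nu>)\<^sup>2 < (s2 \<mu>)\<^sup>2" using s0'(1)[of \<nu>] that s0 by (intro power_strict_mono) auto
    then have "(\<nu> - \<mu>) * ((s0' \<nu>)\<^sup>2 / 2) < (\<nu> - \<mu>) * ((s2 \<mu>)\<^sup>2 / 2)" using that by simp
    moreover have "?E \<mu> (s0' \<mu>) \<le> ?E \<nu> (s0' \<nu>) + (\<nu> - \<mu>) * ((s0' \<nu>)\<^sup>2 / 2)"
      using comp0[of \<nu> \<mu>] that s0 by (simp add: algebra_simps diff_divide_distrib)
    ultimately show ?thesis using comp2[of \<mu> \<nu>] that unfolding D_def by linarith
  qed
  have s2mono: "s2 \<mu> \<le> s2 \<nu>" if "\<mu>s \<le> \<mu>" "\<mu> \<le> \<nu>" for \<mu> \<nu>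
    using inc[of "s2 \<nu>" "s2 \<mu>"] s2[of \<mu>] s2[of \<nu>] that by force
  \<comment> \<open>On the whole range of masses both minimisers are at most
    \<open>s2 \<mu>1\<close>, which bounds the slopes of both minimal values and makes D
    Lipschitz.\<close>
  define K where "K = (s2 \<mu>1)\<^sup>2 / 2"
  have Kb: "(s2 \<mu>)\<^sup>2 / 2 \<le> K" "(s0' \<mu>)\<^sup>2 / 2 \<le> K" if "\<mu>s \<le> \<mu>" "\<mu> \<le> \<mu>1" for \<mu>
  proof -
    show "(s2 \<mu>)\<^sup>2 / 2 \<le> K" using s2mono[of \<mu> \<mu>1] s2[of \<mu>] that ss alpha by (auto simp: K_def intro!: power_mono)
    have "s0' \<mu> \<le> s2 \<mu>1" using s0'[of \<mu>] s2[of \<mu>1] that s0 s1 ss by auto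
    then show "(s0' \<mu>)\<^sup>2 / 2 \<le> K" using s0'(1)[of \<mu>] that s0 by (auto simp: K_def intro!: power_mono)
  qed
  have Dlip: "D \<mu> - D \<nu> \<le> 2 * K * \<bar>\<mu> - \<nu>\<bar>" if "\<mu>s \<le> \<mu>" "\<mu> \<le> \<mu>1" "\<mu>s \<le> \<nu>" "\<nu> \<le> \<mu>1" for \<mu> \<nu>
  proof -
    have "D \<mu> - D \<nu> \<le> - (\<mu> - \<nu>) * ((s2 \<nu>)\<^sup>2 / 2) + - (\<nu> - \<mu>) * ((s0' \<mu>)\<^sup>2 / 2)"
    proof -
      have "?E \<mu> (s2 \<mu>) \<le> ?E \<nu> (s2 \<nu>) - (\<mu> - \<nu>) * ((s2 \<nu>)\<^sup>2 / 2)"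
        "?E \<nu> (s0' \<nu>) \<le> ?E \<mu> (s0' \<mu>) - (\<nu> - \<mu>) * ((s0' \<mu>)\<^sup>2 / 2)"
        using comp2[of \<nu> \<mu>] comp0[of \<mu> \<nu>] that s0 by auto
      then show ?thesis unfolding D_def mult_minus_left by linarith
    qed
    moreover have "- (\<mu> - \<nu>) * ((s2 \<nu>)\<^sup>2 / 2) \<le> \<bar>\<mu> - \<nu>\<bar> * K" using Kb(1)[of \<nu>] that by (intro mult_mono) auto
    moreover have "- (\<nu> - \<mu>) * ((s0' \<mu>)\<^sup>2 / 2) \<le> \<bar>\<mu> - \<nu>\<bar> * K" using Kb(2)[of \<mu>] that by (intro mult_mono) auto
    moreover have "2 * K * \<bar>\<mu> - \<nu>\<bar> = \<bar>\<mu> - \<nu>\<bar> * K + \<bar>\<mu> - \<nu>\<bar> * K" by simp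
    ultimately show ?thesis by linarith
  qed
  have "continuous_on {\<mu>s..\<mu>1} D"
  proof (rule lipschitz_on_continuous_on)
    show "(2 * K)-lipschitz_on {\<mu>s..\<mu>1} D"
    proof (rule lipschitz_onI)
      fix \<mu> \<nu> assume "\<mu> \<in> {\<mu>s..\<mu>1}" "\<nu> \<in> {\<mu>s..\<mu>1}"
      then show "dist (D \<mu>) (D \<nu>) \<le> 2 * K * dist \<mu> \<nu>"
        using Dlip[of \<mu> \<nu>] Dlip[of \<nu> \<mu>] by (auto simp: dist_real_def abs_minus_commute)
    qed (simp add: K_def)
  qed
  \<comment> \<open>At \<open>\<mu>s\<close> the right minimiser is the turning point ss itself.
    Between the two solutions the mass curve stays above \<open>\<mu>s\<close>, so the envelope only
    increases.\<close>
  moreover have Ds: "0 < D \<mu>s"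
  proof -
    have e: "s2 \<mu>s = ss" using inc[of ss "s2 \<mu>s"] s2[of \<mu>s] by (force simp: \<mu>s_def)
    have "?E \<mu>s (s0' \<mu>s) < ?E \<mu>s ss"
    proof (rule envelope_strict_mono)
      fix z assume z: "s0' \<mu>s < z" "z < ss" "z \<noteq> \<alpha>"
      show "\<mu>s < mass_curve z"
        using z incl[of "s0' \<mu>s" z] dec[of z ss] s0'[of \<mu>s] s0 s1 ss by (cases "z < \<alpha>") (auto simp: M_def \<mu>s_def)
    qed (use s0'[of \<mu>s] s0 s1 ss in auto)
    then show ?thesis by (simp add: D_def e)
  qed
  \<comment> \<open>At the full soliton mass the left minimiser is \<alpha>. From there to
    \<open>s2 \<mu>1\<close> the mass curve stays below \<open>\<mu>1\<close>, so the envelope only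
    decreases.\<close>
  moreover have D1: "D \<mu>1 < 0"
  proof -
    have e: "s0' \<mu>1 = \<alpha>" using incl[of "s0' \<mu>1" \<alpha>] s0'[of \<mu>1] s0 s1 by (force simp: \<mu>1_def)
    have "?E \<mu>1 (s2 \<mu>1) < ?E \<mu>1 \<alpha>"
    proof (rule envelope_strict_antimono)
      fix z assume z: "\<alpha> < z" "z < s2 \<mu>1" "z \<noteq> \<alpha>"
      show "mass_curve z < \<mu>1"
        using z dec[of \<alpha> z] inc[of z "s2 \<mu>1"] s2[of \<mu>1] s1 by (cases "z \<le> ss") (auto simp: M_def \<mu>1_def)
    qed (use s2[of \<mu>1] s1 ss alpha in auto)
    then show ?thesis by (simp add: D_def e)
  qed
  ultimately obtain \<mu>t where t: "\<mu>s \<le> \<mu>t" "\<mu>t \<le> \<mu>1" "D \<mu>t = 0"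
    using IVT2'[of D \<mu>1 0 \<mu>s] s1 by auto
  have t': "\<mu>s < \<mu>t" "\<mu>t < \<mu>1" using t Ds D1 by (auto simp: order_le_less)
  show ?thesis
  proof (rule that[of \<mu>s \<mu>t, unfolded \<mu>1, OF s0 t'])
    show "(\<exists>\<sigma>>\<alpha>. mass_curve \<sigma> = \<mu>) \<longleftrightarrow> \<mu>s \<le> \<mu>" for \<mu>
      using ge ex2[of \<mu>] ss by (auto simp: M_def intro: less_le_trans)
    show "(\<exists>\<sigma>>\<alpha>. \<exists>\<tau>>\<alpha>. \<sigma> \<noteq> \<tau> \<and> mass_curve \<sigma> = \<mu> \<and> mass_curve \<tau> = \<mu>) \<longleftrightarrow> \<mu>s < \<mu> \<and> \<mu> < \<mu>1" for \<mu>
    proof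
      assume "\<exists>\<sigma>>\<alpha>. \<exists>\<tau>>\<alpha>. \<sigma> \<noteq> \<tau> \<and> mass_curve \<sigma> = \<mu> \<and> mass_curve \<tau> = \<mu>"
      then obtain \<sigma> \<tau> where st: "\<alpha> < \<sigma>" "\<sigma> < \<tau>" "M \<sigma> = \<mu>" "M \<tau> = \<mu>"
        unfolding M_def by (metis linorder_neqE_linordered_idom)
      then have "\<sigma> < ss" using inc[of \<sigma> \<tau>] by force
      then show "\<mu>s < \<mu> \<and> \<mu> < \<mu>1" using dec[of \<sigma> ss] dec[of \<alpha> \<sigma>] st by (auto simp: \<mu>s_def \<mu>1_def)
    next
      assume m: "\<mu>s < \<mu> \<and> \<mu> < \<mu>1"
      have "\<exists>x. \<alpha> \<le> x \<and> x \<le> ss \<and> M x = \<mu>"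
        by (rule IVT2') (use m ss alpha in \<open>auto simp: \<mu>s_def \<mu>1_def intro!: continuous_on_subset[OF Mc]\<close>)
      then obtain x where x: "\<alpha> \<le> x" "x \<le> ss" "M x = \<mu>" by blast
      have "x \<noteq> \<alpha>" "x \<noteq> ss" using x m by (auto simp: \<mu>s_def \<mu>1_def)
      then show "\<exists>\<sigma>>\<alpha>. \<exists>\<tau>>\<alpha>. \<sigma> \<noteq> \<tau> \<and> mass_curve \<sigma> = \<mu> \<and> mass_curve \<tau> = \<mu>"
        using x s2[of \<mu>] m ss by (intro exI[of _ x] conjI exI[of _ "s2 \<mu>"]) (auto simp: M_def)
    qed
    fix \<mu>
    {
      assume m: "\<mu>t \<le> \<mu>"
      then have ms: "\<mu>s \<le> \<mu>" using t by simp
      have "?E \<mu> (s2 \<mu>) \<le> ?E \<mu> \<sigma> \<and> (\<alpha> < \<sigma> \<longrightarrow> \<sigma> \<noteq> s2 \<mu> \<longrightarrow> ?E \<mu> (s2 \<mu>) < ?E \<mu> \<sigma>)" if s: "0 < \<sigma>" for \<sigma>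
      proof (cases "\<mu> \<le> \<mu>1")
        case True
        have "D \<mu> \<le> 0" using Ddec[of \<mu>t \<mu>] m t True by (cases "\<mu> = \<mu>t") auto
        then have le: "?E \<mu> (s2 \<mu>) \<le> ?E \<mu> (s0' \<mu>)" by (simp add: D_def)
        show ?thesis
        proof (cases "\<sigma> \<le> \<alpha>")
          case a: True
          have "?E \<mu> (s0' \<mu>) \<le> ?E \<mu> \<sigma>" using E0[of \<mu> \<sigma>] ms s0 True s a by (cases "\<sigma> = s0' \<mu>") auto
          then show ?thesis using le a by auto
        next
          case False
          then show ?thesis using Emid[of \<mu> \<sigma>, unfolded min.absorb2[OF le]] ms True by (cases "\<sigma> = s2 \<mu>") auto
        qed
      next
        case False
        \<comment> \<open>For masses above \<open>\<mu>1\<close> the mass curve stays below \<mu>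
          all the way to \<open>s2 \<mu>\<close>, and the left minimum has disappeared.\<close>
        have "?E \<mu> (s2 \<mu>) < ?E \<mu> \<sigma>" if "\<sigma> \<noteq> s2 \<mu>"
        proof (cases "ss \<le> \<sigma>")
          case True then show ?thesis using E2 ms that by blast
        next
          case nss: False
          show ?thesis
          proof (rule envelope_strict_antimono[OF s])
            fix z assume z: "\<sigma> < z" "z < s2 \<mu>" "z \<noteq> \<alpha>"
            have "M z < \<mu>1 \<or> M z < \<mu>"
              using z s incl[of z \<alpha>] dec[of \<alpha> z] inc[of z "s2 \<mu>"] s2[OF ms]
              by (cases "z < \<alpha>"; cases "z \<le> ss") (auto simp: \<mu>1_def)
            then show "mass_curve z < \<mu>" using False by (auto simp: M_def)
          qed (use nss s2[OF ms] in auto)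
        qed
        then show ?thesis by (cases "\<sigma> = s2 \<mu>") auto
      qed
      note key = this
      have a2: "\<alpha> < s2 \<mu>" using s2[OF ms] ss by simp
      have "\<sigma> = s2 \<mu>" if "\<alpha> < \<sigma>" "?E \<mu> \<sigma> = ?E \<mu> (s2 \<mu>)" for \<sigma>
        using key[of \<sigma>] that alpha by fastforce
      then show "\<exists>\<sigma>2>\<alpha>. mass_curve \<sigma>2 = \<mu> \<and> (\<forall>\<sigma>>0. ?E \<mu> \<sigma>2 \<le> ?E \<mu> \<sigma>) \<and> (\<forall>\<sigma>>\<alpha>. ?E \<mu> \<sigma> = ?E \<mu> \<sigma>2 \<longrightarrow> \<sigma> = \<sigma>2)"
        using a2 key s2(2)[OF ms] by (intro exI[of _ "s2 \<mu>"]) (auto simp: M_def)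
    }
    {
      assume m: "0 < \<mu>" "\<mu> < \<mu>t"
      then have m1: "\<mu> \<le> \<mu>1" using t by simp
      have hi: "?E \<mu> (s0' \<mu>) < ?E \<mu> \<sigma>" if s: "\<alpha> < \<sigma>" for \<sigma>
      proof (cases "\<mu>s \<le> \<mu>")
        case True
        then have "?E \<mu> (s0' \<mu>) < ?E \<mu> (s2 \<mu>)" using Ddec[of \<mu> \<mu>t] m t by (simp add: D_def)
        then show ?thesis using Emid[of \<mu> \<sigma>] True m1 s by (cases "\<sigma> = s2 \<mu>") (auto simp: min_def)
      next
        \<comment> \<open>Below \<open>\<mu>s\<close> there is no right minimum: beyond
          \<open>s0' \<mu>\<close> the mass curve exceeds \<mu> and the envelope only
          increases.\<close>
        case False
        show ?thesis
        proof (rule envelope_strict_mono)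
          fix z assume z: "s0' \<mu> < z" "z < \<sigma>" "z \<noteq> \<alpha>"
          show "\<mu> < mass_curve z"
            using z incl[of "s0' \<mu>" z] ge[of z] False s0'[OF m(1) m1] by (cases "z < \<alpha>") (auto simp: M_def)
        qed (use s0'[OF m(1) m1] s in auto)
      qed
      have "?E \<mu> (s0' \<mu>) \<le> ?E \<mu> \<sigma>" if "0 < \<sigma>" for \<sigma>
        using hi[of \<sigma>] E0[of \<mu> \<sigma>] m m1 that by (cases "\<sigma> \<le> \<alpha>"; cases "\<sigma> = s0' \<mu>") auto
      then show "\<exists>\<sigma>0>0. \<sigma>0 \<le> \<alpha> \<and> mass_curve \<sigma>0 = \<mu> \<and> (\<forall>\<sigma>>0. ?E \<mu> \<sigma>0 \<le> ?E \<mu> \<sigma>) \<and> (\<forall>\<sigma>>\<alpha>. ?E \<mu> \<sigma>0 < ?E \<mu> \<sigma>)"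
        using hi s0'[OF m(1) m1] by (intro exI[of _ "s0' \<mu>"]) (auto simp: M_def)
    }
  qed
qed

end

section \<open>The lower bound for the energy\<close>

text \<open>By the reverse triangle inequality |V| also controls the increments of |u|. The geodesic
  estimate can therefore be run on |u|, whatever the sign of u.\<close>

lemma chain_inequality_abs:
  assumes r: "sobolev_rep u V" and xy: "0 \<le> x" "x \<le> y"
    and S: "open S" "\<And>z. x \<le> z \<Longrightarrow> z \<le> y \<Longrightarrow> \<bar>u z\<bar> \<in> S"
    and P: "\<And>w. w \<in> S \<Longrightarrow> (P has_real_derivative \<psi> w) (at w)" and \<psi>: "continuous_on S \<psi>"
  shows "\<bar>P \<bar>u y\<bar> - P \<bar>u x\<bar>\<bar> \<le> (LINT s:{x..y}|lborel. \<bar>\<psi> \<bar>u s\<bar>\<bar> * \<bar>V s\<bar>)"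
proof (rule chain_inequality[where u="\<lambda>x. \<bar>u x\<bar>" and V="\<lambda>x. \<bar>V x\<bar>", OF xy(2) _ _ _ _ S(1) _ P \<psi>])
  have Vi: "set_integrable lborel {s..t} V" for s t
    using r by (auto simp: sobolev_rep_def intro: set_integrable_Icc_of_square)
  show "continuous_on {x..y} (\<lambda>x. \<bar>u x\<bar>)"
  proof (rule continuous_on_rabs, rule continuous_on_subset)
    show "continuous_on {0..} u" using r by (simp add: sobolev_rep_def)
  qed (use xy in auto)
  show "set_integrable lborel {x..y} (\<lambda>x. \<bar>V x\<bar>)" by (rule set_integrable_abs[OF Vi])
  show "\<bar>\<bar>u t\<bar> - \<bar>u s\<bar>\<bar> \<le> (LINT r:{s..t}|lborel. \<bar>V r\<bar>)" if "x \<le> s" "s \<le> t" "t \<le> y" for s t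
  proof -
    have "u t - u s = (LINT r:{s..t}|lborel. V r)"
    proof -
      have "\<And>x y. 0 \<le> x \<Longrightarrow> x \<le> y \<Longrightarrow> u y - u x = (LINT r:{x..y}|lborel. V r)"
        using r by (simp add: sobolev_rep_def)
      moreover have "0 \<le> s" using that xy by linarith
      ultimately show ?thesis using that(2) by blast
    qed
    then show ?thesis using set_integral_norm_bound[OF Vi, of s t] by simp
  qed
qed (use S in auto)

lemma attains_max_half_line:
  fixes U :: "real \<Rightarrow> real"
  assumes U: "continuous_on {0..} U" "(U \<longlongrightarrow> 0) at_top" and z: "0 \<le> z" "0 < U z"
  shows "\<exists>x0\<ge>0. \<forall>x\<ge>0. U x \<le> U x0"
proof -
  have "\<forall>\<^sub>F x in at_top. U x < U z" using order_tendstoD(2)[OF U(2) z(2)] .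
  then obtain R where R: "\<And>x. R \<le> x \<Longrightarrow> U x < U z" by (auto simp: eventually_at_top_linorder)
  have "\<exists>x0\<in>{0..max R z}. \<forall>x\<in>{0..max R z}. U x \<le> U x0"
    by (rule continuous_attains_sup) (use z in \<open>auto intro: continuous_on_subset[OF U(1)]\<close>)
  then obtain x0 where x0: "x0 \<in> {0..max R z}" "\<And>x. x \<in> {0..max R z} \<Longrightarrow> U x \<le> U x0" by blast
  have "U x \<le> U x0" if "0 \<le> x" for x
  proof (cases "x \<le> max R z")
    case False
    have "U x < U z" using R[of x] False by simp
    also have "U z \<le> U x0" using x0(2)[of z] z by auto
    finally show ?thesis by simp
  qed (use x0 that in auto)
  then show ?thesis using x0 by auto
qed

text \<open>This function inverts s \<mapsto> M cosh(s)^(-b): it is the scaled distance from the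
  peak at which a soliton of maximum M has the level w.\<close>

lemma DERIV_arcosh_ratio:
  assumes b: "0 < b" and w: "0 < w" "w < M"
  shows "((\<lambda>w. arcosh ((M / w) powr (1 / b))) has_real_derivative
     - 1 / (b * w * sqrt (1 - (w / M) powr (2 / b)))) (at w)"
proof -
  define q where "q = (M / w) powr (1 / b)"
  have M: "M > 0" using w by simp
  have q1: "1 < q"
  proof -
    have "1 powr (1 / b) < q" unfolding q_def using w b by (intro powr_less_mono2) auto
    then show ?thesis by simp
  qed
  have m: "((\<lambda>w. M / w) has_real_derivative - (M / w\<^sup>2)) (at w)"
    using w by (auto intro!: derivative_eq_intros simp: power2_eq_square)
  have "0 < M / w" using w by simp
  note d = DERIV_chain2[OF has_real_derivative_powr[OF this] m, of "1 / b"]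
  have "(M / w) powr (1 / b - 1) = q / (M / w)" using w M by (simp add: q_def powr_diff)
  then have dq: "((\<lambda>w. (M / w) powr (1 / b)) has_real_derivative - (q / (b * w))) (at w)"
    using w M b by (intro DERIV_cong[OF d]) (simp add: power2_eq_square)
  from DERIV_chain2[OF arcosh_real_has_field_derivative[OF q1[unfolded q_def]] dq]
  have "((\<lambda>w. arcosh ((M / w) powr (1 / b))) has_real_derivative 1 / sqrt (q\<^sup>2 - 1) * - (q / (b * w))) (at w)"
    by (simp add: q_def)
  also have "1 / sqrt (q\<^sup>2 - 1) * - (q / (b * w)) = - 1 / (b * w * sqrt (1 - (w / M) powr (2 / b)))"
  proof -
    have "q\<^sup>2 = (M / w) powr (2 / b)" using w M by (simp add: q_def power2_eq_square flip: powr_add)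
    then have wq: "(w / M) powr (2 / b) = 1 / q\<^sup>2"
      using w M by (simp add: powr_divide)
    have "q\<^sup>2 - 1 = q\<^sup>2 * (1 - 1 / q\<^sup>2)" using q1 by (simp add: right_diff_distrib)
    then have "sqrt (q\<^sup>2 - 1) = q * sqrt (1 - 1 / q\<^sup>2)" using q1 by (simp add: real_sqrt_mult)
    then have "1 / sqrt (q\<^sup>2 - 1) * - (q / (b * w)) = (q * - 1) / (q * (b * w * sqrt (1 - 1 / q\<^sup>2)))"
      by simp
    also have "\<dots> = - 1 / (b * w * sqrt (1 - 1 / q\<^sup>2))" using q1 by (subst mult_divide_mult_cancel_left) auto
    finally show ?thesis by (simp add: wq)
  qed
  finally show ?thesis .
qed

lemma continuous_zero_if_integral_zero:
  fixes f :: "real \<Rightarrow> real"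
  assumes f: "continuous_on {0<..} f" "\<And>x. 0 < x \<Longrightarrow> 0 \<le> f x" "set_integrable lborel {0<..} f"
    and z: "(LINT x:{0<..}|lborel. f x) = 0" and x: "0 < x"
  shows "f x = 0"
proof -
  have i: "set_integrable lborel {x..x+1} f" by (rule set_integrable_subset[OF f(3)]) (use x in auto)
  have "(LINT x:{x..x+1}|lborel. f x) \<le> (LINT x:{0<..}|lborel. f x)"
    unfolding set_lebesgue_integral_def
  proof (rule integral_mono)
    show "integrable lborel (\<lambda>y. indicat_real {x..x+1} y *\<^sub>R f y)" "integrable lborel (\<lambda>y. indicat_real {0<..} y *\<^sub>R f y)"
      using i f(3) by (simp_all only: set_integrable_def)
    show "indicat_real {x..x+1} y *\<^sub>R f y \<le> indicat_real {0<..} y *\<^sub>R f y" for y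
      using f(2)[of y] x by (auto simp: indicator_def)
  qed
  moreover have "0 \<le> (LINT x:{x..x+1}|lborel. f x)"
    unfolding set_lebesgue_integral_def by (rule Bochner_Integration.integral_nonneg) (use f(2) x in \<open>auto simp: indicator_def\<close>)
  ultimately have "integral {x..x+1} f = 0" using z set_borel_integral_eq_integral(2)[OF i] by simp
  then have "\<forall>y\<in>{x..x+1}. f y = 0"
    by (subst (asm) integral_eq_0_iff) (use x f in \<open>auto intro: continuous_on_subset\<close>)
  then show ?thesis by simp
qed

context supercritical_nls
begin

text \<open>The lower bound for the energy in terms of the maximum \<open>amp \<sigma>\<close> and the boundary value
  \<open>r * amp \<sigma>\<close>, minimised over the latter.\<close>

definition boundary_cost :: "real \<Rightarrow> real \<Rightarrow> real" where
  "boundary_cost \<sigma> r = (amp \<sigma>)\<^sup>2 * (\<sigma> * (2 * Psi b 1 - Psi b r) + \<alpha> * r\<^sup>2 / 2)"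

text \<open>The minimiser of \<open>boundary_cost \<sigma>\<close>. Stationarity at r > 0 reads sqrt
  (1 - r^(2 / b)) = \<alpha> / \<sigma>, the boundary condition of the bound state; for \<sigma>
  \<le> \<alpha> it has no positive solution and the minimum sits at 0.\<close>

definition boundary_ratio :: "real \<Rightarrow> real" where
  "boundary_ratio \<sigma> = (if \<sigma> \<le> \<alpha> then 0 else cosh (centre \<sigma>) powr (- b))"

lemma boundary_cost_ratio:
  assumes s: "0 < \<sigma>"
  shows "boundary_cost \<sigma> (boundary_ratio \<sigma>) = envelope0 \<sigma>"
proof (cases "\<sigma> \<le> \<alpha>")
  case True
  then show ?thesis using s by (simp add: boundary_cost_def boundary_ratio_def envelope0_def amp_sq powr_add)
next
  case False
  then have "0 \<le> centre \<sigma>" using centre_pos[of \<sigma>] by simp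
  from sech_kin_eq_Psi[OF b_bounds(3) this]
  have "2 * Psi b 1 - Psi b (cosh (centre \<sigma>) powr (- b)) = Psi b 1 + sech_kin b (centre \<sigma>)" by simp
  moreover have "(cosh (centre \<sigma>) powr (- b))\<^sup>2 = cosh (centre \<sigma>) powr (- 2 * b)"
    by (simp add: powr_power mult.commute)
  ultimately show ?thesis using False s
    by (simp add: boundary_cost_def boundary_ratio_def envelope0_def amp_sq powr_add profile_energy_def algebra_simps)
qed

lemma boundary_ratio_bounds: "0 \<le> boundary_ratio \<sigma>" "boundary_ratio \<sigma> < 1"
proof -
  show "0 \<le> boundary_ratio \<sigma>" by (simp add: boundary_ratio_def)
  have "cosh (centre \<sigma>) powr (- b) < 1" if "\<alpha> < \<sigma>"
  proof -
    have "1 < cosh (centre \<sigma>)" using centre_pos[OF that] cosh_real_strict_mono[of 0 "centre \<sigma>"] by simp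
    then have "1 powr b < cosh (centre \<sigma>) powr b" using b_bounds by (intro powr_less_mono2) auto
    then show ?thesis by (simp add: powr_minus field_simps)
  qed
  then show "boundary_ratio \<sigma> < 1" by (simp add: boundary_ratio_def)
qed

lemma DERIV_boundary_cost:
  assumes "0 \<le> r"
  shows "(boundary_cost \<sigma> has_real_derivative (amp \<sigma>)\<^sup>2 * (r * (\<alpha> - \<sigma> * sqrt (1 - r powr (2 / b))))) (at r)"
proof -
  have q: "((\<lambda>r. \<alpha> * r\<^sup>2 / 2) has_real_derivative \<alpha> * r) (at r)" by (auto intro!: derivative_eq_intros)
  have "(boundary_cost \<sigma> has_real_derivative (amp \<sigma>)\<^sup>2 * (\<sigma> * (0 - psi b r) + \<alpha> * r)) (at r)"
    unfolding boundary_cost_def[abs_def]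
    by (intro DERIV_cmult DERIV_add DERIV_diff DERIV_const DERIV_Psi b_bounds q)
  then show ?thesis by (rule DERIV_cong) (use assms in \<open>simp add: psi_def algebra_simps\<close>)
qed

text \<open>The derivative in r is a positive multiple of r (\<alpha> - \<sigma> sqrt (1 - r^(2 /
  b))). The bracket is strictly increasing, and beyond \<alpha> it vanishes at the ratio, so the
  cost decreases before the ratio and increases after it.\<close>

lemma boundary_cost_min:
  assumes s: "0 < \<sigma>" and r: "0 \<le> r" "r \<le> 1" "r \<noteq> boundary_ratio \<sigma>"
  shows "envelope0 \<sigma> < boundary_cost \<sigma> r"
proof -
  let ?r = "boundary_ratio \<sigma>"
  let ?d = "\<lambda>r. (amp \<sigma>)\<^sup>2 * (r * (\<alpha> - \<sigma> * sqrt (1 - r powr (2 / b))))"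
  have A: "(amp \<sigma>)\<^sup>2 > 0" using amp_pos[OF s] by simp
  have cont: "continuous_on {x..y} (boundary_cost \<sigma>)" if "0 \<le> x" for x y
    by (intro continuous_at_imp_continuous_on ballI DERIV_isCont[OF DERIV_boundary_cost]) (use that in auto)
  have crit: "\<sigma> * sqrt (1 - ?r powr (2 / b)) = \<alpha>" if "\<alpha> < \<sigma>"
  proof -
    have "?r powr (2 / b) = cosh (centre \<sigma>) powr (- 2)" using that b_bounds by (simp add: boundary_ratio_def powr_powr)
    then have "sqrt (1 - ?r powr (2 / b)) = \<bar>tanh (centre \<sigma>)\<bar>" by (simp add: tanh_sq[symmetric])
    then show ?thesis using tanh_centre[OF that] s alpha by simp
  qed
  \<comment> \<open>\<open>sqrt\<close> on the reals is strictly increasing also at negative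
    arguments, which covers values of y above 1.\<close>
  have mono: "sqrt (1 - y powr (2 / b)) < sqrt (1 - x powr (2 / b))" if "0 \<le> x" "x < y" for x y
    using powr_less_mono2[of "2 / b" x y] that b_bounds by simp
  consider "?r < r" | "r < ?r" using r by linarith
  then have "boundary_cost \<sigma> ?r < boundary_cost \<sigma> r"
  proof cases
    case 1
    have pos: "0 < ?d z" if "?r < z" for z
    proof -
      have "\<sigma> * sqrt (1 - z powr (2 / b)) < \<alpha>"
      proof (cases "\<sigma> \<le> \<alpha>")
        case True
        have "sqrt (1 - z powr (2 / b)) < 1" using mono[of 0 z] that True by (simp add: boundary_ratio_def)
        then have "\<sigma> * sqrt (1 - z powr (2 / b)) < \<sigma> * 1" using s by (intro mult_strict_left_mono) auto
        then show ?thesis using True by simp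
      next
        case False
        have "\<sigma> * sqrt (1 - z powr (2 / b)) < \<sigma> * sqrt (1 - ?r powr (2 / b))"
          using mono[of ?r z] that boundary_ratio_bounds[of \<sigma>] s by (intro mult_strict_left_mono) auto
        then show ?thesis using crit False by simp
      qed
      then show ?thesis using A that boundary_ratio_bounds[of \<sigma>] by (intro mult_pos_pos) auto
    qed
    show ?thesis
    proof (rule DERIV_pos_imp_increasing_open[OF 1])
      fix z assume "?r < z" "z < r"
      then show "\<exists>d. (boundary_cost \<sigma> has_real_derivative d) (at z) \<and> 0 < d"
        using DERIV_boundary_cost[of z \<sigma>] pos[of z] boundary_ratio_bounds[of \<sigma>] by (intro exI[of _ "?d z"]) simp
    qed (use cont boundary_ratio_bounds in auto)
  next
    case 2
    then have as: "\<alpha> < \<sigma>" using r by (auto simp: boundary_ratio_def split: if_splits)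
    have neg: "?d z < 0" if "0 < z" "z < ?r" for z
    proof -
      have "\<sigma> * sqrt (1 - ?r powr (2 / b)) < \<sigma> * sqrt (1 - z powr (2 / b))"
        using mono[of z ?r] that s by (intro mult_strict_left_mono) auto
      then show ?thesis using A that crit[OF as] by (intro mult_pos_neg) auto
    qed
    show ?thesis
    proof (rule DERIV_neg_imp_decreasing_open[OF 2])
      fix z assume "r < z" "z < ?r"
      then show "\<exists>d. (boundary_cost \<sigma> has_real_derivative d) (at z) \<and> d < 0"
        using DERIV_boundary_cost[of z \<sigma>] neg[of z] r by (intro exI[of _ "?d z"]) simp
    qed (use cont r in auto)
  qed
  then show ?thesis using boundary_cost_ratio[OF s] by simp
qed

text \<open>The soliton of maximum \<open>amp \<sigma>\<close> crosses the level \<open>w\<close> at this speed, \<open>sqrt (2 W (w))\<close>.\<close>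

definition speed :: "real \<Rightarrow> real \<Rightarrow> real" where
  "speed \<sigma> w = \<sigma> * amp \<sigma> * psi b (w / amp \<sigma>)"

lemma speed_eq:
  assumes s: "0 < \<sigma>" and w: "0 \<le> w"
  shows "speed \<sigma> w = \<sigma> * w * sqrt (1 - (w / amp \<sigma>) powr (2 / b))"
  using amp_pos[OF s] w by (simp add: speed_def psi_def)

lemma speed_sq:
  assumes s: "0 < \<sigma>" and w: "0 \<le> w" "w \<le> amp \<sigma>"
  shows "(speed \<sigma> w)\<^sup>2 = \<sigma>\<^sup>2 * w\<^sup>2 - 2 / p * w powr p"
proof -
  note A = amp_pos[OF s]
  have "(w / amp \<sigma>) powr (2 / b) \<le> 1" using A w b_bounds by (intro powr_le1) auto
  then have "(speed \<sigma> w)\<^sup>2 = \<sigma>\<^sup>2 * w\<^sup>2 - \<sigma>\<^sup>2 * w\<^sup>2 * (w / amp \<sigma>) powr (2 / b)"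
    using w by (simp add: speed_eq[OF s] power_mult_distrib right_diff_distrib)
  also have "\<sigma>\<^sup>2 * w\<^sup>2 * (w / amp \<sigma>) powr (2 / b) = 2 / p * w powr p"
  proof (cases "w = 0")
    case False
    then have wp: "w > 0" using w by simp
    have "w powr p = w\<^sup>2 * w powr (2 / b)" using wp by (simp add: p_eq powr_add)
    moreover have "(w / amp \<sigma>) powr (2 / b) = w powr (2 / b) / (p / 2 * \<sigma>\<^sup>2)"
      by (simp only: powr_divide amp_powr[OF s])
    ultimately show ?thesis using p4 s by (simp add: field_simps)
  qed simp
  finally show ?thesis .
qed

lemma speed_nonneg: "0 < \<sigma> \<Longrightarrow> 0 \<le> w \<Longrightarrow> w \<le> amp \<sigma> \<Longrightarrow> 0 \<le> speed \<sigma> w"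
  unfolding speed_def using amp_pos[of \<sigma>] b_bounds by (intro mult_nonneg_nonneg psi_nonneg) auto

lemma speed_le: "0 < \<sigma> \<Longrightarrow> 0 \<le> w \<Longrightarrow> w \<le> amp \<sigma> \<Longrightarrow> speed \<sigma> w \<le> \<sigma> * w"
  by (subst speed_eq) (simp_all add: mult_left_le)

lemma continuous_on_speed: "0 < \<sigma> \<Longrightarrow> continuous_on A (speed \<sigma>)"
  unfolding speed_def[abs_def] using amp_pos[of \<sigma>]
  by (intro continuous_intros continuous_on_compose2[OF continuous_psi[OF b_bounds(3)]]) auto

lemma DERIV_travel_cost:
  assumes s: "0 < \<sigma>"
  shows "((\<lambda>w. \<sigma> * (amp \<sigma>)\<^sup>2 * Psi b (w / amp \<sigma>)) has_real_derivative speed \<sigma> w) (at w)"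
proof -
  have "((\<lambda>w. w / amp \<sigma>) has_real_derivative 1 / amp \<sigma>) (at w)"
    using amp_pos[OF s] by (auto intro!: derivative_eq_intros)
  from DERIV_cmult[OF DERIV_chain2[OF DERIV_Psi[OF b_bounds(3)] this], of "\<sigma> * (amp \<sigma>)\<^sup>2"]
  show ?thesis using amp_pos[OF s] by (simp add: speed_def power2_eq_square mult_ac)
qed


text \<open>Cut off on the left like V in \<open>sobolev_rep\<close>, so that the square of |V| -
  \<open>half_speed \<sigma> u\<close> can be integrated over the whole line.\<close>

definition half_speed :: "real \<Rightarrow> (real \<Rightarrow> real) \<Rightarrow> real \<Rightarrow> real" where
  "half_speed \<sigma> u x = indicator {0<..} x *\<^sub>R speed \<sigma> \<bar>u x\<bar>"

section \<open>Splitting the energy into nonnegative defects\<close>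

lemma amp_surj: assumes "0 < m" obtains \<sigma> where "0 < \<sigma>" "amp \<sigma> = m"
proof (rule that[of "(m / sqrt c) powr (1 / b)"])
  show "0 < (m / sqrt c) powr (1 / b)" using assms c_pos by simp
  show "amp ((m / sqrt c) powr (1 / b)) = m"
    using assms c_pos b_bounds by (simp add: amp_def powr_powr)
qed

text \<open>Below the peak value the squared speed lies between 0 and \<sigma>^2 u^2. This makes it
  integrable, and |u|^p is then integrable as a combination of two integrable functions.\<close>

lemma half_speed_facts:
  assumes r: "sobolev_rep u V" and s: "0 < \<sigma>" and bd: "\<And>x. 0 \<le> x \<Longrightarrow> \<bar>u x\<bar> \<le> amp \<sigma>"
  shows "half_speed \<sigma> u \<in> borel_measurable lborel" "integrable lborel (\<lambda>x. (half_speed \<sigma> u x)\<^sup>2)"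
    "0 \<le> half_speed \<sigma> u x" "integrable lborel (\<lambda>x. half_speed \<sigma> u x * \<bar>V x\<bar>)"
    "set_integrable lborel {0<..} (\<lambda>x. \<bar>u x\<bar> powr p)"
    "(LINT x|lborel. (half_speed \<sigma> u x)\<^sup>2) = \<sigma>\<^sup>2 * (LINT x:{0<..}|lborel. (u x)\<^sup>2) - 2 / p * (LINT x:{0<..}|lborel. \<bar>u x\<bar> powr p)"
proof -
  have uc: "continuous_on {0..} u" and u2: "set_integrable lborel {0<..} (\<lambda>x. (u x)\<^sup>2)"
    and Vm: "V \<in> borel_measurable lborel" and V2: "integrable lborel (\<lambda>x. (V x)\<^sup>2)"
    using r by (auto simp: sobolev_rep_def)
  have uc': "continuous_on {0<..} u" using uc by (rule continuous_on_subset) auto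
  have c: "continuous_on {0<..} (\<lambda>x. speed \<sigma> \<bar>u x\<bar>)"
    by (intro continuous_on_compose2[OF continuous_on_speed[OF s, of UNIV]] continuous_intros uc') auto
  show m: "half_speed \<sigma> u \<in> borel_measurable lborel"
    unfolding half_speed_def[abs_def] using c by (auto intro!: borel_measurable_continuous_on_indicator simp del: real_scaleR_def)
  have nn: "0 \<le> half_speed \<sigma> u x" for x
    using speed_nonneg[OF s, of "\<bar>u x\<bar>"] bd[of x] by (auto simp: half_speed_def indicator_def)
  then show "0 \<le> half_speed \<sigma> u x" .
  have sq: "(half_speed \<sigma> u x)\<^sup>2 = indicator {0<..} x *\<^sub>R (\<sigma>\<^sup>2 * (u x)\<^sup>2 - 2 / p * \<bar>u x\<bar> powr p)" for x
    using speed_sq[OF s, of "\<bar>u x\<bar>"] bd[of x] by (auto simp: half_speed_def indicator_def)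
  have su2: "integrable lborel (\<lambda>x. indicator {0<..} x *\<^sub>R (\<sigma>\<^sup>2 * (u x)\<^sup>2))"
    using set_integrable_mult_right[OF u2, of "\<sigma>\<^sup>2"] by (simp add: set_integrable_def)
  show i2: "integrable lborel (\<lambda>x. (half_speed \<sigma> u x)\<^sup>2)"
  proof (rule Bochner_Integration.integrable_bound[OF su2])
    show "(\<lambda>x. (half_speed \<sigma> u x)\<^sup>2) \<in> borel_measurable lborel" using m by measurable
    have "(half_speed \<sigma> u x)\<^sup>2 \<le> indicator {0<..} x *\<^sub>R (\<sigma>\<^sup>2 * (u x)\<^sup>2)" for x
      unfolding sq using p4 by (auto simp: indicator_def)
    then show "AE x in lborel. norm ((half_speed \<sigma> u x)\<^sup>2) \<le> norm (indicator {0<..} x *\<^sub>R (\<sigma>\<^sup>2 * (u x)\<^sup>2))"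
      by (intro AE_I2) (auto simp: indicator_def intro: order_trans[OF _ abs_ge_self])
  qed
  show "integrable lborel (\<lambda>x. half_speed \<sigma> u x * \<bar>V x\<bar>)"
  proof (rule Bochner_Integration.integrable_bound[OF Bochner_Integration.integrable_add[OF i2 V2]])
    show "(\<lambda>x. half_speed \<sigma> u x * \<bar>V x\<bar>) \<in> borel_measurable lborel" using m Vm by measurable
    have "half_speed \<sigma> u x * \<bar>V x\<bar> \<le> (half_speed \<sigma> u x)\<^sup>2 + (V x)\<^sup>2" for x
    proof -
      have "0 \<le> (half_speed \<sigma> u x - \<bar>V x\<bar>)\<^sup>2" "0 \<le> half_speed \<sigma> u x * \<bar>V x\<bar>" using nn[of x] by auto
      then show ?thesis unfolding power2_diff power2_abs by linarith
    qed
    then show "AE x in lborel. norm (half_speed \<sigma> u x * \<bar>V x\<bar>) \<le> norm ((half_speed \<sigma> u x)\<^sup>2 + (V x)\<^sup>2)"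
      using nn by (intro AE_I2) (simp add: abs_mult)
  qed
  have "integrable lborel (\<lambda>x. p / 2 * (indicator {0<..} x *\<^sub>R (\<sigma>\<^sup>2 * (u x)\<^sup>2) - (half_speed \<sigma> u x)\<^sup>2))"
    using su2 i2 by auto
  also have "(\<lambda>x. p / 2 * (indicator {0<..} x *\<^sub>R (\<sigma>\<^sup>2 * (u x)\<^sup>2) - (half_speed \<sigma> u x)\<^sup>2)) = (\<lambda>x. indicator {0<..} x *\<^sub>R (\<bar>u x\<bar> powr p))"
    unfolding sq using p4 by (auto simp: indicator_def)
  finally show up: "set_integrable lborel {0<..} (\<lambda>x. \<bar>u x\<bar> powr p)" by (simp add: set_integrable_def)
  show "(LINT x|lborel. (half_speed \<sigma> u x)\<^sup>2) = \<sigma>\<^sup>2 * (LINT x:{0<..}|lborel. (u x)\<^sup>2) - 2 / p * (LINT x:{0<..}|lborel. \<bar>u x\<bar> powr p)"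
  proof -
    have "(LINT x|lborel. (half_speed \<sigma> u x)\<^sup>2) = (LINT x:{0<..}|lborel. \<sigma>\<^sup>2 * (u x)\<^sup>2 - 2 / p * \<bar>u x\<bar> powr p)"
      unfolding sq set_lebesgue_integral_def ..
    also have "\<dots> = (LINT x:{0<..}|lborel. \<sigma>\<^sup>2 * (u x)\<^sup>2) - (LINT x:{0<..}|lborel. 2 / p * \<bar>u x\<bar> powr p)"
      by (intro set_integral_diff(2) set_integrable_mult_right) (use u2 up in auto)
    finally show ?thesis by simp
  qed
qed

text \<open>The levels of |u| run from the boundary value up to the peak at x0 and back down to 0 at
  infinity. In the metric \<open>speed\<close> the lengths of these two legs add up to the left
  side, and the chain inequality bounds each leg.\<close>

lemma travel_bound:
  assumes r: "sobolev_rep u V" and s: "0 < \<sigma>" and bd: "\<And>x. 0 \<le> x \<Longrightarrow> \<bar>u x\<bar> \<le> amp \<sigma>"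
    and x0: "0 \<le> x0" "\<bar>u x0\<bar> = amp \<sigma>"
  shows "\<sigma> * (amp \<sigma>)\<^sup>2 * (2 * Psi b 1 - Psi b (\<bar>u 0\<bar> / amp \<sigma>)) \<le> (LINT x|lborel. half_speed \<sigma> u x * \<bar>V x\<bar>)"
proof -
  note A = amp_pos[OF s] and F = half_speed_facts[OF r s bd]
  define P where "P w = \<sigma> * (amp \<sigma>)\<^sup>2 * Psi b (w / amp \<sigma>)" for w
  have PD: "(P has_real_derivative speed \<sigma> w) (at w)" for w
    using DERIV_travel_cost[OF s] by (simp add: P_def[abs_def])
  have V0: "V x = 0" if "x \<le> 0" for x using r that by (auto simp: sobolev_rep_def)
  let ?h = "\<lambda>x. half_speed \<sigma> u x * \<bar>V x\<bar>"
  have hi: "set_integrable lborel B ?h" if "B \<in> sets borel" for B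
    using F(4) that unfolding set_integrable_def by (intro integrable_mult_indicator) auto
  have step: "\<bar>P \<bar>u y\<bar> - P \<bar>u x\<bar>\<bar> \<le> (LINT z:{x..y}|lborel. ?h z)" if "0 \<le> x" "x \<le> y" for x y
  proof -
    have "\<bar>P \<bar>u y\<bar> - P \<bar>u x\<bar>\<bar> \<le> (LINT z:{x..y}|lborel. \<bar>speed \<sigma> \<bar>u z\<bar>\<bar> * \<bar>V z\<bar>)"
      by (rule chain_inequality_abs[OF r that open_UNIV _ PD continuous_on_speed[OF s]]) simp
    also have "\<dots> = (LINT z:{x..y}|lborel. ?h z)"
    proof (rule set_lebesgue_integral_cong)
      show "\<forall>z. z \<in> {x..y} \<longrightarrow> \<bar>speed \<sigma> \<bar>u z\<bar>\<bar> * \<bar>V z\<bar> = ?h z"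
      proof (intro allI impI)
        fix z assume z: "z \<in> {x..y}"
        show "\<bar>speed \<sigma> \<bar>u z\<bar>\<bar> * \<bar>V z\<bar> = ?h z"
        proof (cases "0 < z")
          case True
          then show ?thesis using speed_nonneg[OF s, of "\<bar>u z\<bar>"] bd[of z] by (simp add: half_speed_def)
        qed (simp add: V0)
      qed
    qed simp
    finally show ?thesis .
  qed
  have "(P (amp \<sigma>) - P \<bar>u 0\<bar>) + (P (amp \<sigma>) - P \<bar>u y\<bar>) \<le> (LINT x|lborel. ?h x)" if y: "x0 \<le> y" for y
  proof -
    have "(P (amp \<sigma>) - P \<bar>u 0\<bar>) + (P (amp \<sigma>) - P \<bar>u y\<bar>) \<le> (LINT z:{0..x0}|lborel. ?h z) + (LINT z:{x0..y}|lborel. ?h z)"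
      using step[of 0 x0] step[of x0 y] x0 y by auto
    also have "\<dots> = (LINT z:{0..y}|lborel. ?h z)"
      using set_integral_Icc_split[OF hi[of "{0..y}"] x0(1) y] by simp
    also have "\<dots> \<le> (LINT x|lborel. ?h x)"
      unfolding set_lebesgue_integral_def
    proof (rule integral_mono)
      show "integrable lborel (\<lambda>x. indicat_real {0..y} x *\<^sub>R ?h x)" using hi[of "{0..y}"] by (simp only: set_integrable_def) simp
      show "indicat_real {0..y} x *\<^sub>R ?h x \<le> ?h x" for x using F(3)[of x] by (auto simp: indicator_def)
    qed (rule F(4))
    finally show ?thesis .
  qed
  then have ev: "\<forall>\<^sub>F y in at_top. (P (amp \<sigma>) - P \<bar>u 0\<bar>) + (P (amp \<sigma>) - P \<bar>u y\<bar>) \<le> (LINT x|lborel. ?h x)"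
    by (rule eventually_at_top_linorderI)
  have "((\<lambda>y. P \<bar>u y\<bar>) \<longlongrightarrow> P \<bar>0\<bar>) at_top"
    by (intro isCont_tendsto_compose[OF DERIV_isCont[OF PD]] tendsto_intros sobolev_rep_tendsto_0[OF r])
  then have "((\<lambda>y. (P (amp \<sigma>) - P \<bar>u 0\<bar>) + (P (amp \<sigma>) - P \<bar>u y\<bar>)) \<longlongrightarrow> (P (amp \<sigma>) - P \<bar>u 0\<bar>) + (P (amp \<sigma>) - P \<bar>0\<bar>)) at_top"
    by (intro tendsto_intros)
  from tendsto_upperbound[OF this ev]
  show ?thesis using A by (simp add: P_def algebra_simps)
qed

text \<open>Positive mass makes the maximum of |u| positive, which fixes \<sigma>. The potential
  term is rewritten through the square of \<open>half_speed\<close>, and the square with |V| is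
  completed. The three summands are kept apart because the equality case is read off from each
  separately.\<close>

lemma energy_decomposition:
  assumes u: "u \<in> H1_mass \<mu>" and m: "0 < \<mu>"
  obtains \<sigma> V x0 where "0 < \<sigma>" "sobolev_rep u V" "0 \<le> x0" "\<bar>u x0\<bar> = amp \<sigma>" "\<forall>x\<ge>0. \<bar>u x\<bar> \<le> amp \<sigma>"
    "energy p \<alpha> u = 1 / 2 * (LINT x|lborel. (\<bar>V x\<bar> - half_speed \<sigma> u x)\<^sup>2)
       + ((LINT x|lborel. half_speed \<sigma> u x * \<bar>V x\<bar>) - \<sigma> * (amp \<sigma>)\<^sup>2 * (2 * Psi b 1 - Psi b (\<bar>u 0\<bar> / amp \<sigma>)))
       + (boundary_cost \<sigma> (\<bar>u 0\<bar> / amp \<sigma>) - \<sigma>\<^sup>2 / 2 * \<mu>)"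
proof -
  have uH: "u \<in> H1_half" and um: "(LINT x:{0<..}|lborel. (u x)\<^sup>2) = \<mu>" using u by (auto simp: H1_mass_def mass_def)
  obtain V where r: "sobolev_rep u V" and K: "(LINT x:{0<..}|lborel. \<bar>wderiv u x\<bar>\<^sup>2) = (LINT x|lborel. (V x)\<^sup>2)"
    using H1_half_sobolev_rep[OF uH] .
  have uc: "continuous_on {0..} u" using r by (simp add: sobolev_rep_def)
  have "\<exists>z>0. u z \<noteq> 0"
  proof (rule ccontr)
    assume "\<not> ?thesis"
    then have z: "\<And>z. 0 < z \<Longrightarrow> u z = 0" by blast
    have "(LINT x:{0<..}|lborel. (u x)\<^sup>2) = (LINT x:{0::real<..}|lborel. 0 :: real)"
      by (rule set_lebesgue_integral_cong) (use z in auto)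
    then show False using um m by simp
  qed
  then obtain z where z: "0 < z" "u z \<noteq> 0" by blast
  have "\<exists>x0\<ge>0. \<forall>x\<ge>0. \<bar>u x\<bar> \<le> \<bar>u x0\<bar>"
    by (rule attains_max_half_line[of "\<lambda>x. \<bar>u x\<bar>" z])
       (use z uc sobolev_rep_tendsto_0[OF r] in \<open>auto intro!: continuous_intros tendsto_rabs_zero\<close>)
  then obtain x0 where x0: "0 \<le> x0" "\<And>x. 0 \<le> x \<Longrightarrow> \<bar>u x\<bar> \<le> \<bar>u x0\<bar>" by blast
  have "0 < \<bar>u x0\<bar>" using x0(2)[of z] z by auto
  then obtain \<sigma> where s: "0 < \<sigma>" "amp \<sigma> = \<bar>u x0\<bar>" using amp_surj by metis
  have bd: "\<And>x. 0 \<le> x \<Longrightarrow> \<bar>u x\<bar> \<le> amp \<sigma>" using x0 s by simp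
  note F = half_speed_facts[OF r s(1) bd] and A = amp_pos[OF s(1)]
  have V2: "integrable lborel (\<lambda>x. (V x)\<^sup>2)" using r by (simp add: sobolev_rep_def)
  have "(LINT x|lborel. (\<bar>V x\<bar> - half_speed \<sigma> u x)\<^sup>2) = (LINT x|lborel. ((V x)\<^sup>2 + (half_speed \<sigma> u x)\<^sup>2) - 2 * (half_speed \<sigma> u x * \<bar>V x\<bar>))"
    by (intro Bochner_Integration.integral_cong) (auto simp: power2_diff)
  also have "\<dots> = ((LINT x|lborel. (V x)\<^sup>2) + (LINT x|lborel. (half_speed \<sigma> u x)\<^sup>2)) - 2 * (LINT x|lborel. half_speed \<sigma> u x * \<bar>V x\<bar>)"
    using V2 F(2,4) by simp
  finally have Q: "(LINT x|lborel. (\<bar>V x\<bar> - half_speed \<sigma> u x)\<^sup>2) = \<dots>" .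
  have B: "boundary_cost \<sigma> (\<bar>u 0\<bar> / amp \<sigma>) = \<sigma> * (amp \<sigma>)\<^sup>2 * (2 * Psi b 1 - Psi b (\<bar>u 0\<bar> / amp \<sigma>)) + \<alpha> / 2 * \<bar>u 0\<bar>\<^sup>2"
    using A unfolding boundary_cost_def by (simp add: power_divide field_simps)
  have N: "(LINT x:{0<..}|lborel. \<bar>u x\<bar> powr p) = p / 2 * (\<sigma>\<^sup>2 * \<mu> - (LINT x|lborel. (half_speed \<sigma> u x)\<^sup>2))"
    using F(6) um p4 by (simp add: field_simps)
  have "energy p \<alpha> u = 1 / 2 * (LINT x|lborel. (\<bar>V x\<bar> - half_speed \<sigma> u x)\<^sup>2)
       + ((LINT x|lborel. half_speed \<sigma> u x * \<bar>V x\<bar>) - \<sigma> * (amp \<sigma>)\<^sup>2 * (2 * Psi b 1 - Psi b (\<bar>u 0\<bar> / amp \<sigma>)))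
       + (boundary_cost \<sigma> (\<bar>u 0\<bar> / amp \<sigma>) - \<sigma>\<^sup>2 / 2 * \<mu>)"
    unfolding energy_def K Q B N using p4 by (simp add: field_simps)
  then show ?thesis using that[OF s(1) r x0(1)] s bd by simp
qed

text \<open>The form in which equality is exploited: |V| = speed turns any bound on |\<psi>| times
  speed into a Lipschitz bound for P(|u|). The two lemmas that follow differ only in the choice of
  P.\<close>

lemma level_lipschitz:
  assumes r: "sobolev_rep u V" and s: "0 < \<sigma>" and bd: "\<And>x. 0 \<le> x \<Longrightarrow> \<bar>u x\<bar> \<le> amp \<sigma>"
    and ae: "AE x in lborel. \<bar>V x\<bar> = half_speed \<sigma> u x"
    and xy: "0 \<le> x" "x \<le> y" and S: "open S" "\<And>z. x \<le> z \<Longrightarrow> z \<le> y \<Longrightarrow> \<bar>u z\<bar> \<in> S"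
    and P: "\<And>w. w \<in> S \<Longrightarrow> (P has_real_derivative \<psi> w) (at w)" and \<psi>: "continuous_on S \<psi>"
    and K: "\<And>z. x \<le> z \<Longrightarrow> z \<le> y \<Longrightarrow> \<bar>\<psi> \<bar>u z\<bar>\<bar> * speed \<sigma> \<bar>u z\<bar> \<le> K"
  shows "\<bar>P \<bar>u y\<bar> - P \<bar>u x\<bar>\<bar> \<le> K * (y - x)"
proof -
  have Vi: "set_integrable lborel {x..y} (\<lambda>s. \<bar>V s\<bar>)"
    using r by (auto simp: sobolev_rep_def intro!: set_integrable_abs set_integrable_Icc_of_square)
  have uc: "continuous_on {x..y} u" using r xy by (auto simp: sobolev_rep_def intro: continuous_on_subset)
  have "\<bar>P \<bar>u y\<bar> - P \<bar>u x\<bar>\<bar> \<le> (LINT z:{x..y}|lborel. \<bar>\<psi> \<bar>u z\<bar>\<bar> * \<bar>V z\<bar>)"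
    by (rule chain_inequality_abs[OF r xy S P \<psi>])
  also have "\<dots> \<le> (LINT z:{x..y}|lborel. K)"
  proof (rule set_integral_mono_AE)
    show "set_integrable lborel {x..y} (\<lambda>z. \<bar>\<psi> \<bar>u z\<bar>\<bar> * \<bar>V z\<bar>)"
      by (rule set_integrable_continuous_mult[OF Vi])
         (intro continuous_intros continuous_on_compose2[OF \<psi>] uc, use S in auto)
    show "set_integrable lborel {x..y} (\<lambda>z. K)" by (rule borel_integrable_atLeastAtMost'[OF continuous_on_const])
    show "AE z\<in>{x..y} in lborel. \<bar>\<psi> \<bar>u z\<bar>\<bar> * \<bar>V z\<bar> \<le> K"
      using ae
    proof eventually_elim
      case (elim z)
      show ?case
      proof
        assume z: "z \<in> {x..y}"
        have "\<bar>V z\<bar> \<le> speed \<sigma> \<bar>u z\<bar>"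
          using speed_nonneg[OF s, of "\<bar>u z\<bar>"] bd[of z] z xy unfolding elim by (auto simp: half_speed_def indicator_def)
        then have "\<bar>\<psi> \<bar>u z\<bar>\<bar> * \<bar>V z\<bar> \<le> \<bar>\<psi> \<bar>u z\<bar>\<bar> * speed \<sigma> \<bar>u z\<bar>" by (intro mult_left_mono) auto
        also have "\<dots> \<le> K" using K z by simp
        finally show "\<bar>\<psi> \<bar>u z\<bar>\<bar> * \<bar>V z\<bar> \<le> K" .
      qed
    qed
  qed
  also have "\<dots> = K * (y - x)" using xy by (simp add: set_lebesgue_integral_def)
  finally show ?thesis .
qed

text \<open>As the speed at w is at most \<sigma> w, ln (|u| + e) is \<sigma>-Lipschitz, and letting
  e tend to 0 spreads the zero over the half-line. It excludes equality when the optimal boundary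
  ratio is 0.\<close>

lemma equality_vanishing:
  assumes r: "sobolev_rep u V" and s: "0 < \<sigma>" and bd: "\<And>x. 0 \<le> x \<Longrightarrow> \<bar>u x\<bar> \<le> amp \<sigma>"
    and ae: "AE x in lborel. \<bar>V x\<bar> = half_speed \<sigma> u x" and u0: "u 0 = 0" and y: "0 \<le> y"
  shows "u y = 0"
proof -
  have "\<bar>u y\<bar> + e \<le> e * exp (\<sigma> * y)" if e: "0 < e" for e
  proof -
    have "\<bar>ln (\<bar>u y\<bar> + e) - ln (\<bar>u 0\<bar> + e)\<bar> \<le> \<sigma> * (y - 0)"
    proof (rule level_lipschitz[OF r s bd ae order_refl y, where S="{-e<..}" and \<psi>="\<lambda>w. 1 / (w + e)"])
      show "((\<lambda>w. ln (w + e)) has_real_derivative 1 / (w + e)) (at w)" if "w \<in> {-e<..}" for w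
        using that by (auto intro!: derivative_eq_intros)
      show "\<bar>1 / (\<bar>u z\<bar> + e)\<bar> * speed \<sigma> \<bar>u z\<bar> \<le> \<sigma>" if "0 \<le> z" for z
      proof -
        have "speed \<sigma> \<bar>u z\<bar> \<le> \<sigma> * \<bar>u z\<bar>" using speed_le[OF s] bd[OF that] by simp
        also have "\<dots> \<le> \<sigma> * (\<bar>u z\<bar> + e)" using s e by simp
        finally show ?thesis using e by (simp add: divide_le_eq)
      qed
    qed (use e in \<open>auto intro!: continuous_intros\<close>)
    then have "ln (\<bar>u y\<bar> + e) \<le> \<sigma> * y + ln e" by (simp add: u0)
    then have "\<bar>u y\<bar> + e \<le> exp (\<sigma> * y + ln e)" using e by (metis abs_ge_zero add_nonneg_pos exp_le_cancel_iff exp_ln)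
    then show ?thesis using e by (simp add: exp_add mult.commute)
  qed
  then have b: "\<bar>u y\<bar> \<le> e * exp (\<sigma> * y)" if "0 < e" for e using that by (smt (verit))
  have "\<bar>u y\<bar> \<le> 0 + e" if "0 < e" for e
    using b[of "e / exp (\<sigma> * y)"] that by simp
  then have "\<bar>u y\<bar> \<le> 0" by (rule field_le_epsilon)
  then show ?thesis by simp
qed

text \<open>The scaled distance from the peak, arcosh of (amp \<sigma> / w)^(1 / b), grows along u
  at rate at most \<sigma> / b, so |u| cannot fall away from x0 faster than the soliton does. Only
  this inequality is to be expected: u may rest at its maximum, where the speed is 0.\<close>

lemma equality_positive:
  assumes r: "sobolev_rep u V" and s: "0 < \<sigma>" and bd: "\<And>x. 0 \<le> x \<Longrightarrow> \<bar>u x\<bar> \<le> amp \<sigma>"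
    and ae: "AE x in lborel. \<bar>V x\<bar> = half_speed \<sigma> u x"
    and x0: "0 \<le> x0" "\<bar>u x0\<bar> = amp \<sigma>" and pos: "\<And>x. 0 \<le> x \<Longrightarrow> u x \<noteq> 0" and x: "0 \<le> x"
  shows "shifted \<sigma> (\<sigma> / b * x0) x \<le> \<bar>u x\<bar>"
proof -
  note A = amp_pos[OF s]
  define q where "q w = (amp \<sigma> / w) powr (1 / b)" for w
  have ux: "0 < \<bar>u x\<bar>" using pos[OF x] by simp
  have q1: "1 \<le> q \<bar>u x\<bar>" unfolding q_def using bd[OF x] ux b_bounds by (intro ge_one_powr_ge_zero) auto
  have "arcosh (q \<bar>u x\<bar>) \<le> \<sigma> / b * \<bar>x - x0\<bar> + e" if e: "0 < e" for e
  proof -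
    \<comment> \<open>The derivative of arcosh blows up at 1, that is, at the maximum of |u|. The
      slightly larger M keeps away from it, and its form makes the value at x0 exactly e.\<close>
    define M where "M = amp \<sigma> * cosh e powr b"
    have ce: "1 < cosh e" using cosh_real_strict_mono[of 0 e] e by simp
    then have "1 powr b < cosh e powr b" using b_bounds by (intro powr_less_mono2) auto
    then have M: "amp \<sigma> < M" using A by (simp add: M_def)
    have qM: "(M / w) powr (1 / b) = cosh e * q w" for w
      using b_bounds A ce by (simp add: M_def q_def powr_divide powr_mult powr_powr)
    define \<theta> where "\<theta> w = arcosh ((M / w) powr (1 / b))" for w
    have lip: "\<bar>\<theta> \<bar>u t\<bar> - \<theta> \<bar>u v\<bar>\<bar> \<le> \<sigma> / b * (t - v)" if vt: "0 \<le> v" "v \<le> t" for v t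
    proof (rule level_lipschitz[OF r s bd ae vt, where S="{0<..<M}" and \<psi>="\<lambda>w. - 1 / (b * w * sqrt (1 - (w / M) powr (2 / b)))"])
      have lt: "(w / M) powr (2 / b) < 1" if "0 < w" "w < M" for w
        using powr_less_mono2[of "2 / b" "w / M" 1] that b_bounds by simp
      show "(\<theta> has_real_derivative - 1 / (b * w * sqrt (1 - (w / M) powr (2 / b)))) (at w)" if "w \<in> {0<..<M}" for w
        unfolding \<theta>_def[abs_def] using that b_bounds by (intro DERIV_arcosh_ratio) auto
      show "continuous_on {0<..<M} (\<lambda>w. - 1 / (b * w * sqrt (1 - (w / M) powr (2 / b))))"
        using b_bounds lt A M by (intro continuous_intros) (auto simp: less_imp_neq)
      fix z assume z: "v \<le> z" "z \<le> t"
      define w where "w = \<bar>u z\<bar>"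
      have w: "0 < w" "w \<le> amp \<sigma>" using pos[of z] bd[of z] z vt by (auto simp: w_def)
      then show "\<bar>u z\<bar> \<in> {0<..<M}" using M by (simp add: w_def)
      have "(w / M) powr (2 / b) \<le> (w / amp \<sigma>) powr (2 / b)"
        using w M A b_bounds by (intro powr_mono2 divide_left_mono) auto
      then have le: "sqrt (1 - (w / amp \<sigma>) powr (2 / b)) \<le> sqrt (1 - (w / M) powr (2 / b))" by simp
      have sp: "0 < sqrt (1 - (w / M) powr (2 / b))" using lt[of w] w M by simp
      have "speed \<sigma> w \<le> \<sigma> * w * sqrt (1 - (w / M) powr (2 / b))"
        unfolding speed_eq[OF s less_imp_le[OF w(1)]] using le s w by (intro mult_left_mono) auto
      then have "speed \<sigma> w / (b * w * sqrt (1 - (w / M) powr (2 / b))) \<le> \<sigma> * w * sqrt (1 - (w / M) powr (2 / b)) / (b * w * sqrt (1 - (w / M) powr (2 / b)))"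
        using sp w b_bounds by (intro divide_right_mono) auto
      also have "\<dots> = \<sigma> / b" using sp w b_bounds by simp
      finally show "\<bar>- 1 / (b * \<bar>u z\<bar> * sqrt (1 - (\<bar>u z\<bar> / M) powr (2 / b)))\<bar> * speed \<sigma> \<bar>u z\<bar> \<le> \<sigma> / b"
        unfolding w_def[symmetric] using sp w b_bounds by (simp add: abs_mult)
    qed simp_all
    have "\<theta> \<bar>u x0\<bar> = e" using e A by (simp add: \<theta>_def qM q_def x0 arcosh_cosh_real)
    moreover have "\<bar>\<theta> \<bar>u x\<bar> - \<theta> \<bar>u x0\<bar>\<bar> \<le> \<sigma> / b * \<bar>x - x0\<bar>"
      using lip[of x x0] lip[of x0 x] x x0 by (cases "x \<le> x0") (simp_all add: abs_minus_commute)
    moreover have "arcosh (q \<bar>u x\<bar>) \<le> \<theta> \<bar>u x\<bar>"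
    proof -
      have "1 * q \<bar>u x\<bar> \<le> cosh e * q \<bar>u x\<bar>" using ce q1 by (intro mult_right_mono) auto
      then have "q \<bar>u x\<bar> \<le> (M / \<bar>u x\<bar>) powr (1 / b)" by (simp add: qM)
      then show ?thesis unfolding \<theta>_def using q1 by (cases "q \<bar>u x\<bar> = (M / \<bar>u x\<bar>) powr (1 / b)") (auto intro!: less_imp_le)
    qed
    ultimately show ?thesis by linarith
  qed
  then have "arcosh (q \<bar>u x\<bar>) \<le> \<sigma> / b * \<bar>x - x0\<bar>" by (rule field_le_epsilon)
  then have "cosh (arcosh (q \<bar>u x\<bar>)) \<le> cosh (\<sigma> / b * \<bar>x - x0\<bar>)"
    using q1 s b_bounds by (subst cosh_real_nonneg_le_iff) auto
  also have "\<sigma> / b * \<bar>x - x0\<bar> = \<bar>\<sigma> / b * x - \<sigma> / b * x0\<bar>"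
  proof -
    have "\<sigma> / b * x - \<sigma> / b * x0 = \<sigma> / b * (x - x0)" by (simp only: right_diff_distrib)
    moreover have "0 \<le> \<sigma> / b" using s b_bounds by simp
    ultimately show ?thesis by (simp only: abs_mult abs_of_nonneg)
  qed
  finally have "q \<bar>u x\<bar> \<le> cosh (\<sigma> / b * x - \<sigma> / b * x0)" using q1 by (simp add: cosh_real_abs)
  then have "(q \<bar>u x\<bar>) powr b \<le> cosh (\<sigma> / b * x - \<sigma> / b * x0) powr b"
    using q1 b_bounds by (intro powr_mono2) auto
  moreover have "(q \<bar>u x\<bar>) powr b = amp \<sigma> / \<bar>u x\<bar>" using A ux b_bounds by (simp add: q_def powr_powr)
  ultimately have "amp \<sigma> / \<bar>u x\<bar> \<le> cosh (\<sigma> / b * x - \<sigma> / b * x0) powr b" by simp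
  then show ?thesis using ux by (simp add: shifted_def powr_minus field_simps)
qed

end

section \<open>Minimisers and minimising sequences\<close>

text \<open>Removes the extended reals: once the infimum is attained it is finite, and the condition
  is a comparison of real energies.\<close>

lemma ground_states_iff:
  "u \<in> ground_states p \<alpha> \<mu> \<longleftrightarrow> u \<in> H1_mass \<mu> \<and> (\<forall>w\<in>H1_mass \<mu>. energy p \<alpha> u \<le> energy p \<alpha> w)"
proof
  assume "u \<in> ground_states p \<alpha> \<mu>"
  then have u: "u \<in> H1_mass \<mu>" and e: "ereal (energy p \<alpha> u) = energy_level p \<alpha> \<mu>"
    by (auto simp: ground_states_def)
  have "ereal (energy p \<alpha> u) \<le> ereal (energy p \<alpha> w)" if "w \<in> H1_mass \<mu>" for w
    unfolding e energy_level_def using that by (rule INF_lower)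
  then show "u \<in> H1_mass \<mu> \<and> (\<forall>w\<in>H1_mass \<mu>. energy p \<alpha> u \<le> energy p \<alpha> w)" using u by simp
next
  assume h: "u \<in> H1_mass \<mu> \<and> (\<forall>w\<in>H1_mass \<mu>. energy p \<alpha> u \<le> energy p \<alpha> w)"
  then have "ereal (energy p \<alpha> u) = energy_level p \<alpha> \<mu>"
    unfolding energy_level_def by (intro antisym INF_greatest INF_lower) auto
  then show "u \<in> ground_states p \<alpha> \<mu>" using h by (simp add: ground_states_def)
qed

context supercritical_nls
begin

text \<open>|u| lies above the soliton centred at x0, with scaled centre T. At 0 this gives T \<ge>
  centre \<sigma>; since the mass grows with T, integrating the squares gives T \<le> centre
  \<sigma>. Both masses then agree and the nonnegative continuous difference of squares
  vanishes.\<close>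

lemma equality_profile:
  assumes u: "u \<in> H1_mass \<mu>" and r: "sobolev_rep u V" and s: "\<alpha> < \<sigma>"
    and bd: "\<And>x. 0 \<le> x \<Longrightarrow> \<bar>u x\<bar> \<le> amp \<sigma>" and ae: "AE x in lborel. \<bar>V x\<bar> = half_speed \<sigma> u x"
    and x0: "0 \<le> x0" "\<bar>u x0\<bar> = amp \<sigma>" and u0: "\<bar>u 0\<bar> = amp \<sigma> * cosh (centre \<sigma>) powr (- b)"
    and pos: "positive_half u" and m: "mass_curve \<sigma> = \<mu>"
  shows "u = profile \<sigma> (centre \<sigma>)"
proof -
  have s0: "0 < \<sigma>" using s alpha by simp
  note A = amp_pos[OF s0]
  define T where "T = \<sigma> / b * x0"
  have T0: "0 \<le> T" using s0 b_bounds x0 by (simp add: T_def)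
  have uc: "continuous_on {0..} u" and u2: "set_integrable lborel {0<..} (\<lambda>x. (u x)\<^sup>2)" using r by (auto simp: sobolev_rep_def)
  have um: "(LINT x:{0<..}|lborel. (u x)\<^sup>2) = \<mu>" using u by (auto simp: H1_mass_def mass_def)
  have nz: "u x \<noteq> 0" if "0 \<le> x" for x
  proof (cases "x = 0")
    case True
    then show ?thesis using u0 A by auto
  next
    case False
    then have "0 < u x" using pos that by (simp add: positive_half_def)
    then show ?thesis by simp
  qed
  have ge: "shifted \<sigma> T x \<le> \<bar>u x\<bar>" if "0 \<le> x" for x
    unfolding T_def by (rule equality_positive[OF r s0 _ ae x0 _ that]) (use bd nz in auto)
  have sq: "(shifted \<sigma> T x)\<^sup>2 \<le> (u x)\<^sup>2" if "0 \<le> x" for x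
    using power_mono[OF ge[OF that] less_imp_le[OF shifted_pos[OF s0]], of 2] by simp
  have "centre \<sigma> \<le> T"
  proof -
    have "amp \<sigma> * cosh T powr (- b) \<le> amp \<sigma> * cosh (centre \<sigma>) powr (- b)"
      using ge[of 0] by (simp add: u0 shifted_def)
    then have le: "cosh T powr (- b) \<le> cosh (centre \<sigma>) powr (- b)" using A by simp
    have "cosh (centre \<sigma>) \<le> cosh T"
    proof (rule ccontr)
      assume "\<not> ?thesis"
      then have "cosh (centre \<sigma>) powr (- b) < cosh T powr (- b)"
        using b_bounds by (intro powr_less_mono2_neg) auto
      then show False using le by simp
    qed
    then show ?thesis using T0 centre_pos[OF s] cosh_real_nonneg_le_iff[of "centre \<sigma>" T] by simp
  qed
  moreover have "profile_mass \<sigma> T \<le> profile_mass \<sigma> (centre \<sigma>)"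
  proof -
    have "profile_mass \<sigma> T = (LINT x:{0<..}|lborel. (shifted \<sigma> T x)\<^sup>2)" using shifted_integrals(2)[OF s0] by simp
    also have "\<dots> \<le> (LINT x:{0<..}|lborel. (u x)\<^sup>2)"
      by (rule set_integral_mono[OF shifted_integrals(1)[OF s0] u2]) (use sq in auto)
    also have "\<dots> = profile_mass \<sigma> (centre \<sigma>)" using um m s by (simp add: mass_curve_def)
    finally show ?thesis .
  qed
  ultimately have T: "T = centre \<sigma>" using profile_mass_strict_mono[OF s0, of "centre \<sigma>" T] by linarith
  have z: "(u x)\<^sup>2 - (shifted \<sigma> T x)\<^sup>2 = 0" if "0 < x" for x
  proof (rule continuous_zero_if_integral_zero[of "\<lambda>x. (u x)\<^sup>2 - (shifted \<sigma> T x)\<^sup>2"])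
    show "continuous_on {0<..} (\<lambda>x. (u x)\<^sup>2 - (shifted \<sigma> T x)\<^sup>2)"
      by (intro continuous_intros continuous_on_shifted continuous_on_subset[OF uc]) auto
    show "0 \<le> (u x)\<^sup>2 - (shifted \<sigma> T x)\<^sup>2" if "0 < x" for x using sq[of x] that by simp
    show "set_integrable lborel {0<..} (\<lambda>x. (u x)\<^sup>2 - (shifted \<sigma> T x)\<^sup>2)"
      by (intro set_integral_diff u2 shifted_integrals(1)[OF s0])
    show "(LINT x:{0<..}|lborel. (u x)\<^sup>2 - (shifted \<sigma> T x)\<^sup>2) = 0"
      using set_integral_diff(2)[OF u2 shifted_integrals(1)[OF s0, of T]] um shifted_integrals(2)[OF s0, of T] m s T
      by (simp add: mass_curve_def)
  qed (rule that)
  have upos: "0 < u x" if "0 < x" for x using pos that by (simp add: positive_half_def)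
  have eq: "u x = shifted \<sigma> T x" if "0 < x" for x
    using z[OF that] upos[OF that] shifted_pos[OF s0, of T x] by (simp add: power2_eq_iff)
  \<comment> \<open>Positivity is given on the open half-line only, and the boundary value is known
    only up to sign.\<close>
  have "0 \<le> u 0"
    by (rule continuous_ge_on_closure[of "{0<..}" u]) (use uc upos in \<open>auto intro: less_imp_le\<close>)
  then have "u 0 = shifted \<sigma> T 0" using u0 by (simp add: T shifted_def)
  then have "u x = shifted \<sigma> T x" if "0 \<le> x" for x using eq that by (cases "x = 0") auto
  moreover have "u \<in> extensional {0..}" using u by (simp add: H1_mass_def H1_half_def)
  ultimately show ?thesis unfolding T
    by (intro extensionalityI[of u "{0..}"]) (auto simp: profile_def)
qed

text \<open>\<sigma> is determined by the maximum of |u| before anything is known about equality,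
  hence the implications. Equality makes the square defect vanish and the boundary ratio optimal; a
  ratio 0 would make u vanish at its own maximum point, hence \<alpha> < \<sigma>.\<close>

lemma energy_ge_envelope:
  assumes u: "u \<in> H1_mass \<mu>" and m: "0 < \<mu>"
  obtains \<sigma> where "0 < \<sigma>" "envelope \<mu> \<sigma> \<le> energy p \<alpha> u"
    "energy p \<alpha> u \<le> envelope \<mu> \<sigma> \<longrightarrow> \<alpha> < \<sigma>"
    "energy p \<alpha> u \<le> envelope \<mu> \<sigma> \<and> positive_half u \<and> mass_curve \<sigma> = \<mu> \<longrightarrow> u = profile \<sigma> (centre \<sigma>)"
proof -
  obtain \<sigma> V x0 where s: "0 < \<sigma>" and r: "sobolev_rep u V" and x0: "0 \<le> x0" "\<bar>u x0\<bar> = amp \<sigma>"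
    and bd': "\<forall>x\<ge>0. \<bar>u x\<bar> \<le> amp \<sigma>"
    and E: "energy p \<alpha> u = 1 / 2 * (LINT x|lborel. (\<bar>V x\<bar> - half_speed \<sigma> u x)\<^sup>2)
       + ((LINT x|lborel. half_speed \<sigma> u x * \<bar>V x\<bar>) - \<sigma> * (amp \<sigma>)\<^sup>2 * (2 * Psi b 1 - Psi b (\<bar>u 0\<bar> / amp \<sigma>)))
       + (boundary_cost \<sigma> (\<bar>u 0\<bar> / amp \<sigma>) - \<sigma>\<^sup>2 / 2 * \<mu>)"
    using energy_decomposition[OF u m] .
  have bd: "\<And>x. 0 \<le> x \<Longrightarrow> \<bar>u x\<bar> \<le> amp \<sigma>" using bd' by simp
  note A = amp_pos[OF s]
  define rr where "rr = \<bar>u 0\<bar> / amp \<sigma>"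
  have rr: "0 \<le> rr" "rr \<le> 1" using A bd[of 0] by (auto simp: rr_def)
  define Q where "Q = (LINT x|lborel. (\<bar>V x\<bar> - half_speed \<sigma> u x)\<^sup>2)"
  have Q0: "0 \<le> Q" unfolding Q_def by (rule Bochner_Integration.integral_nonneg) simp
  have J0: "\<sigma> * (amp \<sigma>)\<^sup>2 * (2 * Psi b 1 - Psi b (\<bar>u 0\<bar> / amp \<sigma>)) \<le> (LINT x|lborel. half_speed \<sigma> u x * \<bar>V x\<bar>)"
    by (rule travel_bound[OF r s _ x0]) (rule bd)
  have B0: "envelope0 \<sigma> \<le> boundary_cost \<sigma> rr"
    using boundary_cost_min[OF s rr] boundary_cost_ratio[OF s] by (cases "rr = boundary_ratio \<sigma>") auto
  have ge: "envelope \<mu> \<sigma> \<le> energy p \<alpha> u"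
    using E Q0 J0 B0 unfolding envelope_def rr_def[symmetric] Q_def[symmetric] by linarith
  have eqn: "rr = boundary_ratio \<sigma>" "AE x in lborel. \<bar>V x\<bar> = half_speed \<sigma> u x" if le: "energy p \<alpha> u \<le> envelope \<mu> \<sigma>"
  proof -
    have "Q = 0" "boundary_cost \<sigma> rr = envelope0 \<sigma>"
      using E Q0 J0 B0 le unfolding envelope_def rr_def[symmetric] Q_def[symmetric] by linarith+
    then show "rr = boundary_ratio \<sigma>" using boundary_cost_min[OF s rr] by (cases "rr = boundary_ratio \<sigma>") auto
    have V2: "integrable lborel (\<lambda>x. (V x)\<^sup>2)" using r by (simp add: sobolev_rep_def)
    note F = half_speed_facts[OF r s bd]
    have "integrable lborel (\<lambda>x. (V x)\<^sup>2 + (half_speed \<sigma> u x)\<^sup>2 - 2 * (half_speed \<sigma> u x * \<bar>V x\<bar>))"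
      using V2 F(2,4) by auto
    then have Qi: "integrable lborel (\<lambda>x. (\<bar>V x\<bar> - half_speed \<sigma> u x)\<^sup>2)"
      by (rule back_subst[of "integrable lborel"]) (auto simp: power2_diff)
    have "AE x in lborel. (\<bar>V x\<bar> - half_speed \<sigma> u x)\<^sup>2 = 0"
      using integral_nonneg_eq_0_iff_AE[OF Qi] \<open>Q = 0\<close> unfolding Q_def by simp
    then show "AE x in lborel. \<bar>V x\<bar> = half_speed \<sigma> u x" by eventually_elim simp
  qed
  have gt: "\<alpha> < \<sigma>" if le: "energy p \<alpha> u \<le> envelope \<mu> \<sigma>"
  proof (rule ccontr)
    assume "\<not> \<alpha> < \<sigma>"
    then have "rr = 0" using eqn(1)[OF le] by (simp add: boundary_ratio_def)
    then have "u 0 = 0" using A by (simp add: rr_def)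
    have "u x0 = 0" by (rule equality_vanishing[OF r s _ eqn(2)[OF le] \<open>u 0 = 0\<close> x0(1)]) (rule bd)
    then show False using x0 A by simp
  qed
  show ?thesis
  proof (rule that[OF s ge]; intro impI; (elim conjE)?)
    assume le: "energy p \<alpha> u \<le> envelope \<mu> \<sigma>"
    then show "\<alpha> < \<sigma>" by (rule gt)
  next
    assume le: "energy p \<alpha> u \<le> envelope \<mu> \<sigma>" and pos: "positive_half u" and mc: "mass_curve \<sigma> = \<mu>"
    have "\<bar>u 0\<bar> = amp \<sigma> * cosh (centre \<sigma>) powr (- b)"
      using eqn(1)[OF le] gt[OF le] A by (simp add: rr_def boundary_ratio_def field_simps)
    then show "u = profile \<sigma> (centre \<sigma>)"
      by (intro equality_profile[OF u r gt[OF le] _ eqn(2)[OF le] x0 _ pos mc]) (use bd in auto)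
  qed
qed

lemma profile_ground_energy:
  assumes s: "\<alpha> < \<sigma>"
  shows "profile \<sigma> (centre \<sigma>) \<in> H1_mass (mass_curve \<sigma>)"
    "energy p \<alpha> (profile \<sigma> (centre \<sigma>)) = envelope (mass_curve \<sigma>) \<sigma>"
    "positive_half (profile \<sigma> (centre \<sigma>))"
proof -
  have s0: "0 < \<sigma>" using s alpha by simp
  show "profile \<sigma> (centre \<sigma>) \<in> H1_mass (mass_curve \<sigma>)"
    using profile_H1(1)[OF s0] mass_profile[OF s0] s by (simp add: H1_mass_def mass_curve_def)
  show "energy p \<alpha> (profile \<sigma> (centre \<sigma>)) = envelope (mass_curve \<sigma>) \<sigma>"
    using energy_profile[OF s0] s by (simp add: envelope_def envelope0_def mass_curve_def)
  show "positive_half (profile \<sigma> (centre \<sigma>))" using shifted_pos[OF s0] by (simp add: positive_half_def profile_eq)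
qed

text \<open>The competitors are truncated solitons of the given mass whose centre escapes to infinity.\<close>

lemma escaping_solitons:
  assumes s: "0 < \<sigma>" "\<sigma> \<le> \<alpha>" and e: "0 < e"
  shows "\<exists>u\<in>H1_mass (mass_curve \<sigma>). energy p \<alpha> u < envelope (mass_curve \<sigma>) \<sigma> + e"
proof -
  define \<mu> where "\<mu> = mass_curve \<sigma>"
  have \<mu>: "0 < \<mu>" using mass_curve_pos[OF s(1)] by (simp add: \<mu>_def)
  define a where "a T = c * b * (sech_mass_top b + sech_mass b T)" for T
  have a: "0 < a T" for T using c_pos b_bounds sech_mass_sum_pos by (simp add: a_def)
  \<comment> \<open>The frequency that gives the truncated soliton with scaled centre T exactly the
    mass \<mu>; it tends to \<sigma> as T goes to infinity.\<close>
  define f where "f T = (\<mu> / a T) powr (1 / (2 * b - 1))" for T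
  have f: "0 < f T" for T using \<mu> a[of T] by (simp add: f_def)
  have fm: "profile_mass (f T) T = \<mu>" for T
  proof -
    have "f T powr (2 * b - 1) = \<mu> / a T" using \<mu> a[of T] b_bounds by (simp add: f_def powr_powr)
    then have "a T * f T powr (2 * b - 1) = \<mu>" using a[of T] by (simp add: field_simps)
    then show ?thesis by (simp add: profile_mass_def a_def mult_ac)
  qed
  have at: "(a \<longlongrightarrow> c * b * (sech_mass_top b + sech_mass_top b)) at_top"
    unfolding a_def[abs_def] by (intro tendsto_intros sech_mass_tendsto b_bounds)
  have a0: "0 < c * b * (sech_mass_top b + sech_mass_top b)" using c_pos b_bounds sech_mass_top_pos by simp
  have fs: "(\<mu> / (c * b * (sech_mass_top b + sech_mass_top b))) powr (1 / (2 * b - 1)) = \<sigma>"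
  proof -
    have "\<mu> = (c * b * (sech_mass_top b + sech_mass_top b)) * \<sigma> powr (2 * b - 1)" using s by (simp add: \<mu>_def mass_curve_def)
    then have "\<mu> / (c * b * (sech_mass_top b + sech_mass_top b)) = \<sigma> powr (2 * b - 1)" using a0 by (metis less_irrefl nonzero_mult_div_cancel_left)
    then show ?thesis using s b_bounds by (simp add: powr_powr)
  qed
  have "(f \<longlongrightarrow> (\<mu> / (c * b * (sech_mass_top b + sech_mass_top b))) powr (1 / (2 * b - 1))) at_top"
    unfolding f_def[abs_def] using a0 \<mu> by (intro tendsto_intros at) auto
  then have ft: "(f \<longlongrightarrow> \<sigma>) at_top" by (simp only: fs)
  have "((\<lambda>T. c * f T powr (2 * b + 1) * (Psi b 1 + sech_kin b T) + \<alpha> * c / 2 * f T powr (2 * b) * cosh T powr (- (2 * b)) - (f T)\<^sup>2 / 2 * \<mu>)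
     \<longlongrightarrow> c * \<sigma> powr (2 * b + 1) * (Psi b 1 + Psi b 1) + \<alpha> * c / 2 * \<sigma> powr (2 * b) * 0 - \<sigma>\<^sup>2 / 2 * \<mu>) at_top"
    using s b_bounds by (intro tendsto_intros ft sech_kin_tendsto cosh_powr_tendsto_0) auto
  moreover have "c * \<sigma> powr (2 * b + 1) * (Psi b 1 + Psi b 1) + \<alpha> * c / 2 * \<sigma> powr (2 * b) * 0 - \<sigma>\<^sup>2 / 2 * \<mu> = envelope \<mu> \<sigma>"
    using s by (simp add: envelope_def envelope0_def)
  moreover have "energy p \<alpha> (profile (f T) T) = c * f T powr (2 * b + 1) * (Psi b 1 + sech_kin b T) + \<alpha> * c / 2 * f T powr (2 * b) * cosh T powr (- (2 * b)) - (f T)\<^sup>2 / 2 * \<mu>" for T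
    unfolding energy_profile[OF f] fm profile_energy_def by simp
  ultimately have "((\<lambda>T. energy p \<alpha> (profile (f T) T)) \<longlongrightarrow> envelope \<mu> \<sigma>) at_top" by simp
  then have "\<forall>\<^sub>F T in at_top. energy p \<alpha> (profile (f T) T) < envelope \<mu> \<sigma> + e"
    using e by (intro order_tendstoD(2)) auto
  then obtain T where "energy p \<alpha> (profile (f T) T) < envelope \<mu> \<sigma> + e"
    using eventually_happens'[OF trivial_limit_at_top_linorder] by blast
  moreover have "profile (f T) T \<in> H1_mass \<mu>"
    using profile_H1(1)[OF f] mass_profile[OF f] fm by (simp add: H1_mass_def)
  ultimately show ?thesis unfolding \<mu>_def by blast
qed

end



section \<open>Classification of the bound states\<close>

lemma DERIV_abs_powr:
  assumes "2 < p"
  shows "((\<lambda>w::real. \<bar>w\<bar> powr p) has_real_derivative p * \<bar>w\<bar> powr (p - 2) * w) (at w)"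
proof -
  consider "w > 0" | "w < 0" | "w = 0" by linarith
  then show ?thesis
  proof cases
    case 1
    have "((\<lambda>w. w powr p) has_real_derivative p * w powr (p - 1)) (at w)" by (rule has_real_derivative_powr[OF 1])
    also have "p * w powr (p - 1) = p * \<bar>w\<bar> powr (p - 2) * w" using 1 powr_add[of w "p - 2" 1] by simp
    finally show ?thesis
      by (rule has_field_derivative_transform_within_open[of _ _ _ "{0<..}"]) (use 1 in auto)
  next
    case 2
    have "((\<lambda>w. (- w) powr p) has_real_derivative p * (- w) powr (p - 1) * - 1) (at w)"
      by (rule DERIV_chain2[OF has_real_derivative_powr]) (use 2 in \<open>auto intro!: derivative_eq_intros\<close>)
    also have "p * (- w) powr (p - 1) * - 1 = p * \<bar>w\<bar> powr (p - 2) * w" using 2 powr_add[of "- w" "p - 2" 1] by simp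
    finally show ?thesis
      by (rule has_field_derivative_transform_within_open[of _ _ _ "{..<0}"]) (use 2 in auto)
  next
    case 3
    have "isCont (\<lambda>z::real. \<bar>z\<bar> powr (p - 2) * z) 0"
      unfolding isCont_def using assms by (auto intro!: tendsto_eq_intros tendsto_powr')
    moreover have "\<bar>z\<bar> powr p = \<bar>z\<bar> powr (p - 2) * z * z" for z :: real
      using powr_add[of "\<bar>z\<bar>" "p - 2" 2] by (cases "z = 0") (auto simp: power2_eq_square)
    ultimately show ?thesis unfolding CARAT_DERIV 3
      by (intro exI[of _ "\<lambda>z. \<bar>z\<bar> powr (p - 2) * z"]) auto
  qed
qed

lemma has_field_derivative_zero_constant_pos:
  fixes f :: "real \<Rightarrow> real"
  assumes d: "\<And>x. 0 < x \<Longrightarrow> (f has_real_derivative 0) (at x)" and x: "0 < x" and y: "0 < y"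
  shows "f x = f y"
proof -
  have "\<exists>k. \<forall>x\<in>{0<..}. f x = k"
    by (rule has_field_derivative_zero_constant)
       (use d in \<open>auto intro: has_field_derivative_at_within\<close>)
  then show ?thesis using x y by auto
qed

context supercritical_nls
begin

lemma DERIV_shifted':
  assumes s: "0 < \<sigma>"
  shows "(shifted' \<sigma> T has_real_derivative \<sigma>\<^sup>2 * shifted \<sigma> T x - shifted \<sigma> T x powr (p - 2) * shifted \<sigma> T x) (at x)"
proof -
  define t where "t = tanh (\<sigma> / b * x - T)"
  have "((\<lambda>x. \<sigma> / b * x - T) has_real_derivative \<sigma> / b) (at x)" using b_bounds(3) by (auto intro!: derivative_eq_intros)
  moreover have "(tanh has_real_derivative 1 - t\<^sup>2) (at (\<sigma> / b * x - T))" unfolding t_def by (auto intro!: derivative_eq_intros)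
  ultimately have dt: "((\<lambda>x. tanh (\<sigma> / b * x - T)) has_real_derivative (1 - t\<^sup>2) * (\<sigma> / b)) (at x)"
    by (rule DERIV_chain2[rotated])
  have "(shifted' \<sigma> T has_real_derivative (- \<sigma> * ((1 - t\<^sup>2) * (\<sigma> / b))) * shifted \<sigma> T x + shifted' \<sigma> T x * (- \<sigma> * t)) (at x)"
    unfolding shifted'_def[abs_def] t_def
    by (intro DERIV_mult DERIV_cmult dt[unfolded t_def] DERIV_shifted[unfolded shifted'_def])
  also have "(- \<sigma> * ((1 - t\<^sup>2) * (\<sigma> / b))) * shifted \<sigma> T x + shifted' \<sigma> T x * (- \<sigma> * t)
     = \<sigma>\<^sup>2 * shifted \<sigma> T x - shifted \<sigma> T x powr (p - 2) * shifted \<sigma> T x"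
  proof -
    have h: "p / 2 = 1 + 1 / b" by (simp add: p_eq)
    have q: "shifted \<sigma> T x powr (p - 2) = (1 + 1 / b) * \<sigma>\<^sup>2 * (1 - t\<^sup>2)"
      using shifted_powr_minus[OF s, of T x] by (simp only: h t_def)
    show ?thesis unfolding shifted'_def t_def[symmetric] q
      by (simp add: power2_eq_square algebra_simps diff_divide_distrib add_divide_distrib)
  qed
  finally show ?thesis .
qed

lemma profile_bound_state:
  assumes s: "\<alpha> < \<sigma>"
  shows "profile \<sigma> (centre \<sigma>) \<in> bound_states p \<alpha> (mass_curve \<sigma>)"
proof -
  have s0: "0 < \<sigma>" using s alpha by simp
  let ?T = "centre \<sigma>"
  have "solves_nls_half p \<alpha> (\<sigma>\<^sup>2) (profile \<sigma> ?T)"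
    unfolding solves_nls_half_def
  proof (intro exI conjI allI impI)
    fix x :: real
    show "(profile \<sigma> ?T has_real_derivative shifted' \<sigma> ?T x) (at x within {0..})" if "0 \<le> x"
      by (rule has_field_derivative_transform_within[OF has_field_derivative_at_within[OF DERIV_shifted], of 1])
         (use that in \<open>auto simp: profile_eq\<close>)
    show "(shifted' \<sigma> ?T has_real_derivative \<sigma>\<^sup>2 * shifted \<sigma> ?T x - shifted \<sigma> ?T x powr (p - 2) * shifted \<sigma> ?T x) (at x)"
      by (rule DERIV_shifted'[OF s0])
    show "- (\<sigma>\<^sup>2 * shifted \<sigma> ?T x - shifted \<sigma> ?T x powr (p - 2) * shifted \<sigma> ?T x)
       - \<bar>profile \<sigma> ?T x\<bar> powr (p - 2) * profile \<sigma> ?T x + \<sigma>\<^sup>2 * profile \<sigma> ?T x = 0" if "0 < x"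
      using that shifted_pos[OF s0, of ?T x] by (simp add: profile_eq)
    show "shifted' \<sigma> ?T 0 = \<alpha> * profile \<sigma> ?T 0"
      using tanh_centre[OF s] s0 by (simp add: shifted'_def profile_eq)
  qed
  then show ?thesis
    using profile_H1(1)[OF s0] mass_profile[OF s0] s s0 by (auto simp: bound_states_def H1_mass_def mass_curve_def intro!: exI[of _ "\<sigma>\<^sup>2"])
qed

text \<open>The difference of the two sides is a constant N. As u tends to 0, u'^2 tends to N; were
  N positive, |u'| would eventually exceed some e > 0 while u varies by less than e over unit
  intervals, against the mean value theorem.\<close>

lemma first_integral:
  assumes r: "sobolev_rep u V" and u': "\<And>x. 0 < x \<Longrightarrow> (u has_real_derivative u' x) (at x)"
    and u'': "\<And>x. 0 < x \<Longrightarrow> (u' has_real_derivative \<omega> * u x - \<bar>u x\<bar> powr (p - 2) * u x) (at x)"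
    and x: "0 < x"
  shows "(u' x)\<^sup>2 = \<omega> * (u x)\<^sup>2 - 2 / p * \<bar>u x\<bar> powr p"
proof -
  define N where "N x = (u' x)\<^sup>2 - \<omega> * (u x)\<^sup>2 + 2 / p * \<bar>u x\<bar> powr p" for x
  have p2: "2 < p" "0 < p" using p4 by auto
  have dN: "(N has_real_derivative 0) (at y)" if y: "0 < y" for y
  proof -
    have 1: "((\<lambda>x. (u' x)\<^sup>2) has_real_derivative 2 * u' y * (\<omega> * u y - \<bar>u y\<bar> powr (p - 2) * u y)) (at y)"
      using DERIV_power[OF u''[OF y], of 2] by (simp add: mult_ac)
    have 2: "((\<lambda>x. \<omega> * (u x)\<^sup>2) has_real_derivative \<omega> * (2 * u y * u' y)) (at y)"
      using DERIV_cmult[OF DERIV_power[OF u'[OF y], of 2], of \<omega>] by (simp add: mult_ac)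
    have 3: "((\<lambda>x. 2 / p * \<bar>u x\<bar> powr p) has_real_derivative 2 / p * (p * \<bar>u y\<bar> powr (p - 2) * u y * u' y)) (at y)"
      by (rule DERIV_cmult[OF DERIV_chain2[OF DERIV_abs_powr[OF p2(1)] u'[OF y]]])
    show ?thesis unfolding N_def[abs_def]
      by (rule DERIV_cong[OF DERIV_add[OF DERIV_diff[OF 1 2] 3]]) (use p2 in \<open>simp add: algebra_simps\<close>)
  qed
  have Nc: "N y = N x" if "0 < y" for y
    by (rule has_field_derivative_zero_constant_pos[OF dN that x])
  have ut: "(u \<longlongrightarrow> 0) at_top" by (rule sobolev_rep_tendsto_0[OF r])
  have t: "((\<lambda>y. \<bar>u y\<bar> powr p) \<longlongrightarrow> \<bar>0\<bar> powr p) at_top"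
    by (rule isCont_tendsto_compose[OF DERIV_isCont[OF DERIV_abs_powr[OF p2(1)]] ut])
  have "((\<lambda>y. N x + (\<omega> * (u y)\<^sup>2 - 2 / p * \<bar>u y\<bar> powr p)) \<longlongrightarrow> N x + (\<omega> * 0\<^sup>2 - 2 / p * \<bar>0\<bar> powr p)) at_top"
    by (rule tendsto_add[OF tendsto_const tendsto_diff[OF tendsto_mult[OF tendsto_const tendsto_power[OF ut]] tendsto_mult[OF tendsto_const t]]])
  then have "((\<lambda>y. N x + (\<omega> * (u y)\<^sup>2 - 2 / p * \<bar>u y\<bar> powr p)) \<longlongrightarrow> N x) at_top" by simp
  then have lim: "((\<lambda>y. (u' y)\<^sup>2) \<longlongrightarrow> N x) at_top"
  proof (rule Lim_transform_eventually)
    show "\<forall>\<^sub>F y in at_top. N x + (\<omega> * (u y)\<^sup>2 - 2 / p * \<bar>u y\<bar> powr p) = (u' y)\<^sup>2"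
      using eventually_gt_at_top[of 0]
    proof eventually_elim
      case (elim y)
      then show ?case using Nc[OF elim] unfolding N_def[of y] by simp
    qed
  qed
  have "N x = 0"
  proof (rule ccontr)
    assume "N x \<noteq> 0"
    moreover have "0 \<le> N x" by (rule tendsto_lowerbound[OF lim]) auto
    ultimately have E: "0 < N x" by simp
    define e where "e = sqrt (N x / 2)"
    have e: "0 < e" "e\<^sup>2 = N x / 2" using E by (auto simp: e_def)
    have "\<forall>\<^sub>F y in at_top. N x / 2 < (u' y)\<^sup>2" using order_tendstoD(1)[OF lim, of "N x / 2"] E by simp
    moreover have "\<forall>\<^sub>F y in at_top. \<bar>u y\<bar> < e / 2" using order_tendstoD(2)[OF tendsto_rabs_zero[OF ut], of "e / 2"] e by simp
    ultimately have "\<forall>\<^sub>F y in at_top. N x / 2 < (u' y)\<^sup>2 \<and> \<bar>u y\<bar> < e / 2 \<and> 0 < y"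
      using eventually_gt_at_top[of 0] by eventually_elim blast
    then obtain R where "\<forall>y\<ge>R. N x / 2 < (u' y)\<^sup>2 \<and> \<bar>u y\<bar> < e / 2 \<and> 0 < y"
      unfolding eventually_at_top_linorder ..
    note R = this[rule_format]
    have "\<exists>z>R. z < R + 1 \<and> u (R + 1) - u R = (R + 1 - R) * u' z"
    proof (rule MVT2)
      fix y assume "R \<le> y"
      then have "0 < y" using R by blast
      then show "(u has_real_derivative u' y) (at y)" by (rule u')
    qed simp
    then obtain z where z: "R < z" "z < R + 1" "u (R + 1) - u R = (R + 1 - R) * u' z" by blast
    have "e\<^sup>2 < \<bar>u' z\<bar>\<^sup>2" using R[of z] z e by simp
    then have "e < \<bar>u' z\<bar>" by (rule power2_less_imp_less) simp
    moreover have "\<bar>u (R + 1) - u R\<bar> < e" using R[of R] R[of "R + 1"] abs_triangle_ineq4[of "u (R + 1)" "u R"] by simp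
    ultimately show False using z by simp
  qed
  then show ?thesis by (simp add: N_def)
qed

text \<open>A Gronwall argument in both directions: the bound on u' makes u^2 with a suitable
  exponential weight monotone, so a zero spreads over the open half-line.\<close>

lemma no_zero:
  assumes u': "\<And>x. 0 < x \<Longrightarrow> (u has_real_derivative u' x) (at x)"
    and le: "\<And>x. 0 < x \<Longrightarrow> \<bar>u' x\<bar> \<le> \<sigma> * \<bar>u x\<bar>" and x: "0 < x" "u x = 0" and y: "0 < y"
  shows "u y = 0"
proof -
  have d: "((\<lambda>x. (u x)\<^sup>2 * exp (k * x)) has_real_derivative (2 * u z * u' z + k * (u z)\<^sup>2) * exp (k * z)) (at z)" if "0 < z" for k z
    using DERIV_mult[OF DERIV_power[OF u'[OF that], of 2] DERIV_chain2[OF DERIV_exp DERIV_cmult[OF DERIV_ident, of k]]]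
    by (simp add: algebra_simps)
  have b: "\<bar>2 * u z * u' z\<bar> \<le> 2 * \<sigma> * (u z)\<^sup>2" if "0 < z" for z
    using mult_left_mono[OF le[OF that], of "2 * \<bar>u z\<bar>"] by (simp add: abs_mult power2_eq_square algebra_simps)
  \<comment> \<open>The sign of k depends on the side of x on which y lies; in both cases the
    weighted square at y is at most the one at x, which is 0.\<close>
  have "(u y)\<^sup>2 * exp (k * y) \<le> (u x)\<^sup>2 * exp (k * x)" if "k = (if x \<le> y then - 2 * \<sigma> else 2 * \<sigma>)" for k
  proof (cases "x \<le> y")
    case True
    show ?thesis
    proof (rule DERIV_nonpos_imp_nonincreasing[OF True])
      fix z assume "x \<le> z" "z \<le> y"
      then have z: "0 < z" using x by simp
      have "(2 * u z * u' z + k * (u z)\<^sup>2) * exp (k * z) \<le> 0" using b[OF z] True that by (intro mult_nonpos_nonneg) auto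
      then show "\<exists>d. ((\<lambda>x. (u x)\<^sup>2 * exp (k * x)) has_real_derivative d) (at z) \<and> d \<le> 0" using d[OF z, of k] by blast
    qed
  next
    case False
    show ?thesis
    proof (rule DERIV_nonneg_imp_nondecreasing[of y x])
      fix z assume "y \<le> z" "z \<le> x"
      then have z: "0 < z" using y by simp
      have "0 \<le> (2 * u z * u' z + k * (u z)\<^sup>2) * exp (k * z)" using b[OF z] False that by (intro mult_nonneg_nonneg) auto
      then show "\<exists>d. ((\<lambda>x. (u x)\<^sup>2 * exp (k * x)) has_real_derivative d) (at z) \<and> d \<ge> 0" using d[OF z, of k] by blast
    qed (use False in simp)
  qed
  note this[OF refl]
  then obtain k where "(u y)\<^sup>2 * exp (k * y) \<le> (u x)\<^sup>2 * exp (k * x)" ..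
  then have "(u y)\<^sup>2 * exp (k * y) \<le> 0 * exp (k * y)" using x by simp
  then have "(u y)\<^sup>2 \<le> 0" by (rule mult_right_le_imp_le) simp
  then show ?thesis by simp
qed

text \<open>The logarithmic derivative solves a Riccati equation, so that \<open>artanh (- w' / (\<sigma> w))\<close> is affine.\<close>

lemma positive_solution_shifted:
  assumes s: "0 < \<sigma>" and w: "\<And>x. 0 < x \<Longrightarrow> 0 < w x"
    and w': "\<And>x. 0 < x \<Longrightarrow> (w has_real_derivative w' x) (at x)"
    and w'': "\<And>x. 0 < x \<Longrightarrow> (w' has_real_derivative \<sigma>\<^sup>2 * w x - w x powr (p - 2) * w x) (at x)"
    and fi: "\<And>x. 0 < x \<Longrightarrow> (w' x)\<^sup>2 = \<sigma>\<^sup>2 * (w x)\<^sup>2 - 2 / p * w x powr p"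
  shows "\<exists>T. \<forall>x>0. w x = shifted \<sigma> T x"
proof -
  define y where "y x = - w' x / (\<sigma> * w x)" for x
  \<comment> \<open>The first integral divided by w^2: the nonlinear term becomes a function of y
    alone, which closes the Riccati equation.\<close>
  have ysq: "w x powr (p - 2) = p / 2 * \<sigma>\<^sup>2 * (1 - (y x)\<^sup>2)" if x: "0 < x" for x
  proof -
    have "w x powr p = w x powr (p - 2) * (w x)\<^sup>2" using w[OF x] powr_add[of "w x" "p - 2" 2] by simp
    then have "(w' x)\<^sup>2 = (w x)\<^sup>2 * (\<sigma>\<^sup>2 - 2 / p * w x powr (p - 2))" using fi[OF x] by (simp add: algebra_simps)
    moreover have "(w' x)\<^sup>2 = (y x)\<^sup>2 * (\<sigma>\<^sup>2 * (w x)\<^sup>2)" using w[OF x] s by (simp add: y_def power_divide power_mult_distrib)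
    ultimately have "(w x)\<^sup>2 * (\<sigma>\<^sup>2 * (y x)\<^sup>2) = (w x)\<^sup>2 * (\<sigma>\<^sup>2 - 2 / p * w x powr (p - 2))" by (simp add: mult_ac)
    then have "\<sigma>\<^sup>2 * (y x)\<^sup>2 = \<sigma>\<^sup>2 - 2 / p * w x powr (p - 2)" using w[OF x] by simp
    then show ?thesis using p4 by (simp add: field_simps)
  qed
  have y1: "\<bar>y x\<bar> < 1" if x: "0 < x" for x
  proof -
    have "0 < p / 2 * \<sigma>\<^sup>2 * (1 - (y x)\<^sup>2)" using w[OF x] by (subst ysq[OF x, symmetric]) simp
    then have "0 < 1 - (y x)\<^sup>2" by (rule zero_less_mult_pos) (use p4 s in simp)
    then have "(y x)\<^sup>2 < 1" by simp
    then show ?thesis by (simp add: abs_square_less_1)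
  qed
  have dy: "(y has_real_derivative \<sigma> / b * (1 - (y x)\<^sup>2)) (at x)" if x: "0 < x" for x
  proof -
    have "(y has_real_derivative (- (\<sigma>\<^sup>2 * w x - w x powr (p - 2) * w x) * (\<sigma> * w x) - (- w' x) * (\<sigma> * w' x)) / ((\<sigma> * w x) * (\<sigma> * w x))) (at x)"
      unfolding y_def[abs_def]
      by (rule DERIV_divide[OF DERIV_minus[OF w''[OF x]] DERIV_cmult[OF w'[OF x]]]) (use s w[OF x] in auto)
    also have "(- (\<sigma>\<^sup>2 * w x - w x powr (p - 2) * w x) * (\<sigma> * w x) - (- w' x) * (\<sigma> * w' x)) / ((\<sigma> * w x) * (\<sigma> * w x)) = \<sigma> / b * (1 - (y x)\<^sup>2)"
    proof -
      have wy: "w' x = - (y x * \<sigma> * w x)" using w[OF x] s by (simp add: y_def)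
      have h: "p / 2 = 1 + 1 / b" by (simp add: p_eq)
      have q: "w x powr (p - 2) = (1 + 1 / b) * \<sigma>\<^sup>2 * (1 - (y x)\<^sup>2)" using ysq[OF x] by (simp only: h)
      have "- (\<sigma>\<^sup>2 * w x - w x powr (p - 2) * w x) * (\<sigma> * w x) - (- w' x) * (\<sigma> * w' x)
         = (\<sigma> / b * (1 - (y x)\<^sup>2)) * ((\<sigma> * w x) * (\<sigma> * w x))"
        unfolding wy q by (simp add: power2_eq_square algebra_simps)
      then show ?thesis using w[OF x] s by simp
    qed
    finally show ?thesis .
  qed
  define g where "g x = artanh (y x) - \<sigma> / b * x" for x
  have dg: "(g has_real_derivative 0) (at x)" if x: "0 < x" for x
  proof -
    have "(y x)\<^sup>2 < 1" using y1[OF x] by (simp add: abs_square_less_1)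
    then have "(y x)\<^sup>2 \<noteq> 1" by simp
    then show ?thesis unfolding g_def[abs_def]
      by (intro DERIV_cong[OF DERIV_diff[OF DERIV_chain2[OF artanh_real_has_field_derivative[OF y1[OF x]] dy[OF x]] DERIV_cmult[OF DERIV_ident, of "\<sigma> / b"]]])
         simp
  qed
  have gc: "g x = g 1" if "0 < x" for x
    by (rule has_field_derivative_zero_constant_pos[OF dg that zero_less_one])
  have "w x = shifted \<sigma> (- g 1) x" if x: "0 < x" for x
  proof -
    have "artanh (y x) = \<sigma> / b * x - - g 1" using gc[OF x] by (simp add: g_def)
    then have yx: "tanh (\<sigma> / b * x - - g 1) = y x" using tanh_artanh_real[OF y1[OF x]] by simp
    have "w x powr (p - 2) = shifted \<sigma> (- g 1) x powr (p - 2)"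
      unfolding ysq[OF x] shifted_powr_minus[OF s] yx ..
    then have "(w x powr (p - 2)) powr (1 / (p - 2)) = (shifted \<sigma> (- g 1) x powr (p - 2)) powr (1 / (p - 2))" by simp
    then show ?thesis using p4 w[OF x] shifted_pos[OF s, of "- g 1" x] by (simp add: powr_powr)
  qed
  then show ?thesis by blast
qed

text \<open>The first integral gives |u'| \<le> \<sigma> |u|, so u has no zero and a fixed sign. The
  equation determines the shape on the open half-line and continuity carries it to 0, where the
  boundary condition becomes tanh T = \<alpha> / \<sigma>. Since tanh stays below 1, this forces
  \<alpha> < \<sigma>.\<close>

lemma bound_state_classification:
  assumes u: "u \<in> bound_states p \<alpha> \<mu>" and m: "0 < \<mu>"
  obtains \<sigma> where "\<alpha> < \<sigma>" "mass_curve \<sigma> = \<mu>" "positive_half u \<longrightarrow> u = profile \<sigma> (centre \<sigma>)"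
proof -
  have uH: "u \<in> H1_half" and um: "(LINT x:{0<..}|lborel. (u x)\<^sup>2) = \<mu>" using u by (auto simp: bound_states_def H1_mass_def mass_def)
  obtain \<omega> where \<omega>: "0 < \<omega>" and sol: "solves_nls_half p \<alpha> \<omega> u" using u by (auto simp: bound_states_def)
  obtain u' u'' where d: "\<forall>x\<ge>0. (u has_real_derivative u' x) (at x within {0..})"
    "\<forall>x>0. (u' has_real_derivative u'' x) (at x)"
    "\<forall>x>0. - u'' x - \<bar>u x\<bar> powr (p - 2) * u x + \<omega> * u x = 0" and bc: "u' 0 = \<alpha> * u 0"
    using sol unfolding solves_nls_half_def by blast
  note d1 = d(1)[rule_format] and d2 = d(2)[rule_format] and eq = d(3)[rule_format]
  define \<sigma> where "\<sigma> = sqrt \<omega>"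
  have s: "0 < \<sigma>" "\<sigma>\<^sup>2 = \<omega>" using \<omega> by (auto simp: \<sigma>_def)
  obtain V where r: "sobolev_rep u V" using H1_half_sobolev_rep[OF uH] by blast
  have uc: "continuous_on {0..} u" using r by (simp add: sobolev_rep_def)
  have d1': "(u has_real_derivative u' x) (at x)" if "0 < x" for x
  proof -
    have "at x within {0..} = at x" using that by (intro at_within_interior) auto
    then show ?thesis using d1[of x] that by simp
  qed
  have d2': "(u' has_real_derivative \<omega> * u x - \<bar>u x\<bar> powr (p - 2) * u x) (at x)" if "0 < x" for x
    by (rule DERIV_cong[OF d2[OF that]]) (use eq[OF that] in linarith)
  have fi: "(u' x)\<^sup>2 = \<omega> * (u x)\<^sup>2 - 2 / p * \<bar>u x\<bar> powr p" if "0 < x" for x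
    by (rule first_integral[OF r _ _ that]) (use d1' d2' in auto)
  have le: "\<bar>u' x\<bar> \<le> \<sigma> * \<bar>u x\<bar>" if "0 < x" for x
  proof (rule power2_le_imp_le)
    show "\<bar>u' x\<bar>\<^sup>2 \<le> (\<sigma> * \<bar>u x\<bar>)\<^sup>2" using fi[OF that] p4 by (simp add: power_mult_distrib s)
  qed (use s in simp)
  have nz: "u x \<noteq> 0" if x: "0 < x" for x
  proof
    assume ux: "u x = 0"
    have z: "u y = 0" if "0 < y" for y
      by (rule no_zero[of u u' \<sigma> x y]) (use d1' le x ux that in auto)
    have "(LINT x:{0<..}|lborel. (u x)\<^sup>2) = (LINT x:{0::real<..}|lborel. 0 :: real)"
      by (rule set_lebesgue_integral_cong) (use z in auto)
    then show False using um m by simp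
  qed
  \<comment> \<open>The sign of u at one point is its sign everywhere, as u has no zero; it reduces
    the problem to a positive solution.\<close>
  define \<epsilon> where "\<epsilon> = sgn (u 1)"
  have \<epsilon>: "\<epsilon> = 1 \<or> \<epsilon> = - 1" using nz[of 1] by (auto simp: \<epsilon>_def sgn_if)
  define w where "w x = \<epsilon> * u x" for x
  have wpos: "0 < w x" if x: "0 < x" for x
  proof (rule ccontr)
    assume "\<not> 0 < w x"
    moreover have "0 < w 1" using nz[of 1] by (auto simp: w_def \<epsilon>_def sgn_if)
    moreover have c: "continuous_on {a..b'} w" if "0 < a" for a b'
      unfolding w_def[abs_def] by (intro continuous_intros continuous_on_subset[OF uc]) (use that in auto)
    ultimately have "\<exists>z>0. w z = 0"
    proof (cases "x \<le> 1")
      case True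
      then obtain z where "x \<le> z" "w z = 0"
        using IVT'[of w x 0 1] c[OF x, of 1] \<open>0 < w 1\<close> \<open>\<not> 0 < w x\<close> by auto
      then show ?thesis using x by (intro exI[of _ z]) simp
    next
      case False
      then obtain z where "1 \<le> z" "w z = 0"
        using IVT2'[of w x 0 1] c[of 1 x] \<open>0 < w 1\<close> \<open>\<not> 0 < w x\<close> by auto
      then show ?thesis by (intro exI[of _ z]) simp
    qed
    then obtain z where "0 < z" "w z = 0" by blast
    then show False using nz[of z] \<epsilon> by (auto simp: w_def)
  qed
  have wa: "\<bar>u x\<bar> = w x" if "0 < x" for x using wpos[OF that] \<epsilon> by (auto simp: w_def)
  have wsq: "(u x)\<^sup>2 = (w x)\<^sup>2" for x using \<epsilon> by (auto simp: w_def)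
  have "\<exists>T. \<forall>x>0. w x = shifted \<sigma> T x"
  proof (rule positive_solution_shifted[OF s(1) wpos])
    fix x :: real assume x: "0 < x"
    show "(w has_real_derivative \<epsilon> * u' x) (at x)" unfolding w_def[abs_def] by (rule DERIV_cmult[OF d1'[OF x]])
    show "((\<lambda>x. \<epsilon> * u' x) has_real_derivative \<sigma>\<^sup>2 * w x - w x powr (p - 2) * w x) (at x)"
      by (rule DERIV_cong[OF DERIV_cmult[OF d2'[OF x], of \<epsilon>]])
         (simp add: wa[OF x] s(2), simp add: w_def algebra_simps)
    show "(\<epsilon> * u' x)\<^sup>2 = \<sigma>\<^sup>2 * (w x)\<^sup>2 - 2 / p * w x powr p"
      using fi[OF x] \<epsilon> by (auto simp: wa[OF x] wsq s(2) power_mult_distrib)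
  qed
  then obtain T where T: "\<And>x. 0 < x \<Longrightarrow> w x = shifted \<sigma> T x" by blast
  have wc: "continuous_on {0..} w" unfolding w_def[abs_def] by (intro continuous_intros uc)
  have T0: "w x = shifted \<sigma> T x" if "0 \<le> x" for x
  proof -
    have "w x - shifted \<sigma> T x = 0"
      by (rule continuous_constant_on_closure[of "{0<..}" "\<lambda>x. w x - shifted \<sigma> T x"])
         (use that T in \<open>auto intro!: continuous_intros wc continuous_on_shifted\<close>)
    then show ?thesis by simp
  qed
  \<comment> \<open>u' at 0 is only a one-sided derivative, but that is unique because 0 is a limit
    point of the half-line.\<close>
  have "\<epsilon> * u' 0 = shifted' \<sigma> T 0"
  proof (rule has_field_derivative_unique)
    show "(w has_real_derivative \<epsilon> * u' 0) (at 0 within {0..})"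
      unfolding w_def[abs_def] by (rule DERIV_cmult[OF d1]) simp
    show "(w has_real_derivative shifted' \<sigma> T 0) (at 0 within {0..})"
      by (rule has_field_derivative_transform_within[OF has_field_derivative_at_within[OF DERIV_shifted], of 1])
         (use T0 in auto)
    show "at 0 within {0::real..} \<noteq> bot" by (simp add: at_within_Ici_at_right)
  qed
  moreover have "\<epsilon> * u' 0 = \<alpha> * shifted \<sigma> T 0" using bc T0[of 0] by (simp add: w_def mult_ac)
  ultimately have tT: "tanh T = \<alpha> / \<sigma>" using shifted_pos[OF s(1), of T 0] s(1) by (simp add: shifted'_def field_simps)
  have "\<alpha> / \<sigma> < 1" using tanh_real_lt_1[of T] tT by simp
  then have sa: "\<alpha> < \<sigma>" using s by simp
  have Tc: "T = centre \<sigma>" using tT artanh_tanh_real[of T] by (simp add: centre_def)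
  have "mass_curve \<sigma> = profile_mass \<sigma> T" using sa Tc by (simp add: mass_curve_def)
  also have "\<dots> = (LINT x:{0<..}|lborel. (shifted \<sigma> T x)\<^sup>2)" using shifted_integrals(2)[OF s(1)] by simp
  also have "\<dots> = (LINT x:{0<..}|lborel. (u x)\<^sup>2)" by (rule set_lebesgue_integral_cong) (auto simp: wsq T)
  finally have mc: "mass_curve \<sigma> = \<mu>" using um by simp
  show ?thesis
  proof (rule that[OF sa mc], rule impI)
    assume "positive_half u"
    then have "\<epsilon> = 1" by (simp add: \<epsilon>_def positive_half_def)
    then have "u x = shifted \<sigma> (centre \<sigma>) x" if "0 \<le> x" for x using T0[OF that] by (simp add: w_def Tc)
    moreover have "u \<in> extensional {0..}" using uH by (simp add: H1_half_def)
    ultimately show "u = profile \<sigma> (centre \<sigma>)"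
      by (intro extensionalityI[of u "{0..}"]) (auto simp: profile_def)
  qed
qed


section \<open>Mass thresholds\<close>

lemma amp_le_imp_le:
  assumes "0 < \<sigma>" "0 < \<tau>" "amp \<sigma> \<le> amp \<tau>"
  shows "\<sigma> \<le> \<tau>"
proof (rule ccontr)
  assume "\<not> \<sigma> \<le> \<tau>"
  then have "\<tau> powr b < \<sigma> powr b" using assms b_bounds by (intro powr_less_mono2) auto
  then show False using assms(3) c_pos by (simp add: amp_def)
qed

text \<open>The peak of a profile with positive centre lies in the half-line, so the profile
  determines its maximum and thereby its frequency. Distinct points of the mass curve thus give
  distinct bound states.\<close>

lemma profile_eq_imp_le:
  assumes s: "\<alpha> < \<sigma>" and t: "\<alpha> < \<tau>" and eq: "profile \<sigma> (centre \<sigma>) = profile \<tau> (centre \<tau>)"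
  shows "\<sigma> \<le> \<tau>"
proof (rule amp_le_imp_le)
  \<comment> \<open>The point at which the first profile peaks.\<close>
  define x where "x = b * centre \<sigma> / \<sigma>"
  have p: "0 < \<sigma>" "0 < \<tau>" using s t alpha by auto
  show "0 < \<sigma>" "0 < \<tau>" by fact+
  have x: "0 \<le> x" using p b_bounds centre_pos[OF s] by (simp add: x_def)
  have "\<sigma> / b * x - centre \<sigma> = 0" using p b_bounds by (simp add: x_def)
  then have "amp \<sigma> = profile \<sigma> (centre \<sigma>) x" using x by (simp only: profile_eq shifted_def) simp
  also have "\<dots> = shifted \<tau> (centre \<tau>) x" unfolding eq using x by (rule profile_eq)
  also have "\<dots> \<le> amp \<tau> * 1"
    unfolding shifted_def
  proof (rule mult_left_mono)
    have "1 powr (- b) \<ge> cosh (\<tau> / b * x - centre \<tau>) powr (- b)"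
      using b_bounds by (intro powr_mono2') (auto simp: cosh_real_ge_1)
    then show "cosh (\<tau> / b * x - centre \<tau>) powr (- b) \<le> 1" by simp
  qed (use amp_pos[OF p(2)] in simp)
  finally show "amp \<sigma> \<le> amp \<tau>" by simp
qed

text \<open>The profile attains the minimum of the envelope, which bounds every energy from below.
  Another positive ground state comes with a frequency \<tau> > \<alpha> at which the envelope has
  the same minimal value; uniqueness gives \<tau> = \<sigma>, and equality in the lower bound gives
  the profile.\<close>

lemma ground_state_exists:
  assumes \<mu>: "0 < \<mu>" and s: "\<alpha> < \<sigma>" "mass_curve \<sigma> = \<mu>" and min: "\<forall>\<tau>>0. envelope \<mu> \<sigma> \<le> envelope \<mu> \<tau>"
    and uniq: "\<forall>\<tau>>\<alpha>. envelope \<mu> \<tau> = envelope \<mu> \<sigma> \<longrightarrow> \<tau> = \<sigma>"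
  shows "\<exists>!u. u \<in> ground_states p \<alpha> \<mu> \<and> positive_half u"
proof (rule ex1I[of _ "profile \<sigma> (centre \<sigma>)"])
  note P = profile_ground_energy[OF s(1), unfolded s(2)]
  have "energy p \<alpha> (profile \<sigma> (centre \<sigma>)) \<le> energy p \<alpha> w" if w: "w \<in> H1_mass \<mu>" for w
  proof -
    obtain \<tau> where "0 < \<tau>" "envelope \<mu> \<tau> \<le> energy p \<alpha> w" using energy_ge_envelope[OF w \<mu>] by metis
    moreover have "envelope \<mu> \<sigma> \<le> envelope \<mu> \<tau>" using min \<open>0 < \<tau>\<close> by simp
    ultimately show ?thesis using P(2) by simp
  qed
  then show "profile \<sigma> (centre \<sigma>) \<in> ground_states p \<alpha> \<mu> \<and> positive_half (profile \<sigma> (centre \<sigma>))"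
    using P by (simp add: ground_states_iff)
  fix u assume u: "u \<in> ground_states p \<alpha> \<mu> \<and> positive_half u"
  then have um: "u \<in> H1_mass \<mu>" and le: "energy p \<alpha> u \<le> envelope \<mu> \<sigma>"
    using P by (auto simp: ground_states_iff)
  obtain \<tau> where t: "0 < \<tau>" "envelope \<mu> \<tau> \<le> energy p \<alpha> u" "energy p \<alpha> u \<le> envelope \<mu> \<tau> \<longrightarrow> \<alpha> < \<tau>"
    "energy p \<alpha> u \<le> envelope \<mu> \<tau> \<and> positive_half u \<and> mass_curve \<tau> = \<mu> \<longrightarrow> u = profile \<tau> (centre \<tau>)"
    using energy_ge_envelope[OF um \<mu>] by metis
  have "envelope \<mu> \<sigma> \<le> envelope \<mu> \<tau>" using min t by simp
  then have e: "envelope \<mu> \<tau> = envelope \<mu> \<sigma>" "energy p \<alpha> u \<le> envelope \<mu> \<tau>" using t(2) le by linarith+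
  then have "\<tau> = \<sigma>" using uniq t(3) by blast
  then show "u = profile \<sigma> (centre \<sigma>)" using t(4) e u s by blast
qed

text \<open>Escaping solitons keep the energy of a ground state at or below the minimum of the
  envelope. The lower bound is then attained, at a frequency beyond \<alpha>, where the envelope is
  strictly larger.\<close>

lemma no_ground_state:
  assumes \<mu>: "0 < \<mu>" and s: "0 < \<sigma>" "\<sigma> \<le> \<alpha>" "mass_curve \<sigma> = \<mu>"
    and min: "\<forall>\<tau>>0. envelope \<mu> \<sigma> \<le> envelope \<mu> \<tau>" and strict: "\<forall>\<tau>>\<alpha>. envelope \<mu> \<sigma> < envelope \<mu> \<tau>"
  shows "u \<notin> ground_states p \<alpha> \<mu>"
proof
  assume u: "u \<in> ground_states p \<alpha> \<mu>"
  then have um: "u \<in> H1_mass \<mu>" by (simp add: ground_states_iff)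
  have le: "energy p \<alpha> u \<le> envelope \<mu> \<sigma>"
  proof (rule field_le_epsilon)
    fix e :: real assume "0 < e"
    then obtain w where "w \<in> H1_mass \<mu>" "energy p \<alpha> w < envelope \<mu> \<sigma> + e"
      using escaping_solitons[OF s(1,2)] s(3) by blast
    then show "energy p \<alpha> u \<le> envelope \<mu> \<sigma> + e" using u by (force simp: ground_states_iff)
  qed
  obtain \<tau> where t: "0 < \<tau>" "envelope \<mu> \<tau> \<le> energy p \<alpha> u" "energy p \<alpha> u \<le> envelope \<mu> \<tau> \<longrightarrow> \<alpha> < \<tau>"
    using energy_ge_envelope[OF um \<mu>] by metis
  have "envelope \<mu> \<sigma> \<le> envelope \<mu> \<tau>" using min t by simp
  then have "\<alpha> < \<tau>" using le t by linarith
  then have "envelope \<mu> \<sigma> < envelope \<mu> \<tau>" using strict by simp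
  then show False using t(2) le by linarith
qed

end

theorem theorem1p3:
  fixes p \<alpha> :: real
  assumes "4 < p" and "p < 6" and "\<alpha> > 0"
  shows "\<exists>\<mu>s. 0 < \<mu>s \<and> \<mu>s < soliton_mass p (\<alpha>\<^sup>2) \<and>
    (\<forall>\<mu>>0. (\<exists>u. u \<in> bound_states p \<alpha> \<mu>) \<longleftrightarrow> \<mu>s \<le> \<mu>) \<and>
    (\<forall>\<mu>>0. (\<exists>u v. u \<in> bound_states p \<alpha> \<mu> \<and> v \<in> bound_states p \<alpha> \<mu> \<and>
                    positive_half u \<and> positive_half v \<and> u \<noteq> v)
            \<longleftrightarrow> \<mu>s < \<mu> \<and> \<mu> < soliton_mass p (\<alpha>\<^sup>2)) \<and>
    (\<exists>\<mu>t. \<mu>s < \<mu>t \<and> \<mu>t < soliton_mass p (\<alpha>\<^sup>2) \<and>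
      (\<forall>\<mu>>0. (\<exists>u. u \<in> ground_states p \<alpha> \<mu>) \<longleftrightarrow> \<mu>t \<le> \<mu>) \<and>
      (\<forall>\<mu>>0. (\<exists>u. u \<in> ground_states p \<alpha> \<mu>) \<longrightarrow>
              (\<exists>!u. u \<in> ground_states p \<alpha> \<mu> \<and> positive_half u)))"
proof -
  interpret supercritical_nls p \<alpha> "2 / (p - 2)" "(p / 2) powr (2 / (p - 2))"
    by unfold_locales (use assms in auto)
  show ?thesis
  proof (rule mass_thresholds, goal_cases)
    case (1 \<mu>s \<mu>t)
    note th = 1(1-3) and B1 = 1(4) and B2 = 1(5) and G1 = 1(6) and G2 = 1(7)
    have bound: "(\<exists>u. u \<in> bound_states p \<alpha> \<mu>) \<longleftrightarrow> \<mu>s \<le> \<mu>" if m: "0 < \<mu>" for \<mu>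
    proof
      assume "\<exists>u. u \<in> bound_states p \<alpha> \<mu>"
      then obtain \<sigma> where "\<alpha> < \<sigma>" "mass_curve \<sigma> = \<mu>" using bound_state_classification[OF _ m] by metis
      then show "\<mu>s \<le> \<mu>" using B1[of \<mu>] by blast
    next
      assume "\<mu>s \<le> \<mu>"
      then obtain \<sigma> where "\<alpha> < \<sigma>" "mass_curve \<sigma> = \<mu>" using B1[of \<mu>] by blast
      then show "\<exists>u. u \<in> bound_states p \<alpha> \<mu>" using profile_bound_state by blast
    qed
    have two: "(\<exists>u v. u \<in> bound_states p \<alpha> \<mu> \<and> v \<in> bound_states p \<alpha> \<mu> \<and>
        positive_half u \<and> positive_half v \<and> u \<noteq> v) \<longleftrightarrow> \<mu>s < \<mu> \<and> \<mu> < soliton_mass p (\<alpha>\<^sup>2)" if m: "0 < \<mu>" for \<mu>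
    proof
      assume "\<exists>u v. u \<in> bound_states p \<alpha> \<mu> \<and> v \<in> bound_states p \<alpha> \<mu> \<and> positive_half u \<and> positive_half v \<and> u \<noteq> v"
      then obtain u v where uv: "u \<in> bound_states p \<alpha> \<mu>" "v \<in> bound_states p \<alpha> \<mu>" "positive_half u" "positive_half v" "u \<noteq> v"
        by blast
      obtain \<sigma> where s: "\<alpha> < \<sigma>" "mass_curve \<sigma> = \<mu>" "u = profile \<sigma> (centre \<sigma>)"
        using bound_state_classification[OF uv(1) m] uv(3) by metis
      obtain \<tau> where t: "\<alpha> < \<tau>" "mass_curve \<tau> = \<mu>" "v = profile \<tau> (centre \<tau>)"
        using bound_state_classification[OF uv(2) m] uv(4) by metis
      have "\<sigma> \<noteq> \<tau>" using s t uv(5) by blast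
      then show "\<mu>s < \<mu> \<and> \<mu> < soliton_mass p (\<alpha>\<^sup>2)" using B2[of \<mu>] s t by blast
    next
      assume "\<mu>s < \<mu> \<and> \<mu> < soliton_mass p (\<alpha>\<^sup>2)"
      then obtain \<sigma> \<tau> where s: "\<alpha> < \<sigma>" "mass_curve \<sigma> = \<mu>" and t: "\<alpha> < \<tau>" "mass_curve \<tau> = \<mu>" and ne: "\<sigma> \<noteq> \<tau>"
        using B2[of \<mu>] by blast
      have "profile \<sigma> (centre \<sigma>) \<noteq> profile \<tau> (centre \<tau>)"
        using profile_eq_imp_le[OF s(1) t(1)] profile_eq_imp_le[OF t(1) s(1)] ne by force
      then show "\<exists>u v. u \<in> bound_states p \<alpha> \<mu> \<and> v \<in> bound_states p \<alpha> \<mu> \<and> positive_half u \<and> positive_half v \<and> u \<noteq> v"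
        using profile_bound_state[OF s(1), unfolded s(2)] profile_bound_state[OF t(1), unfolded t(2)]
          profile_ground_energy(3)[OF s(1)] profile_ground_energy(3)[OF t(1)] by blast
    qed
    have unique: "\<exists>!u. u \<in> ground_states p \<alpha> \<mu> \<and> positive_half u" if "0 < \<mu>" "\<mu>t \<le> \<mu>" for \<mu>
      using G1[OF that(2)] ground_state_exists[OF that(1)] by blast
    have none: "\<not> (\<exists>u. u \<in> ground_states p \<alpha> \<mu>)" if "0 < \<mu>" "\<mu> < \<mu>t" for \<mu>
      using G2[OF that] no_ground_state[OF that(1)] by blast
    have ground: "(\<exists>u. u \<in> ground_states p \<alpha> \<mu>) \<longleftrightarrow> \<mu>t \<le> \<mu>" if "0 < \<mu>" for \<mu>
      using unique[OF that] none[OF that] by (meson not_le)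
    show ?thesis
      using th bound two ground unique by (intro exI[of _ \<mu>s] conjI exI[of _ \<mu>t] allI impI) auto
  qed
qed

end
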